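(* Let $N\ge 2$ and $1<q<p<N$, and suppose that $\lambda>0$ and $q^*<r<p^*<s$. Consider the equation $$-\Delta_p u-\Delta_q u=|u|^{r-2}u+\lambda|u|^{s-2}u\quad\text{in }\mathbb{R}^N. \qquad (\mathcal P_\lambda)$$ If $p<r$, then there exists a (sufficiently small) $\lambda_0>0$ such that for any $\lambda\in(0,\lambda_0)$ the equation $(\mathcal P_\lambda)$ admits a positive weak solution.
   Context: For $1<m<N$, $m^*=\frac{Nm}{N-m}$, $\Delta_m u=\operatorname{div}(|\nabla u|^{m-2}\nabla u)$, and $\mathcal D^{1,m}(\mathbb{R}^N)=\{u\in L^{m^*}(\mathbb{R}^N): |\nabla u|\in L^m(\mathbb{R}^N)\}$. Set $E=\mathcal D^{1,p}(\mathbb{R}^N)\cap\mathcal D^{1,q}(\mathbb{R}^N)$. A weak solution of $(\mathcal P_\lambda)$ is a function $u\in E$ such that for every $\varphi\in E$ (the integrals being well defined) $$\int_{\mathbb{R}^N}\left(|\nabla u|^{p-2}\nabla u+|\nabla u|^{q-2}\nabla u\right)\cdot\nabla\varphi=\int_{\mathbb{R}^N}\left(|u|^{r-2}u+\lambda|u|^{s-2}u\right)\varphi .$$ Positive means $u>0$ in $\mathbb{R}^N$. *)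

theory Defs
  imports "HOL-Analysis.Analysis"
begin

definition partial_deriv :: "'n \<Rightarrow> (real ^ 'n \<Rightarrow> real) \<Rightarrow> real ^ 'n \<Rightarrow> real" where
  "partial_deriv i f x = frechet_derivative f (at x) (axis i 1)"

text \<open>\<^term>\<open>C_k k f\<close>: the function is k times continuously differentiable on the whole space.\<close>

primrec C_k :: "nat \<Rightarrow> (real ^ 'n \<Rightarrow> real) \<Rightarrow> bool" where
  "C_k 0 f \<longleftrightarrow> continuous_on UNIV f"
| "C_k (Suc k) f \<longleftrightarrow> (\<forall>x. f differentiable at x) \<and> (\<forall>i. C_k k (partial_deriv i f))"

definition test_function :: "(real ^ 'n \<Rightarrow> real) \<Rightarrow> bool" where
  "test_function \<phi> \<longleftrightarrow> (\<forall>k. C_k k \<phi>) \<and> compact (closure {x. \<phi> x \<noteq> 0})"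

definition locally_integrable :: "(real ^ 'n \<Rightarrow> 'b::euclidean_space) \<Rightarrow> bool" where
  "locally_integrable f \<longleftrightarrow> (\<forall>K. compact K \<longrightarrow> f absolutely_integrable_on K)"

definition is_weak_gradient :: "(real ^ 'n \<Rightarrow> real) \<Rightarrow> (real ^ 'n \<Rightarrow> real ^ 'n) \<Rightarrow> bool" where
  "is_weak_gradient u g \<longleftrightarrow> locally_integrable u \<and> locally_integrable g \<and>
     (\<forall>\<phi> i. test_function \<phi> \<longrightarrow>
        (LINT x|lebesgue. u x * partial_deriv i \<phi> x) = - (LINT x|lebesgue. g x $ i * \<phi> x))"

text \<open>A weak gradient is determined only up to a null set; \<open>weak_grad u\<close> is an arbitrary
  representative, meaningful only if \<open>u\<close> has a weak gradient. It is used below only in integrals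
  over the whole space and in integrability conditions, which do not depend on the choice.\<close>

definition weak_grad :: "(real ^ 'n \<Rightarrow> real) \<Rightarrow> real ^ 'n \<Rightarrow> real ^ 'n" where
  "weak_grad u = (SOME g. is_weak_gradient u g)"

definition in_Lp :: "real \<Rightarrow> (real ^ 'n \<Rightarrow> real) \<Rightarrow> bool" where
  "in_Lp m f \<longleftrightarrow> f \<in> borel_measurable lebesgue \<and> integrable lebesgue (\<lambda>x. \<bar>f x\<bar> powr m)"

definition sobolev_exponent :: "nat \<Rightarrow> real \<Rightarrow> real" where
  "sobolev_exponent N m = real N * m / (real N - m)"

definition D1 :: "real \<Rightarrow> (real ^ 'n \<Rightarrow> real) set" where
  "D1 m = {u. in_Lp (sobolev_exponent CARD('n) m) u \<and> (\<exists>g. is_weak_gradient u g) \<and>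
              in_Lp m (\<lambda>x. norm (weak_grad u x))}"

text \<open>The field \<open>|v|^(m-2) v\<close>. Since \<open>0 powr a = 0\<close>, it vanishes at \<open>v = 0\<close> for every \<open>m\<close>,
  the usual convention for \<open>m > 1\<close>.\<close>

definition power_field :: "real \<Rightarrow> 'b::real_normed_vector \<Rightarrow> 'b" where
  "power_field m v = (norm v powr (m - 2)) *\<^sub>R v"

text \<open>Weak solutions of \<open>-\<Delta>\<^sub>p u - \<Delta>\<^sub>q u = |u|^(r-2) u + l |u|^(s-2) u\<close>. The integrability
  clauses say that the integrals are well defined; the right-hand side needs this because \<open>s\<close> may be
  supercritical.\<close>

definition weak_solution ::
    "real \<Rightarrow> real \<Rightarrow> real \<Rightarrow> real \<Rightarrow> real \<Rightarrow> (real ^ 'n \<Rightarrow> real) \<Rightarrow> bool" where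
  "weak_solution p q r s l u \<longleftrightarrow> u \<in> D1 p \<inter> D1 q \<and>
     (\<forall>\<phi> \<in> D1 p \<inter> D1 q.
        integrable lebesgue
          (\<lambda>x. (power_field p (weak_grad u x) + power_field q (weak_grad u x)) \<bullet> weak_grad \<phi> x) \<and>
        integrable lebesgue (\<lambda>x. (power_field r (u x) + l * power_field s (u x)) * \<phi> x) \<and>
        (LINT x|lebesgue.
           (power_field p (weak_grad u x) + power_field q (weak_grad u x)) \<bullet> weak_grad \<phi> x) =
        (LINT x|lebesgue. (power_field r (u x) + l * power_field s (u x)) * \<phi> x))"

end

(* The solution is radial and is found by shooting. With v = -u' and w = t^(N-1) (v^(p-1) + v^(q-1))
   the equation is the system u' = -v, w' = t^(N-1) (u^(r-1) + l u^(s-1)), u(0) = a.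

   For small a the gradient stays small, the q-Laplacian dominates and, since r > q^*, the Pohozaev
   functional becomes negative and decreases from then on, so u never reaches 0. For one large a and
   all small l the solution does reach 0: after rescaling, the equation is a perturbation of the
   p-Laplace equation with exponent r < p^*. Both alternatives are open conditions on a, so some a
   satisfies neither. The corresponding u is positive on [0, oo) and its Pohozaev functional is
   eventually nonnegative and decreasing, which forces the decay u = O(t^(-(N-q)/q - eps)); hence u
   lies in D^{1,p} and D^{1,q}.

   To test the equation against an arbitrary phi in E, the radial flux is approximated by vector
   fields x G(|x|^2) with G polynomial, cut off smoothly, whose components are test functions. *)
theory Submission
  imports Defs
begin

section \<open>Inverting the flux function\<close>

text \<open>As \<open>s\<close> is supercritical, the norms of E do not control the power of order
  \<open>s\<close>, which is the obstacle to a direct variational approach. For a radial decreasing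
  solution \<open>u\<close> is bounded by its initial value, and this power is a bounded multiple of
  the one of order \<open>r\<close>. One functional, \<open>t ^ N * energy - b * w * u\<close>,
  serves both ends of the shooting. For \<open>b\<close> between \<open>N / r\<close> and
  \<open>N / q - 1\<close> it decreases as long as the velocity is small; for \<open>b\<close>
  between \<open>N / p - 1\<close> and \<open>N / r\<close> it stays above a positive constant after
  rescaling. The smallness of \<open>l\<close> enters through the second choice, for one fixed
  initial value. The limiting solution first receives only a borderline decay; the gain eps comes
  from feeding it once more into the equation, where q^* < r is used again. In the last stage phi
  has only a weak gradient. Instead of a density theorem in E, all smoothness is put on the field:
  the definition of the weak gradient is applied with the components of the field as test functions,
  and the field, not phi, is passed to the limit.\<close>

lemma deriv_compare_open:
  fixes f g :: "real \<Rightarrow> real"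
  assumes "a \<le> b" "continuous_on {a..b} f" "continuous_on {a..b} g"
    and "\<And>t. a < t \<Longrightarrow> t < b \<Longrightarrow> \<exists>f'. (f has_real_derivative f') (at t) \<and> f' \<le> g' t"
    and "\<And>t. a < t \<Longrightarrow> t < b \<Longrightarrow> (g has_real_derivative g' t) (at t)"
  shows "f b - f a \<le> g b - g a"
proof -
  have "(\<lambda>t. g t - f t) a \<le> (\<lambda>t. g t - f t) b"
  proof (rule DERIV_nonneg_imp_increasing_open[OF assms(1)])
    fix x assume x: "a < x" "x < b"
    obtain f' where f': "(f has_real_derivative f') (at x)" "f' \<le> g' x" using assms(4)[OF x] by blast
    show "\<exists>y. ((\<lambda>t. g t - f t) has_real_derivative y) (at x) \<and> 0 \<le> y"
      by (intro exI[of _ "g' x - f'"] conjI DERIV_diff assms(5) x f'(1)) (use f' in simp)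
  qed (intro continuous_intros assms)
  thus ?thesis by simp
qed

text \<open>The version for derivatives relative to a closed interval, which is how the initial
  value problem supplies them at its end points.\<close>

lemma deriv_compare:
  fixes f g :: "real \<Rightarrow> real"
  assumes f: "\<And>t. t \<in> {a..b} \<Longrightarrow> (f has_real_derivative f' t) (at t within {a..b})"
    and g: "\<And>t. t \<in> {a..b} \<Longrightarrow> (g has_real_derivative g' t) (at t within {a..b})"
    and le: "\<And>t. a < t \<Longrightarrow> t < b \<Longrightarrow> f' t \<le> g' t"
    and ab: "a \<le> b"
  shows "f b - f a \<le> g b - g a"
proof (rule deriv_compare_open[OF ab, where g' = g'])
  show "continuous_on {a..b} f" "continuous_on {a..b} g"
    using f g by (meson DERIV_continuous continuous_on_eq_continuous_within)+
  fix t assume t: "a < t" "t < b"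
  hence "at t within {a..b} = at t" by (intro at_within_interior) auto
  thus "\<exists>f'. (f has_real_derivative f') (at t) \<and> f' \<le> g' t" "(g has_real_derivative g' t) (at t)"
    using f[of t] g[of t] le[OF t] t by auto
qed

locale flux =
  fixes p q :: real
  assumes q_gt_1: "1 < q" and q_less_p: "q < p"
begin

definition flux :: "real \<Rightarrow> real" where
  "flux v = v powr (p - 1) + v powr (q - 1)"

text \<open>The inverse has no closed form. The description is meaningful for
  \<open>0 \<le> y\<close>, by \<open>flux_surj\<close> and strict monotonicity.\<close>

definition flux_inv :: "real \<Rightarrow> real" where
  "flux_inv y = (THE v. 0 \<le> v \<and> flux v = y)"

lemma flux_0 [simp]: "flux 0 = 0"
  by (simp add: flux_def)

lemma flux_less: "0 \<le> v \<Longrightarrow> v < w \<Longrightarrow> flux v < flux w"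
  unfolding flux_def using q_gt_1 q_less_p
  by (intro add_strict_mono powr_less_mono2) auto

lemma flux_less_iff: "0 \<le> v \<Longrightarrow> 0 \<le> w \<Longrightarrow> flux v < flux w \<longleftrightarrow> v < w"
  using flux_less[of v w] flux_less[of w v] by (cases v w rule: linorder_cases) auto

lemma flux_le_iff: "0 \<le> v \<Longrightarrow> 0 \<le> w \<Longrightarrow> flux v \<le> flux w \<longleftrightarrow> v \<le> w"
  using flux_less_iff[of w v] by (simp add: not_less[symmetric])

lemma flux_nonneg: "0 \<le> flux v"
  by (simp add: flux_def)

lemma continuous_on_flux: "continuous_on {0..} flux"
  unfolding flux_def using q_gt_1 q_less_p
  by (intro continuous_intros continuous_on_powr') auto

lemma flux_surj:
  assumes "0 \<le> y" shows "\<exists>v\<ge>0. flux v = y"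
proof -
  define b where "b = y powr (1 / (q - 1))"
  have "b powr (q - 1) = y" using assms q_gt_1 by (simp add: b_def powr_powr)
  hence "y \<le> flux b" by (simp add: flux_def)
  moreover have "continuous_on {0..b} flux"
    by (rule continuous_on_subset[OF continuous_on_flux]) auto
  ultimately show ?thesis using IVT'[of flux 0 y b] assms by (auto simp: b_def)
qed

lemma flux_inv_unique: "0 \<le> v \<Longrightarrow> flux_inv (flux v) = v"
  unfolding flux_inv_def
  by (rule the_equality) (simp, metis flux_less less_irrefl linorder_neqE_linordered_idom)

lemma flux_inv:
  assumes "0 \<le> y" shows flux_inv_nonneg: "0 \<le> flux_inv y" and flux_flux_inv: "flux (flux_inv y) = y"
  using flux_surj[OF assms] flux_inv_unique by auto

lemma flux_inv_0 [simp]: "flux_inv 0 = 0"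
  using flux_inv_unique[of 0] by simp

lemma flux_inv_le_iff: "0 \<le> x \<Longrightarrow> 0 \<le> y \<Longrightarrow> flux_inv x \<le> flux_inv y \<longleftrightarrow> x \<le> y"
  by (metis flux_inv_nonneg flux_flux_inv flux_le_iff)

lemma flux_inv_pos: "0 < y \<Longrightarrow> 0 < flux_inv y"
  using flux_inv[of y] by (cases "flux_inv y = 0") auto

text \<open>Dropping the \<open>p\<close>-term of \<open>flux\<close> leaves a pure power. The bound
  gives continuity of \<open>flux_inv\<close> at 0 and, later, the decay rate of the
  velocity.\<close>

lemma flux_inv_le_powr:
  assumes "0 \<le> y" shows "flux_inv y \<le> y powr (1 / (q - 1))"
proof -
  have "flux_inv y powr (q - 1) \<le> y"
    using flux_flux_inv[OF assms] powr_ge_zero[of "flux_inv y" "p - 1"] unfolding flux_def by linarith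
  hence "(flux_inv y powr (q - 1)) powr (1 / (q - 1)) \<le> y powr (1 / (q - 1))"
    using q_gt_1 by (intro powr_mono2) auto
  thus ?thesis using q_gt_1 flux_inv_nonneg[OF assms] by (simp add: powr_powr)
qed

lemma DERIV_flux:
  assumes "0 < v"
  shows "(flux has_real_derivative ((p-1) * v powr (p-2) + (q-1) * v powr (q-2))) (at v)"
  unfolding flux_def using assms by (auto intro!: derivative_eq_intros)

text \<open>The logarithmic derivative of \<open>flux\<close> is a weighted mean of
  \<open>p - 1\<close> and \<open>q - 1\<close>, hence at least \<open>q - 1\<close>.\<close>

lemma DERIV_flux_ge:
  assumes "0 < v"
  shows "(q - 1) * flux v / v \<le> (p-1) * v powr (p-2) + (q-1) * v powr (q-2)"
proof -
  have "(q - 1) * flux v / v = (q-1) * v powr (p-2) + (q-1) * v powr (q-2)"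
    unfolding flux_def using assms powr_diff[of v "p-1" 1] powr_diff[of v "q-1" 1]
    by (simp add: field_simps)
  also have "\<dots> \<le> (p-1) * v powr (p-2) + (q-1) * v powr (q-2)"
    using q_less_p by (intro add_mono mult_right_mono) auto
  finally show ?thesis .
qed

text \<open>Mean value theorem for \<open>flux\<close> between the two preimages, combined with
  \<open>DERIV_flux_ge\<close>. The factor \<open>1 / y\<close> is the price for an inverse that may
  have infinite slope at 0; it is affordable because the arguments met later are bounded below by a
  multiple of \<open>t\<close>.\<close>

lemma flux_inv_diff:
  assumes "0 < y" "y \<le> z"
  shows "flux_inv z - flux_inv y \<le> flux_inv z * (z - y) / ((q - 1) * y)"
proof (cases "y = z")
  case False
  define v w where "v = flux_inv y" and "w = flux_inv z"
  have v: "0 < v" "flux v = y" and w: "flux w = z" "0 < w"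
    using assms flux_inv_pos flux_flux_inv by (auto simp: v_def w_def)
  have vw: "v < w" using v w False assms flux_less_iff[of v w] by auto
  obtain x where x: "v < x" "x < w"
    "flux w - flux v = (w - v) * ((p-1) * x powr (p-2) + (q-1) * x powr (q-2))"
    using MVT2[OF vw, of flux "\<lambda>x. (p-1) * x powr (p-2) + (q-1) * x powr (q-2)"] DERIV_flux v by auto
  have "(q - 1) * y / w \<le> (q - 1) * flux x / x"
    using x v w q_gt_1 flux_less[of v x] assms by (intro frac_le mult_left_mono mult_nonneg_nonneg flux_nonneg) auto
  also have "\<dots> \<le> (p-1) * x powr (p-2) + (q-1) * x powr (q-2)"
    using x v by (intro DERIV_flux_ge) auto
  finally have "(w - v) * ((q - 1) * y / w) \<le> z - y"
    using x v w vw mult_left_mono[of "(q - 1) * y / w" "(p-1) * x powr (p-2) + (q-1) * x powr (q-2)" "w - v"] by simp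
  thus ?thesis using v w q_gt_1 assms by (simp add: v_def[symmetric] w_def[symmetric] field_simps)
qed auto

lemma continuous_on_flux_inv: "continuous_on {0..} flux_inv"
proof -
  have "continuous (at y within {0..}) flux_inv" if "0 \<le> y" for y
  proof (cases "y = 0")
    case True
    have "((\<lambda>x. x powr (1/(q-1))) \<longlongrightarrow> 0 powr (1/(q-1))) (at 0 within {0..})"
      using q_gt_1 by (intro tendsto_powr') (auto simp: eventually_at_filter)
    hence "((\<lambda>x. x powr (1/(q-1))) \<longlongrightarrow> 0) (at 0 within {0..})" by simp
    hence "(flux_inv \<longlongrightarrow> 0) (at 0 within {0..})"
      by (rule tendsto_sandwich[rotated 3, of _ _ _ "\<lambda>x. 0"])
         (auto simp: eventually_at_filter flux_inv_nonneg flux_inv_le_powr)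
    thus ?thesis using True by (simp add: continuous_within)
  next
    case False
    hence y: "0 < y" using that by simp
    have b: "\<bar>flux_inv x - flux_inv y\<bar> \<le> flux_inv (2*y) * \<bar>x - y\<bar> / ((q-1) * (y/2))"
      if "y/2 < x" "x < 2*y" for x
    proof (cases "x \<le> y")
      case True
      have "\<bar>flux_inv x - flux_inv y\<bar> = flux_inv y - flux_inv x"
        using True that y flux_inv_le_iff[of x y] by auto
      also have "\<dots> \<le> flux_inv y * (y - x) / ((q - 1) * x)"
        using flux_inv_diff[of x y] that y True by auto
      also have "\<dots> \<le> flux_inv (2*y) * \<bar>x - y\<bar> / ((q-1) * (y/2))"
        using y that True q_gt_1 flux_inv_le_iff[of y "2*y"] flux_inv_pos[of y]
        by (intro frac_le mult_mono mult_left_mono) auto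
      finally show ?thesis .
    next
      case F: False
      have "\<bar>flux_inv x - flux_inv y\<bar> = flux_inv x - flux_inv y"
        using F that y flux_inv_le_iff[of y x] by auto
      also have "\<dots> \<le> flux_inv x * (x - y) / ((q - 1) * y)"
        using flux_inv_diff[of y x] that y F by auto
      also have "\<dots> \<le> flux_inv (2*y) * \<bar>x - y\<bar> / ((q-1) * (y/2))"
        using y that F q_gt_1 flux_inv_le_iff[of x "2*y"] flux_inv_pos[of x] flux_inv_pos[of "2*y"]
        by (intro frac_le mult_mono mult_left_mono) auto
      finally show ?thesis .
    qed
    have "((\<lambda>x. flux_inv (2*y) * \<bar>x - y\<bar> / ((q-1) * (y/2))) \<longlongrightarrow> flux_inv (2*y) * \<bar>y - y\<bar> / ((q-1) * (y/2))) (at y)"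
      using y q_gt_1 by (intro tendsto_intros) auto
    hence l: "((\<lambda>x. flux_inv (2*y) * \<bar>x - y\<bar> / ((q-1) * (y/2))) \<longlongrightarrow> 0) (at y)" by simp
    have "eventually (\<lambda>x. x \<in> {y/2<..<2*y}) (at y)"
      using y by (intro eventually_at_in_open') auto
    hence "eventually (\<lambda>x. norm (flux_inv x - flux_inv y) \<le> flux_inv (2*y) * \<bar>x - y\<bar> / ((q-1) * (y/2))) (at y)"
      by (rule eventually_mono) (use b in auto)
    hence "((\<lambda>x. flux_inv x - flux_inv y) \<longlongrightarrow> 0) (at y)"
      by (rule Lim_null_comparison[OF _ l])
    hence "isCont flux_inv y"
      by (simp add: isCont_def LIM_zero_iff)
    thus ?thesis by (rule continuous_at_imp_continuous_within)
  qed
  thus ?thesis by (simp add: continuous_on_eq_continuous_within)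
qed

lemma DERIV_flux_inv:
  assumes "0 < y"
  shows "(flux_inv has_real_derivative
    inverse ((p-1) * flux_inv y powr (p-2) + (q-1) * flux_inv y powr (q-2))) (at y)"
proof (rule DERIV_inverse_function[where f = flux and a = 0 and b = "y + 1"])
  show "(flux has_real_derivative (p-1) * flux_inv y powr (p-2) + (q-1) * flux_inv y powr (q-2)) (at (flux_inv y))"
    using DERIV_flux flux_inv_pos assms by blast
  have "0 < (p-1) * flux_inv y powr (p-2) + (q-1) * flux_inv y powr (q-2)"
    using flux_inv_pos[OF assms] q_gt_1 q_less_p by (intro add_pos_pos mult_pos_pos) auto
  thus "(p-1) * flux_inv y powr (p-2) + (q-1) * flux_inv y powr (q-2) \<noteq> 0" by simp
  show "isCont flux_inv y"
    by (rule continuous_on_interior[OF continuous_on_flux_inv]) (use assms in simp)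
qed (use assms flux_flux_inv in auto)

end

section \<open>The radial initial value problem\<close>

locale radial_flux = flux +
  fixes N :: nat
  assumes N_ge_2: "2 \<le> N"
begin

text \<open>Here \<open>w t = t ^ (N - 1) * flux (- u' t)\<close>. At \<open>t = 0\<close> the quotient \<open>w t / t ^ (N - 1)\<close> is \<open>0\<close> (division by
  zero), which is the correct initial slope.\<close>

definition radial_sol :: "(real \<Rightarrow> real) \<Rightarrow> real \<Rightarrow> (real \<Rightarrow> real) \<Rightarrow> (real \<Rightarrow> real) \<Rightarrow> bool" where
  "radial_sol f T u w \<longleftrightarrow> w 0 = 0 \<and> (\<forall>t\<in>{0..T}.
     (u has_real_derivative - flux_inv (w t / t ^ (N - 1))) (at t within {0..T}) \<and>
     (w has_real_derivative t ^ (N - 1) * f (u t)) (at t within {0..T}))"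

lemma DERIV_power_N:
  "((\<lambda>t. B * t ^ N / N) has_real_derivative t ^ (N - 1) * B) (at t within S)"
  using N_ge_2 by (auto intro!: derivative_eq_intros)

text \<open>Comparison with \<open>B * t ^ N / N\<close>, the primitive of
  \<open>B * t ^ (N - 1)\<close> that vanishes at 0.\<close>

lemma weight_diff_le:
  assumes "\<And>t. t \<in> {0..T} \<Longrightarrow> (w1 has_real_derivative t ^ (N - 1) * k1 t) (at t within {0..T})"
    and "\<And>t. t \<in> {0..T} \<Longrightarrow> (w2 has_real_derivative t ^ (N - 1) * k2 t) (at t within {0..T})"
    and "w1 0 = 0" "w2 0 = 0" "0 \<le> T"
    and "\<And>t. t \<in> {0..T} \<Longrightarrow> k1 t - k2 t \<le> B"
  shows "w1 T - w2 T \<le> B * T ^ N / N"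
proof -
  have "(w1 T - w2 T) - (w1 0 - w2 0) \<le> B * T ^ N / N - B * 0 ^ N / N"
  proof (rule deriv_compare)
    fix t assume "t \<in> {0..T}"
    thus "((\<lambda>t. w1 t - w2 t) has_real_derivative t ^ (N - 1) * (k1 t - k2 t)) (at t within {0..T})"
      by (auto intro!: derivative_eq_intros assms(1,2) simp: right_diff_distrib)
  next
    fix t assume "t \<in> {0..T}"
    show "((\<lambda>t. B * t ^ N / N) has_real_derivative t ^ (N - 1) * B) (at t within {0..T})"
      by (rule DERIV_power_N)
  qed (use assms in \<open>auto intro!: mult_left_mono\<close>)
  thus ?thesis using assms N_ge_2 by (simp add: power_0_left)
qed

lemma weight_bounds:
  assumes w': "\<And>t. t \<in> {0..T} \<Longrightarrow> (w has_real_derivative t ^ (N - 1) * k t) (at t within S)" "{0..T} \<subseteq> S"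
    and "w 0 = 0" "0 \<le> T" and "\<And>t. t \<in> {0..T} \<Longrightarrow> m \<le> k t" "\<And>t. t \<in> {0..T} \<Longrightarrow> k t \<le> M"
  shows "m * T ^ N / N \<le> w T" "w T \<le> M * T ^ N / N"
proof -
  have w: "(w has_real_derivative t ^ (N - 1) * k t) (at t within {0..T})" if "t \<in> {0..T}" for t
    using w' that by (blast intro: DERIV_subset)
  have z: "((\<lambda>t. 0) has_real_derivative t ^ (N - 1) * 0) (at t within {0..T})" for t :: real by simp
  have "w T - 0 \<le> M * T ^ N / N"
    by (rule weight_diff_le[OF w z]) (use assms in auto)
  thus "w T \<le> M * T ^ N / N" by simp
  have "0 - w T \<le> - m * T ^ N / N"
    by (rule weight_diff_le[OF z w]) (use assms in auto)
  thus "m * T ^ N / N \<le> w T" by simp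
qed

lemma weight_quot:
  assumes "0 < t" shows "m * t ^ N / N / t ^ (N - 1) = m * t / N"
proof -
  have "t ^ N = t * t ^ (N - 1)" using N_ge_2 by (cases N) auto
  thus ?thesis using assms by simp
qed

lemma flux_inv_lipschitz:
  assumes "0 < c" "c \<le> y" "c \<le> z" "y \<le> Y" "z \<le> Y"
  shows "\<bar>flux_inv y - flux_inv z\<bar> \<le> flux_inv Y * \<bar>y - z\<bar> / ((q - 1) * c)"
proof -
  have *: "\<bar>flux_inv y - flux_inv z\<bar> \<le> flux_inv Y * \<bar>y - z\<bar> / ((q - 1) * c)"
    if "c \<le> y" "y \<le> z" "z \<le> Y" for y z
  proof -
    have "\<bar>flux_inv y - flux_inv z\<bar> = flux_inv z - flux_inv y"
      using flux_inv_le_iff[of y z] that assms by auto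
    also have "\<dots> \<le> flux_inv z * (z - y) / ((q - 1) * y)"
      using that assms by (intro flux_inv_diff) auto
    also have "\<dots> \<le> flux_inv Y * \<bar>y - z\<bar> / ((q - 1) * c)"
      using that assms q_gt_1 flux_inv_le_iff[of z Y] flux_inv_pos[of z] flux_inv_pos[of Y]
      by (intro frac_le mult_mono mult_left_mono) auto
    finally show ?thesis .
  qed
  show ?thesis
  proof (cases "y \<le> z")
    case True thus ?thesis using * assms by blast
  next
    case False thus ?thesis using *[of z y] assms by (simp add: abs_minus_commute)
  qed
qed

text \<open>Lipschitz constant of the integral operator: the factor \<open>1 / t\<close> by which \<open>flux_inv\<close> degenerates at
  the centre is compensated by the averaging in \<open>w t / t ^ (N - 1)\<close>.\<close>

definition step_const :: "real \<Rightarrow> real \<Rightarrow> real \<Rightarrow> real" where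
  "step_const m M T = flux_inv (M * T / N) / ((q - 1) * m)"

lemma step_const_nonneg: "0 < m \<Longrightarrow> 0 < M \<Longrightarrow> 0 < T \<Longrightarrow> 0 \<le> step_const m M T"
  unfolding step_const_def using q_gt_1 flux_inv_nonneg by (intro divide_nonneg_nonneg) auto

text \<open>The estimate behind a Picard step in the norm weighted by \<open>exp (- K * t)\<close>:
  integrating \<open>exp (K * t)\<close> gains the factor \<open>1 / K\<close>. Inputs
  \<open>y1\<close>, \<open>y2\<close> and outputs \<open>u1\<close>, \<open>u2\<close> are kept
  apart so that the same estimate yields the contraction (outputs are the next iterates) and
  continuous dependence (inputs equal outputs).\<close>

lemma radial_compare:
  assumes "0 < m" "0 < K" "0 \<le> L" "0 \<le> D"
    and lip: "\<And>x y. \<bar>g x - g y\<bar> \<le> L * \<bar>x - y\<bar>" and g: "\<And>x. m \<le> g x" "\<And>x. g x \<le> M"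
    and w1: "\<And>t. t \<in> {0..T} \<Longrightarrow> (w1 has_real_derivative t ^ (N - 1) * g (y1 t)) (at t within {0..T})"
    and w2: "\<And>t. t \<in> {0..T} \<Longrightarrow> (w2 has_real_derivative t ^ (N - 1) * g (y2 t)) (at t within {0..T})"
    and w0: "w1 0 = 0" "w2 0 = 0"
    and u1: "\<And>t. t \<in> {0..T} \<Longrightarrow> (u1 has_real_derivative - flux_inv (w1 t / t ^ (N - 1))) (at t within {0..T})"
    and u2: "\<And>t. t \<in> {0..T} \<Longrightarrow> (u2 has_real_derivative - flux_inv (w2 t / t ^ (N - 1))) (at t within {0..T})"
    and y: "\<And>t. t \<in> {0..T} \<Longrightarrow> \<bar>y1 t - y2 t\<bar> \<le> D * exp (K * t)"
    and t: "t \<in> {0..T}"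
  shows "\<bar>u1 t - u2 t\<bar> \<le> \<bar>u1 0 - u2 0\<bar> + step_const m M T * L * D / K * exp (K * t)"
    and "\<bar>w1 t - w2 t\<bar> \<le> L * D * exp (K * t) * t ^ N / N"
proof -
  have M: "0 < M" using g assms(1) by (meson le_less_trans not_less order_trans)
  have gd: "\<bar>g (y1 s) - g (y2 s)\<bar> \<le> L * D * exp (K * \<tau>)" if "s \<in> {0..T}" "s \<le> \<tau>" for s \<tau>
  proof -
    have "\<bar>g (y1 s) - g (y2 s)\<bar> \<le> L * (D * exp (K * s))"
      using lip[of "y1 s" "y2 s"] y[OF that(1)] \<open>0 \<le> L\<close> by (meson mult_left_mono order_trans)
    also have "\<dots> \<le> L * (D * exp (K * \<tau>))"
      using that assms(2-4) by (intro mult_left_mono) auto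
    finally show ?thesis by simp
  qed
  have wd: "\<bar>w1 \<tau> - w2 \<tau>\<bar> \<le> L * D * exp (K * \<tau>) * \<tau> ^ N / N" if "\<tau> \<in> {0..T}" for \<tau>
  proof -
    have sub: "{0..\<tau>} \<subseteq> {0..T}" using that by auto
    have a: "(w1 has_real_derivative s ^ (N - 1) * g (y1 s)) (at s within {0..\<tau>})"
      "(w2 has_real_derivative s ^ (N - 1) * g (y2 s)) (at s within {0..\<tau>})" if "s \<in> {0..\<tau>}" for s
      using w1 w2 sub that by (blast intro: DERIV_subset)+
    have "w1 \<tau> - w2 \<tau> \<le> L * D * exp (K * \<tau>) * \<tau> ^ N / N"
      by (rule weight_diff_le[OF a]) (use w0 that gd[of _ \<tau>] sub in \<open>auto simp: abs_le_iff\<close>)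
    moreover have "w2 \<tau> - w1 \<tau> \<le> L * D * exp (K * \<tau>) * \<tau> ^ N / N"
      by (rule weight_diff_le[OF a(2,1)]) (use w0 that gd[of _ \<tau>] sub in \<open>auto simp: abs_le_iff\<close>)
    ultimately show ?thesis by auto
  qed
  show "\<bar>w1 t - w2 t\<bar> \<le> L * D * exp (K * t) * t ^ N / N" using wd t by blast
  have wb: "m * \<tau> / N \<le> w \<tau> / \<tau> ^ (N - 1) \<and> w \<tau> / \<tau> ^ (N - 1) \<le> M * T / N"
    if \<tau>: "0 < \<tau>" "\<tau> \<le> T" and w: "\<And>t. t \<in> {0..T} \<Longrightarrow> (w has_real_derivative t ^ (N - 1) * g (y t)) (at t within {0..T})" "w 0 = 0"
    for \<tau> w y
  proof -
    have "m * \<tau> ^ N / N \<le> w \<tau>" "w \<tau> \<le> M * \<tau> ^ N / N"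
      by (rule weight_bounds[where k = "\<lambda>t. g (y t)" and S = "{0..T}"]; use \<tau> w g in auto)+
    hence "m * \<tau> ^ N / N / \<tau> ^ (N-1) \<le> w \<tau> / \<tau> ^ (N-1)" "w \<tau> / \<tau> ^ (N-1) \<le> M * \<tau> ^ N / N / \<tau> ^ (N-1)"
      using \<tau> by (intro divide_right_mono; simp)+
    moreover have "M * \<tau> / N \<le> M * T / N" using \<tau> M by (intro divide_right_mono mult_left_mono) auto
    ultimately show ?thesis using weight_quot[OF \<tau>(1)] by (metis order_trans)
  qed
  have pd: "\<bar>flux_inv (w1 \<tau> / \<tau> ^ (N-1)) - flux_inv (w2 \<tau> / \<tau> ^ (N-1))\<bar> \<le> step_const m M T * L * D * exp (K * \<tau>)"
    if \<tau>: "0 < \<tau>" "\<tau> \<le> T" for \<tau>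
  proof -
    have "\<bar>w1 \<tau> / \<tau> ^ (N-1) - w2 \<tau> / \<tau> ^ (N-1)\<bar> = \<bar>w1 \<tau> - w2 \<tau>\<bar> / \<tau> ^ (N-1)"
      using \<tau> by (simp add: diff_divide_distrib[symmetric] abs_divide)
    also have "\<dots> \<le> L * D * exp (K * \<tau>) * \<tau> ^ N / N / \<tau> ^ (N-1)"
      using wd[of \<tau>] \<tau> by (intro divide_right_mono) auto
    also have "\<dots> = L * D * exp (K * \<tau>) * \<tau> / N" using weight_quot[OF \<tau>(1)] .
    finally have 1: "\<bar>w1 \<tau> / \<tau> ^ (N-1) - w2 \<tau> / \<tau> ^ (N-1)\<bar> \<le> L * D * exp (K * \<tau>) * \<tau> / N" .
    have "\<bar>flux_inv (w1 \<tau> / \<tau> ^ (N-1)) - flux_inv (w2 \<tau> / \<tau> ^ (N-1))\<bar>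
       \<le> flux_inv (M * T / N) * \<bar>w1 \<tau> / \<tau> ^ (N-1) - w2 \<tau> / \<tau> ^ (N-1)\<bar> / ((q - 1) * (m * \<tau> / N))"
      using wb[OF \<tau> w1 w0(1)] wb[OF \<tau> w2 w0(2)] assms(1) \<tau> N_ge_2 by (intro flux_inv_lipschitz) auto
    also have "\<dots> \<le> flux_inv (M * T / N) * (L * D * exp (K * \<tau>) * \<tau> / N) / ((q - 1) * (m * \<tau> / N))"
      using 1 assms(1) \<tau> M q_gt_1 by (intro divide_right_mono mult_left_mono flux_inv_nonneg) auto
    also have "\<dots> = step_const m M T * L * D * exp (K * \<tau>)"
      using \<tau> N_ge_2 assms(1) q_gt_1 by (simp add: step_const_def field_simps)
    finally show ?thesis .
  qed
  let ?E = "\<lambda>s. step_const m M T * L * D / K * exp (K * s)"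
  have sub: "{0..t} \<subseteq> {0..T}" using t by auto
  have E: "(?E has_real_derivative step_const m M T * L * D * exp (K * s)) (at s within {0..t})" for s
    using \<open>0 < K\<close> by (auto intro!: derivative_eq_intros)
  have u: "(u1 has_real_derivative - flux_inv (w1 s / s ^ (N - 1))) (at s within {0..t})"
    "(u2 has_real_derivative - flux_inv (w2 s / s ^ (N - 1))) (at s within {0..t})" if "s \<in> {0..t}" for s
    using u1 u2 that sub by (blast intro: DERIV_subset)+
  have "(u1 t - u2 t) - (u1 0 - u2 0) \<le> ?E t - ?E 0"
    by (rule deriv_compare[OF DERIV_diff[OF u] E]) (use pd t in \<open>auto simp: abs_le_iff\<close>)
  moreover have "(u2 t - u1 t) - (u2 0 - u1 0) \<le> ?E t - ?E 0"
    by (rule deriv_compare[OF DERIV_diff[OF u(2,1)] E]) (use pd t in \<open>auto simp: abs_le_iff\<close>)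
  moreover have "0 \<le> step_const m M T"
    using step_const_nonneg[of m M T] M assms(1-4) t by (cases "T = 0") (auto simp: step_const_def)
  hence "0 \<le> ?E 0" using assms(1-4) by simp
  ultimately show "\<bar>u1 t - u2 t\<bar> \<le> \<bar>u1 0 - u2 0\<bar> + ?E t" by linarith
qed

text \<open>At \<open>t = 0\<close> the quotient is 0 by the convention for division, and the bound
  \<open>M * t / N\<close> squeezes it to this value, so the convention creates no jump.\<close>

lemma continuous_on_weight_quot:
  assumes w': "\<And>t. t \<in> {0..T} \<Longrightarrow> (w has_real_derivative t ^ (N - 1) * k t) (at t within {0..T})"
    and w0: "w 0 = 0" and k: "\<And>t. t \<in> {0..T} \<Longrightarrow> 0 \<le> k t" "\<And>t. t \<in> {0..T} \<Longrightarrow> k t \<le> M"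
  shows "continuous_on {0..T} (\<lambda>t. w t / t ^ (N - 1))"
    and "t \<in> {0..T} \<Longrightarrow> 0 \<le> w t / t ^ (N - 1) \<and> w t / t ^ (N - 1) \<le> M * t / N"
proof -
  have cw: "continuous_on {0..T} w"
    using w' by (meson DERIV_continuous continuous_on_eq_continuous_within)
  define h where "h t = w t / t ^ (N - 1)" for t
  have hb: "0 \<le> h t \<and> h t \<le> M * t / N" if "t \<in> {0..T}" for t
  proof (cases "t = 0")
    case True thus ?thesis by (simp add: h_def w0)
  next
    case False
    hence t: "0 < t" using that by simp
    have "0 * t ^ N / N \<le> w t" "w t \<le> M * t ^ N / N"
      by (rule weight_bounds[where k = k and S = "{0..T}" and w = w and m = 0 and M = M]; use that w' w0 k in auto)+
    hence "0 \<le> w t / t ^ (N-1)" "w t / t ^ (N-1) \<le> M * t ^ N / N / t ^ (N-1)"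
      using t by (auto intro!: divide_right_mono simp del: divide_divide_eq_left)
    thus ?thesis using weight_quot[OF t] by (simp add: h_def)
  qed
  thus "t \<in> {0..T} \<Longrightarrow> 0 \<le> w t / t ^ (N - 1) \<and> w t / t ^ (N - 1) \<le> M * t / N" by (simp add: h_def)
  have "continuous (at t within {0..T}) h" if t: "t \<in> {0..T}" for t
  proof (cases "t = 0")
    case True
    have "((\<lambda>x. M * x / N) \<longlongrightarrow> M * 0 / N) (at 0 within {0..T})" by (intro tendsto_intros) (use N_ge_2 in auto)
    hence "((\<lambda>x. M * x / N) \<longlongrightarrow> 0) (at 0 within {0..T})" by simp
    hence "(h \<longlongrightarrow> 0) (at 0 within {0..T})"
      by (rule tendsto_sandwich[rotated 3, of _ _ _ "\<lambda>x. 0"]) (use hb in \<open>auto simp: eventually_at_filter\<close>)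
    thus ?thesis using True by (simp add: continuous_within h_def w0)
  next
    case False
    thus ?thesis unfolding h_def using cw t
      by (intro continuous_intros) (auto simp: continuous_on_eq_continuous_within)
  qed
  thus "continuous_on {0..T} (\<lambda>t. w t / t ^ (N - 1))"
    by (simp add: continuous_on_eq_continuous_within h_def[abs_def])
qed

text \<open>One Picard step: \<open>y\<close> is the old iterate; two successive integrations
  produce \<open>w\<close> and then the new iterate \<open>u\<close>.\<close>

lemma radial_step:
  assumes y: "continuous_on {0..T} y" and g: "continuous_on UNIV g" "\<And>x. 0 \<le> g x" "\<And>x. g x \<le> M"
    and "0 \<le> T"
  shows "\<exists>u w. u 0 = a \<and> w 0 = 0 \<and> (\<forall>t\<in>{0..T}.
     (u has_real_derivative - flux_inv (w t / t ^ (N - 1))) (at t within {0..T}) \<and>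
     (w has_real_derivative t ^ (N - 1) * g (y t)) (at t within {0..T}))"
proof -
  define w where "w t = integral {0..t} (\<lambda>s. s ^ (N - 1) * g (y s))" for t
  have c: "continuous_on {0..T} (\<lambda>s. s ^ (N - 1) * g (y s))"
    by (intro continuous_intros continuous_on_compose2[OF g(1) y]) auto
  have w': "(w has_real_derivative t ^ (N - 1) * g (y t)) (at t within {0..T})" if "t \<in> {0..T}" for t
    unfolding w_def using integral_has_real_derivative[OF c that] .
  have w0: "w 0 = 0" by (simp add: w_def)
  define h where "h t = w t / t ^ (N - 1)" for t
  have ch: "continuous_on {0..T} h" and hb: "\<And>t. t \<in> {0..T} \<Longrightarrow> 0 \<le> h t"
    unfolding h_def using continuous_on_weight_quot[of T w "\<lambda>t. g (y t)" M] w' w0 g by auto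
  have cf: "continuous_on {0..T} (\<lambda>t. - flux_inv (h t))"
    by (intro continuous_intros continuous_on_compose2[OF continuous_on_flux_inv ch]) (use hb in auto)
  define u where "u t = a + integral {0..t} (\<lambda>t. - flux_inv (h t))" for t
  have u': "(u has_real_derivative - flux_inv (h t)) (at t within {0..T})" if "t \<in> {0..T}" for t
    unfolding u_def by (rule derivative_eq_intros integral_has_real_derivative[OF cf that] refl)+ simp
  show ?thesis
    by (rule exI[of _ u], rule exI[of _ w]) (use u' w' w0 in \<open>auto simp: u_def h_def\<close>)
qed

text \<open>Banach fixed point of the Picard map. The unknown is the solution multiplied by
  \<open>exp (- K * t)\<close>, so a single contraction covers \<open>{0..T}\<close> however large
  \<open>T\<close> is.\<close>

lemma clipped_sol_exists:
  assumes "0 < m" "0 \<le> L" and lip: "\<And>x y. \<bar>g x - g y\<bar> \<le> L * \<bar>x - y\<bar>"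
    and g: "\<And>x. m \<le> g x" "\<And>x. g x \<le> M" and "0 < T"
  shows "\<exists>u w. u 0 = a \<and> radial_sol g T u w"
proof -
  have M: "0 < M" using g assms(1) by (meson le_less_trans not_less order_trans)
  have cg: "continuous_on UNIV g"
    by (rule lipschitz_on_continuous_on[of L]) (use lip \<open>0 \<le> L\<close> in \<open>auto simp: lipschitz_on_def dist_real_def\<close>)
  define C where "C = step_const m M T"
  have C: "0 \<le> C" unfolding C_def using step_const_nonneg assms M by auto
  \<comment> \<open>Makes the contraction factor \<open>C * L / K\<close> at most 1/2; the summand 1
    keeps \<open>K\<close> positive when \<open>C * L\<close> vanishes.\<close>
  define K where "K = 2 * C * L + 1"
  have K: "0 < K" using C assms by (auto simp: K_def intro!: add_nonneg_pos)
  define Y where "Y z t = exp (K * t) * apply_bcontfun z t" for z :: "real \<Rightarrow>\<^sub>C real" and t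
  have "\<forall>z. \<exists>u w. u 0 = a \<and> w 0 = 0 \<and> (\<forall>t\<in>{0..T}.
     (u has_real_derivative - flux_inv (w t / t ^ (N - 1))) (at t within {0..T}) \<and>
     (w has_real_derivative t ^ (N - 1) * g (Y z t)) (at t within {0..T}))"
  proof (intro allI radial_step[OF _ cg _ g(2)])
    fix z show "continuous_on {0..T} (Y z)" unfolding Y_def by (intro continuous_intros) auto
    show "0 \<le> g x" for x using g(1)[of x] \<open>0 < m\<close> by simp
  qed (use \<open>0 < T\<close> in simp)
  then obtain U W where U0: "\<And>z. U z 0 = a" and W0: "\<And>z. W z 0 = 0"
    and U: "\<And>z t. t \<in> {0..T} \<Longrightarrow> (U z has_real_derivative - flux_inv (W z t / t ^ (N - 1))) (at t within {0..T})"
    and W: "\<And>z t. t \<in> {0..T} \<Longrightarrow> (W z has_real_derivative t ^ (N - 1) * g (Y z t)) (at t within {0..T})"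
    by metis
  \<comment> \<open>Clamping the time extends iterates from \<open>{0..T}\<close> to bounded
    continuous functions on the whole line, a complete metric space available as a type.\<close>
  define c where "c t = max 0 (min T t)" for t
  have c: "c t \<in> {0..T}" for t using \<open>0 < T\<close> by (auto simp: c_def)
  have c_id: "c t = t" if "t \<in> {0..T}" for t using that by (auto simp: c_def)
  have cU: "continuous_on {0..T} (\<lambda>t. exp (- (K * t)) * U z t)" for z
  proof (intro continuous_intros)
    show "continuous_on {0..T} (U z)"
      using U by (meson DERIV_continuous continuous_on_eq_continuous_within)
  qed
  define F where "F z t = exp (- (K * c t)) * U z (c t)" for z t
  have F: "F z \<in> bcontfun" for z
  proof -
    have "continuous_on UNIV (F z)" unfolding F_def
      by (rule continuous_on_compose2[OF cU, of _ c]) (use c in \<open>auto simp: c_def[abs_def] intro!: continuous_intros\<close>)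
    moreover have "bounded ((\<lambda>t. exp (- (K * t)) * U z t) ` {0..T})"
      by (intro compact_imp_bounded compact_continuous_image cU) auto
    hence "bounded (range (F z))"
      by (rule bounded_subset) (use c in \<open>auto simp: F_def\<close>)
    ultimately show ?thesis by (simp add: bcontfun_def)
  qed
  have "dist (Bcontfun (F z1)) (Bcontfun (F z2)) \<le> 1/2 * dist z1 z2" for z1 z2
  proof (rule dist_bound)
    fix t
    let ?D = "dist z1 z2" and ?t = "c t"
    have "\<bar>Y z1 s - Y z2 s\<bar> \<le> ?D * exp (K * s)" for s
    proof -
      have "\<bar>Y z1 s - Y z2 s\<bar> = exp (K * s) * dist (z1 s) (z2 s)"
        unfolding Y_def dist_real_def right_diff_distrib[symmetric] by (simp add: abs_mult)
      also have "\<dots> \<le> exp (K * s) * ?D" by (intro mult_left_mono dist_bounded) auto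
      finally show ?thesis by (simp add: mult.commute)
    qed
    hence "\<bar>U z1 ?t - U z2 ?t\<bar> \<le> \<bar>U z1 0 - U z2 0\<bar> + C * L * ?D / K * exp (K * ?t)"
      unfolding C_def
      by (intro radial_compare(1)[where g = g and ?w1.0 = "W z1" and ?w2.0 = "W z2" and ?y1.0 = "Y z1" and ?y2.0 = "Y z2"])
         (use assms K U W W0 c in \<open>auto simp del: atLeastAtMost_iff\<close>)
    also have "\<dots> = C * L / K * ?D * exp (K * ?t)" by (simp add: U0)
    also have "\<dots> \<le> 1/2 * ?D * exp (K * ?t)"
      using K C assms by (intro mult_right_mono) (auto simp: K_def field_simps)
    finally have "exp (- (K * ?t)) * \<bar>U z1 ?t - U z2 ?t\<bar> \<le> exp (- (K * ?t)) * (1/2 * ?D * exp (K * ?t))"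
      by (intro mult_left_mono) auto
    also have "\<dots> = 1/2 * ?D" by (simp add: exp_minus field_simps)
    finally have "\<bar>F z1 t - F z2 t\<bar> \<le> 1/2 * ?D"
      unfolding F_def right_diff_distrib[symmetric] by (simp add: abs_mult)
    thus "dist (Bcontfun (F z1) t) (Bcontfun (F z2) t) \<le> 1/2 * ?D"
      by (simp add: Bcontfun_inverse F dist_real_def)
  qed
  hence "\<exists>!z. Bcontfun (F z) = z" by (intro banach_fix_type[of "1/2"]) auto
  then obtain z where z: "Bcontfun (F z) = z" by blast
  have Yz: "Y z t = U z t" if "t \<in> {0..T}" for t
  proof -
    have "apply_bcontfun z t = F z t" using z F[of z] Bcontfun_inverse by metis
    thus ?thesis using that by (simp add: Y_def F_def c_id exp_minus)
  qed
  have "radial_sol g T (U z) (W z)"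
    unfolding radial_sol_def using U[of _ z] W[of _ z] W0[of z] by (simp add: Yz)
  thus ?thesis using U0 by blast
qed

text \<open>The weighted difference attains a maximum at some \<open>\<tau>\<close>; there
  \<open>radial_compare\<close>, with inputs equal to outputs, bounds it by the initial difference
  plus half of itself, and that half is absorbed. The resulting \<open>B\<close> is the same for all
  pairs of solutions.\<close>

lemma clipped_sol_dep:
  assumes "0 < m" "0 \<le> L" and lip: "\<And>x y. \<bar>g x - g y\<bar> \<le> L * \<bar>x - y\<bar>"
    and g: "\<And>x. m \<le> g x" "\<And>x. g x \<le> M" and "0 < T"
  shows "\<exists>B\<ge>0. \<forall>u1 w1 u2 w2. radial_sol g T u1 w1 \<longrightarrow> radial_sol g T u2 w2 \<longrightarrow>
    (\<forall>t\<in>{0..T}. \<bar>u1 t - u2 t\<bar> \<le> B * \<bar>u1 0 - u2 0\<bar> \<and> \<bar>w1 t - w2 t\<bar> \<le> B * \<bar>u1 0 - u2 0\<bar>)"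
proof -
  have M: "0 < M" using g assms(1) by (meson le_less_trans not_less order_trans)
  define C where "C = step_const m M T"
  have C: "0 \<le> C" unfolding C_def using step_const_nonneg assms M by auto
  define K where "K = 2 * C * L + 1"
  have K: "0 < K" using C assms by (auto simp: K_def intro!: add_nonneg_pos)
  have CL: "C * L / K \<le> 1/2" using K by (simp add: K_def field_simps)
  define B where "B = max (2 * exp (K * T)) (L * 2 * exp (K * T) * T ^ N / N)"
  have main: "\<bar>u1 t - u2 t\<bar> \<le> B * \<bar>u1 0 - u2 0\<bar> \<and> \<bar>w1 t - w2 t\<bar> \<le> B * \<bar>u1 0 - u2 0\<bar>"
    if s1: "radial_sol g T u1 w1" and s2: "radial_sol g T u2 w2" and t: "t \<in> {0..T}" for u1 u2 w1 w2 t
  proof -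
    let ?d = "\<lambda>t. exp (- (K * t)) * \<bar>u1 t - u2 t\<bar>"
    have "continuous_on {0..T} u1" "continuous_on {0..T} u2"
      using s1 s2 unfolding radial_sol_def by (meson DERIV_continuous continuous_on_eq_continuous_within)+
    hence "continuous_on {0..T} ?d" by (intro continuous_intros)
    then obtain \<tau> where \<tau>: "\<tau> \<in> {0..T}" and max: "\<And>s. s \<in> {0..T} \<Longrightarrow> ?d s \<le> ?d \<tau>"
      using continuous_attains_sup[of "{0..T}" ?d] \<open>0 < T\<close> by auto
    have D: "\<bar>u1 s - u2 s\<bar> \<le> ?d \<tau> * exp (K * s)" if "s \<in> {0..T}" for s
      using mult_right_mono[OF max[OF that], of "exp (K * s)"] by (simp add: exp_minus field_simps)
    note cmp = radial_compare[where g = g and ?w1.0 = w1 and ?w2.0 = w2 and ?y1.0 = u1 and ?y2.0 = u2 and T = T and D = "?d \<tau>" and ?u1.0 = u1 and ?u2.0 = u2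
        and m = m and K = K and L = L and M = M]
    have "\<bar>u1 \<tau> - u2 \<tau>\<bar> \<le> \<bar>u1 0 - u2 0\<bar> + C * L * ?d \<tau> / K * exp (K * \<tau>)"
      unfolding C_def by (rule cmp(1)) (use assms K D s1 s2 \<tau> in \<open>auto simp: radial_sol_def simp del: atLeastAtMost_iff\<close>)
    hence "?d \<tau> \<le> exp (- (K * \<tau>)) * (\<bar>u1 0 - u2 0\<bar> + C * L * ?d \<tau> / K * exp (K * \<tau>))"
      by (rule mult_left_mono) auto
    also have "\<dots> = exp (- (K * \<tau>)) * \<bar>u1 0 - u2 0\<bar> + C * L / K * ?d \<tau>"
      by (simp add: exp_minus field_simps)
    also have "\<dots> \<le> 1 * \<bar>u1 0 - u2 0\<bar> + 1/2 * ?d \<tau>"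
      using K C assms \<tau> CL by (intro add_mono mult_right_mono) auto
    finally have d: "?d \<tau> \<le> 2 * \<bar>u1 0 - u2 0\<bar>" by simp
    have eT: "exp (K * t) \<le> exp (K * T)" using t K by auto
    have "\<bar>u1 t - u2 t\<bar> \<le> (2 * \<bar>u1 0 - u2 0\<bar>) * exp (K * T)"
      using order_trans[OF D[OF t] mult_mono[OF d eT]] by simp
    also have "\<dots> \<le> B * \<bar>u1 0 - u2 0\<bar>"
      using mult_right_mono[of "2 * exp (K * T)" B "\<bar>u1 0 - u2 0\<bar>"] by (simp add: B_def mult_ac)
    finally have 1: "\<bar>u1 t - u2 t\<bar> \<le> B * \<bar>u1 0 - u2 0\<bar>" .
    have "\<bar>w1 t - w2 t\<bar> \<le> L * ?d \<tau> * exp (K * t) * t ^ N / N"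
      by (rule cmp(2)) (use assms K D s1 s2 t in \<open>auto simp: radial_sol_def simp del: atLeastAtMost_iff\<close>)
    also have "\<dots> \<le> L * (2 * \<bar>u1 0 - u2 0\<bar>) * exp (K * T) * T ^ N / N"
      using eT t assms by (intro divide_right_mono mult_mono[OF mult_mono[OF mult_left_mono[OF d]]] power_mono) auto
    also have "\<dots> \<le> B * \<bar>u1 0 - u2 0\<bar>"
      using mult_right_mono[of "L * 2 * exp (K * T) * T ^ N / N" B "\<bar>u1 0 - u2 0\<bar>"] by (simp add: B_def mult_ac)
    finally show ?thesis using 1 by simp
  qed
  have "0 \<le> B" by (simp add: B_def le_max_iff_disj)
  thus ?thesis using main by blast
qed

end

section \<open>Positive solutions: truncation, uniqueness and dependence on the initial
  value\<close>

locale radial_ode = radial_flux +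
  fixes f :: "real \<Rightarrow> real"
  assumes f_pos: "0 < x \<Longrightarrow> 0 < f x"
    and f_mono: "0 < x \<Longrightarrow> x \<le> y \<Longrightarrow> f x \<le> f y"
    and f_lip: "0 < x \<Longrightarrow> x \<le> y \<Longrightarrow> \<exists>L. L-lipschitz_on {x..y} f"
begin

definition sol :: "real \<Rightarrow> (real \<Rightarrow> real) \<Rightarrow> (real \<Rightarrow> real) \<Rightarrow> bool" where
  "sol T u w \<longleftrightarrow> 0 < T \<and> radial_sol f T u w \<and> (\<forall>t\<in>{0..T}. 0 < u t)"

lemma radial_sol_subset: "radial_sol g T u w \<Longrightarrow> T' \<le> T \<Longrightarrow> radial_sol g T' u w"
  unfolding radial_sol_def using DERIV_subset[of _ _ _ "{0..T}" "{0..T'}"] by fastforce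

lemma sol_subset: "sol T u w \<Longrightarrow> 0 < T' \<Longrightarrow> T' \<le> T \<Longrightarrow> sol T' u w"
  unfolding sol_def using radial_sol_subset by auto

text \<open>As \<open>w\<close> is nondecreasing, the argument of \<open>flux_inv\<close> on
  \<open>{s..t}\<close> is at least \<open>w s / t ^ (N - 1)\<close>; the last inequality integrates
  the resulting bound for the slope. It allows data at a single time to decide that \<open>u\<close>
  must reach 0.\<close>

lemma radial_sol_mono:
  assumes s: "radial_sol g T u w" and g: "\<And>t. t \<in> {0..T} \<Longrightarrow> 0 \<le> g (u t)"
    and st: "0 \<le> s" "s \<le> t" "t \<le> T"
  shows "w s \<le> w t" "0 \<le> w s" "u t \<le> u s"
    and "u t \<le> u s - (t - s) * flux_inv (w s / t ^ (N - 1))"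
proof -
  have sub: "{s..t} \<subseteq> {0..T}" "{0..s} \<subseteq> {0..T}" using st by auto
  have w': "(w has_real_derivative \<tau> ^ (N - 1) * g (u \<tau>)) (at \<tau> within S)"
    if "\<tau> \<in> S" "S \<subseteq> {0..T}" for \<tau> S
    using s that unfolding radial_sol_def by (blast intro: DERIV_subset)
  have wmono: "w a \<le> w b" if "a \<le> b" "0 \<le> a" "b \<le> T" for a b
  proof -
    have "0 - 0 \<le> w b - w a"
      by (rule deriv_compare[where f' = "\<lambda>_. 0", OF _ w']) (use that g in auto)
    thus ?thesis by simp
  qed
  show ws: "w s \<le> w t" "0 \<le> w s" using wmono[of s t] wmono[of 0 s] st s by (auto simp: radial_sol_def)
  have u': "(u has_real_derivative - flux_inv (w \<tau> / \<tau> ^ (N - 1))) (at \<tau> within {s..t})" if "\<tau> \<in> {s..t}" for \<tau>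
    using s that sub unfolding radial_sol_def by (blast intro: DERIV_subset)
  let ?c = "flux_inv (w s / t ^ (N - 1))"
  have "u t - u s \<le> (- ?c) * t - (- ?c) * s"
  proof (rule deriv_compare[OF u'])
    fix \<tau> assume \<tau>: "s < \<tau>" "\<tau> < t"
    have "w s / t ^ (N - 1) \<le> w \<tau> / \<tau> ^ (N - 1)"
      using wmono[of s \<tau>] wmono[of 0 s] \<tau> st ws by (intro frac_le power_mono) auto
    thus "- flux_inv (w \<tau> / \<tau> ^ (N - 1)) \<le> - ?c"
      using \<tau> st ws by (subst neg_le_iff_le, subst flux_inv_le_iff) (auto intro: order_trans[rotated])
  qed (use st in \<open>auto intro!: derivative_eq_intros\<close>)
  thus *: "u t \<le> u s - (t - s) * ?c" by (simp add: algebra_simps)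
  have "0 \<le> (t - s) * ?c"
    using st ws by (intro mult_nonneg_nonneg flux_inv_nonneg divide_nonneg_nonneg) auto
  thus "u t \<le> u s" using * by simp
qed

lemma sol_mono:
  assumes s: "sol T u w" and st: "0 \<le> s" "s \<le> t" "t \<le> T"
  shows "w s \<le> w t" "0 \<le> w s" "u t \<le> u s"
    and "u t \<le> u s - (t - s) * flux_inv (w s / t ^ (N - 1))"
  using radial_sol_mono[of f T u w s t] s st f_pos unfolding sol_def by (auto simp: less_imp_le)

lemma radial_sol_continuous:
  "radial_sol g T u w \<Longrightarrow> continuous_on {0..T} u \<and> continuous_on {0..T} w"
  unfolding radial_sol_def by (meson DERIV_continuous continuous_on_eq_continuous_within)

text \<open>The nonlinearity need not be Lipschitz at \<open>0\<close>; truncation between \<open>\<delta>\<close> and \<open>A\<close> does not change a solution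
  as long as it stays between these values.\<close>

definition clip :: "real \<Rightarrow> real \<Rightarrow> real \<Rightarrow> real" where
  "clip \<delta> A x = max \<delta> (min A x)"

lemma clip_props:
  assumes "0 < \<delta>" "\<delta> \<le> A"
  shows "f \<delta> \<le> f (clip \<delta> A x)" "f (clip \<delta> A x) \<le> f A" "0 < f \<delta>"
    and "\<exists>L\<ge>0. \<forall>x y. \<bar>f (clip \<delta> A x) - f (clip \<delta> A y)\<bar> \<le> L * \<bar>x - y\<bar>"
proof -
  have c: "clip \<delta> A x \<in> {\<delta>..A}" for x using assms by (auto simp: clip_def)
  show "f \<delta> \<le> f (clip \<delta> A x)" "f (clip \<delta> A x) \<le> f A" "0 < f \<delta>"
    using c[of x] assms f_mono f_pos by auto
  obtain L where L: "L-lipschitz_on {\<delta>..A} f" using f_lip assms by blast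
  hence "0 \<le> L" by (rule lipschitz_on_nonneg)
  moreover have "\<bar>f (clip \<delta> A x) - f (clip \<delta> A y)\<bar> \<le> L * \<bar>x - y\<bar>" for x y
  proof -
    have "\<bar>f (clip \<delta> A x) - f (clip \<delta> A y)\<bar> \<le> L * \<bar>clip \<delta> A x - clip \<delta> A y\<bar>"
      using lipschitz_onD[OF L c c] by (simp add: dist_real_def)
    also have "\<dots> \<le> L * \<bar>x - y\<bar>"
      using \<open>0 \<le> L\<close> by (intro mult_left_mono) (auto simp: clip_def)
    finally show ?thesis .
  qed
  ultimately show "\<exists>L\<ge>0. \<forall>x y. \<bar>f (clip \<delta> A x) - f (clip \<delta> A y)\<bar> \<le> L * \<bar>x - y\<bar>" by blast
qed

lemma clipped_mono:
  assumes "0 < \<delta>" "\<delta> \<le> A" and s: "radial_sol (\<lambda>x. f (clip \<delta> A x)) T u w" and st: "0 \<le> s" "s \<le> t" "t \<le> T"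
  shows "u t \<le> u s"
  by (rule radial_sol_mono(3)[OF s _ st]) (use clip_props[OF assms(1,2)] in \<open>meson less_imp_le order_trans\<close>)

lemma sol_imp_clipped:
  assumes "sol T u w" "\<delta> \<le> u T" "u 0 \<le> A"
  shows "radial_sol (\<lambda>x. f (clip \<delta> A x)) T u w"
proof -
  have "clip \<delta> A (u t) = u t" if "t \<in> {0..T}" for t
    using sol_mono(3)[OF assms(1), of 0 t] sol_mono(3)[OF assms(1), of t T] that assms(2,3)
    by (auto simp: clip_def)
  thus ?thesis using assms(1) by (auto simp: sol_def radial_sol_def)
qed

text \<open>Truncated solutions are nonincreasing, so their two end values already confine them to
  \<open>{\<delta>..A}\<close>, where the truncation is invisible.\<close>

lemma clipped_imp_sol:
  assumes s: "radial_sol (\<lambda>x. f (clip \<delta> A x)) T u w" and "0 < T" "0 < \<delta>" "\<delta> \<le> u T" "u 0 \<le> A" "\<delta> \<le> A"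
  shows "sol T u w"
proof -
  have b: "\<delta> \<le> u t \<and> u t \<le> A" if "t \<in> {0..T}" for t
    using clipped_mono[OF \<open>0 < \<delta>\<close> assms(6) s, of t T] clipped_mono[OF \<open>0 < \<delta>\<close> assms(6) s, of 0 t] that assms by auto
  hence "clip \<delta> A (u t) = u t" if "t \<in> {0..T}" for t using that by (auto simp: clip_def)
  moreover have "0 < u t" if "t \<in> {0..T}" for t using b[OF that] \<open>0 < \<delta>\<close> by linarith
  ultimately show ?thesis using assms(1,2) by (auto simp: sol_def radial_sol_def)
qed

text \<open>Truncation between the smaller final value and the common initial value turns both into
  solutions of one Lipschitz problem with zero initial difference.\<close>

lemma sol_unique:
  assumes s: "sol T1 u1 w1" "sol T2 u2 w2" and a: "u1 0 = u2 0" and t: "0 \<le> t" "t \<le> T1" "t \<le> T2"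
  shows "u1 t = u2 t" "w1 t = w2 t"
proof -
  define T where "T = min T1 T2"
  have T: "0 < T" "t \<in> {0..T}" using s t by (auto simp: T_def sol_def)
  have s': "sol T u1 w1" "sol T u2 w2"
    using sol_subset[OF s(1), of T] sol_subset[OF s(2), of T] T by (auto simp: T_def)
  define \<delta> where "\<delta> = min (u1 T) (u2 T)"
  have \<delta>: "0 < \<delta>" "\<delta> \<le> u1 T" "\<delta> \<le> u2 T" using s' T unfolding \<delta>_def sol_def by auto
  have "\<delta> \<le> u1 0" using sol_mono(3)[OF s'(1), of 0 T] T \<delta> by auto
  note c = clip_props[OF \<delta>(1) this]
  obtain L where L: "L \<ge> 0" "\<And>x y. \<bar>f (clip \<delta> (u1 0) x) - f (clip \<delta> (u1 0) y)\<bar> \<le> L * \<bar>x - y\<bar>" using c by blast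
  have "\<bar>u1 t - u2 t\<bar> \<le> 0 \<and> \<bar>w1 t - w2 t\<bar> \<le> 0"
    using clipped_sol_dep[OF c(3) L c(1,2) T(1)] sol_imp_clipped[OF s'(1) \<delta>(2), of "u1 0"]
      sol_imp_clipped[OF s'(2) \<delta>(3), of "u1 0"] T(2) a by fastforce
  thus "u1 t = u2 t" "w1 t = w2 t" by auto
qed

lemma sol_dep:
  assumes s: "sol T u w" and "0 < e"
  shows "\<exists>d>0. \<forall>a. \<bar>a - u 0\<bar> < d \<longrightarrow> (\<exists>u' w'. sol T u' w' \<and> u' 0 = a \<and> \<bar>u' T - u T\<bar> < e \<and> \<bar>w' T - w T\<bar> < e)"
proof -
  have T: "0 < T" and uT: "0 < u T" using s by (auto simp: sol_def)
  \<comment> \<open>Half the final value below, and one more than the initial value above, leave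
    room for nearby solutions to stay inside the truncation.\<close>
  define \<delta> where "\<delta> = u T / 2"
  define A where "A = u 0 + 1"
  have \<delta>: "0 < \<delta>" "\<delta> \<le> u T" "u T \<le> u 0" using uT sol_mono(3)[OF s, of 0 T] T by (auto simp: \<delta>_def)
  note c = clip_props[OF \<delta>(1), of A]
  have dA: "\<delta> \<le> A" using \<delta> by (simp add: A_def)
  obtain L where L: "L \<ge> 0" "\<And>x y. \<bar>f (clip \<delta> A x) - f (clip \<delta> A y)\<bar> \<le> L * \<bar>x - y\<bar>"
    using c(4)[OF dA] by blast
  obtain B where B: "B \<ge> 0" "\<And>u1 w1 u2 w2 t. radial_sol (\<lambda>x. f (clip \<delta> A x)) T u1 w1 \<Longrightarrow> radial_sol (\<lambda>x. f (clip \<delta> A x)) T u2 w2 \<Longrightarrow>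
     t\<in>{0..T} \<Longrightarrow> \<bar>u1 t - u2 t\<bar> \<le> B * \<bar>u1 0 - u2 0\<bar> \<and> \<bar>w1 t - w2 t\<bar> \<le> B * \<bar>u1 0 - u2 0\<bar>"
    using clipped_sol_dep[OF c(3)[OF dA] L c(1)[OF dA] c(2)[OF dA] T] by blast
  define d where "d = min 1 (min e \<delta> / (B + 1))"
  have d: "0 < d" using B \<delta> \<open>0 < e\<close> by (auto simp: d_def)
  show ?thesis
  proof (intro exI[of _ d] conjI d allI impI)
    fix a assume a: "\<bar>a - u 0\<bar> < d"
    obtain u' w' where s': "u' 0 = a" "radial_sol (\<lambda>x. f (clip \<delta> A x)) T u' w'"
      using clipped_sol_exists[OF c(3)[OF dA] L c(1)[OF dA] c(2)[OF dA] T] by blast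
    have "radial_sol (\<lambda>x. f (clip \<delta> A x)) T u w"
      by (rule sol_imp_clipped[OF s \<delta>(2)]) (simp add: A_def)
    from B(2)[OF s'(2) this, of T] T s'
    have b: "\<bar>u' T - u T\<bar> \<le> B * \<bar>a - u 0\<bar>" "\<bar>w' T - w T\<bar> \<le> B * \<bar>a - u 0\<bar>" by auto
    have "B * \<bar>a - u 0\<bar> \<le> (B + 1) * \<bar>a - u 0\<bar>" by (simp add: distrib_right)
    also have "\<dots> < (B + 1) * d" using a B by (intro mult_strict_left_mono) auto
    also have "\<dots> \<le> (B + 1) * (min e \<delta> / (B + 1))" using B by (intro mult_left_mono) (auto simp: d_def)
    also have "\<dots> = min e \<delta>" using B by simp
    finally have *: "B * \<bar>a - u 0\<bar> < min e \<delta>" .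
    have "sol T u' w'"
      by (rule clipped_imp_sol[OF s'(2) T \<delta>(1)]) (use dA b * s' a in \<open>auto simp: \<delta>_def A_def d_def abs_if split: if_splits\<close>)
    thus "\<exists>u' w'. sol T u' w' \<and> u' 0 = a \<and> \<bar>u' T - u T\<bar> < e \<and> \<bar>w' T - w T\<bar> < e"
      using b * s'(1) by (intro exI[of _ u'] exI[of _ w']) auto
  qed
qed

text \<open>The time \<open>T\<close> is kept while \<open>a\<close> varies, so
  \<open>sol_dep\<close> suffices. Both alternatives of the shooting argument are brought into this
  form.\<close>

lemma open_sol_set:
  assumes "\<And>T. open (Q T)"
  shows "open {a. \<exists>T u w. sol T u w \<and> u 0 = a \<and> (u T, w T) \<in> Q T}"
proof (rule openI)
  fix a assume "a \<in> {a. \<exists>T u w. sol T u w \<and> u 0 = a \<and> (u T, w T) \<in> Q T}"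
  then obtain T u w where s: "sol T u w" "u 0 = a" and Q: "(u T, w T) \<in> Q T" by blast
  obtain e where e: "e > 0" "ball (u T, w T) e \<subseteq> Q T" using assms Q open_contains_ball by meson
  obtain d where d: "d > 0" "\<And>a. \<bar>a - u 0\<bar> < d \<Longrightarrow> (\<exists>u' w'. sol T u' w' \<and> u' 0 = a \<and> \<bar>u' T - u T\<bar> < e/2 \<and> \<bar>w' T - w T\<bar> < e/2)"
    using sol_dep[OF s(1), of "e/2"] e by auto
  have "ball a d \<subseteq> {a. \<exists>T u w. sol T u w \<and> u 0 = a \<and> (u T, w T) \<in> Q T}"
  proof
    fix b assume "b \<in> ball a d"
    hence "\<bar>b - u 0\<bar> < d" using s(2) by (simp add: dist_real_def abs_minus_commute)
    then obtain u' w' where u': "sol T u' w'" "u' 0 = b" "\<bar>u' T - u T\<bar> < e/2" "\<bar>w' T - w T\<bar> < e/2"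
      using d(2) by blast
    have "dist (u T, w T) (u' T, w' T) \<le> dist (u T) (u' T) + dist (w T) (w' T)"
      unfolding dist_Pair_Pair by (rule sqrt_sum_squares_le_sum) auto
    also have "\<dots> < e" using u' by (simp add: dist_real_def abs_minus_commute)
    finally have "(u' T, w' T) \<in> Q T" using e(2) by (auto simp: mem_ball)
    thus "b \<in> {a. \<exists>T u w. sol T u w \<and> u 0 = a \<and> (u T, w T) \<in> Q T}" using u' by blast
  qed
  thus "\<exists>T>0. ball a T \<subseteq> {a. \<exists>T u w. sol T u w \<and> u 0 = a \<and> (u T, w T) \<in> Q T}" using d(1) by blast
qed

text \<open>The solution truncated below at \<open>\<delta>\<close> exists on all of
  \<open>{0..T}\<close>. If it ends at or above \<open>\<delta>\<close> it is a true solution;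
  otherwise the intermediate value theorem gives a time at which it equals \<open>\<delta>\<close>,
  and up to that time it is one.\<close>

lemma sol_or_hits:
  assumes "0 < T" "0 < \<delta>" "\<delta> < a"
  shows "(\<exists>u w. sol T u w \<and> u 0 = a) \<or> (\<exists>T' u w. T' \<le> T \<and> sol T' u w \<and> u 0 = a \<and> u T' = \<delta>)"
proof -
  note c = clip_props[OF \<open>0 < \<delta>\<close>, of a]
  have dA: "\<delta> \<le> a" using assms by simp
  obtain L where L: "L \<ge> 0" "\<And>x y. \<bar>f (clip \<delta> a x) - f (clip \<delta> a y)\<bar> \<le> L * \<bar>x - y\<bar>"
    using c(4)[OF dA] by blast
  obtain u w where u: "u 0 = a" "radial_sol (\<lambda>x. f (clip \<delta> a x)) T u w"
    using clipped_sol_exists[OF c(3)[OF dA] L c(1)[OF dA] c(2)[OF dA] \<open>0 < T\<close>] by blast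
  show ?thesis
  proof (cases "\<delta> \<le> u T")
    case True
    thus ?thesis using clipped_imp_sol[OF u(2) assms(1,2)] u(1) dA by auto
  next
    case False
    then obtain T' where T': "0 \<le> T'" "T' \<le> T" "u T' = \<delta>"
      using IVT2'[of u T \<delta> 0] radial_sol_continuous[OF u(2)] u assms by auto
    have "0 < T'" using T' u assms by (cases "T' = 0") auto
    hence "sol T' u w"
      using clipped_imp_sol[OF radial_sol_subset[OF u(2) T'(2)] _ assms(2)] T' u(1) dA by auto
    thus ?thesis using T' u(1) by blast
  qed
qed

text \<open>As \<open>w\<close> increases, the inequality forces \<open>u\<close> below zero before time \<open>T + 1\<close>. Stated in terms of the solution
  while it is still positive, crossing is visibly an open condition on the initial value.\<close>

definition will_cross :: "real \<Rightarrow> bool" where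
  "will_cross a \<longleftrightarrow> (\<exists>T u w. sol T u w \<and> u 0 = a \<and> u T < flux_inv (w T / (T + 1) ^ (N - 1)))"

lemma continuous_flux_inv_max: "continuous_on UNIV (\<lambda>y. flux_inv (max 0 y))"
  by (rule continuous_on_compose2[OF continuous_on_flux_inv]) (auto intro!: continuous_intros)

lemma open_will_cross: "open (Collect will_cross)"
proof -
  define Q where "Q T = {z::real\<times>real. fst z < flux_inv (max 0 (snd z / (T + 1) ^ (N - 1)))}" for T :: real
  have "open (Q T)" for T
    unfolding Q_def divide_inverse
    by (intro open_Collect_less continuous_on_compose2[OF continuous_flux_inv_max] continuous_intros) auto
  moreover have wc: "will_cross a \<longleftrightarrow> (\<exists>T u w. sol T u w \<and> u 0 = a \<and> (u T, w T) \<in> Q T)" for a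
  proof -
    have "max 0 (w T / (T + 1) ^ (N - 1)) = w T / (T + 1) ^ (N - 1)" if "sol T u w" for T u w
      using sol_mono(2)[OF that, of T T] that by (intro max_absorb2 divide_nonneg_nonneg) (auto simp: sol_def)
    hence "sol T u w \<and> u 0 = a \<and> u T < flux_inv (w T / (T + 1) ^ (N - 1)) \<longleftrightarrow>
      sol T u w \<and> u 0 = a \<and> (u T, w T) \<in> Q T" for T u w
      by (cases "sol T u w") (simp_all add: Q_def)
    thus ?thesis unfolding will_cross_def by simp
  qed
  moreover have "Collect will_cross = {a. \<exists>T u w. sol T u w \<and> u 0 = a \<and> (u T, w T) \<in> Q T}"
    by (intro Collect_cong wc)
  ultimately show ?thesis using open_sol_set[of Q] by simp
qed

text \<open>A positive solution on \<open>{0..T + 1}\<close> would have to drop by more than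
  \<open>u T\<close> after \<open>T\<close>. Hence the solution meets every level below
  \<open>u T\<close> after \<open>T\<close>, and since \<open>w\<close> increases it does so with
  slope at least \<open>c\<close>. Small positive levels stand in for the zero of \<open>u\<close>,
  because \<open>sol\<close> speaks of positive solutions.\<close>

lemma will_cross_reaches:
  assumes "will_cross a"
  shows "\<exists>T0>0. \<exists>c>0. \<exists>\<delta>0>0. \<forall>\<delta>. 0 < \<delta> \<longrightarrow> \<delta> < \<delta>0 \<longrightarrow>
    (\<exists>T u w. T0 \<le> T \<and> sol T u w \<and> u 0 = a \<and> u T = \<delta> \<and> c \<le> flux_inv (w T / T ^ (N - 1)))"
proof -
  obtain T u w where s: "sol T u w" "u 0 = a" and less: "u T < flux_inv (w T / (T + 1) ^ (N - 1))"
    using assms by (auto simp: will_cross_def)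
  define c where "c = flux_inv (w T / (T + 1) ^ (N - 1))"
  have T: "0 < T" "0 < u T" "u T \<le> a" "0 \<le> w T" using s sol_mono(2,3)[OF s(1), of 0 T] sol_mono(2)[OF s(1), of T T]
    by (auto simp: sol_def)
  have c: "0 < c" "u T < c" using less T by (auto simp: c_def)
  have "\<exists>T' u' w'. T \<le> T' \<and> sol T' u' w' \<and> u' 0 = a \<and> u' T' = \<delta> \<and> c \<le> flux_inv (w' T' / T' ^ (N - 1))"
    if \<delta>: "0 < \<delta>" "\<delta> < u T" for \<delta>
  proof -
    have "\<not> sol (T + 1) u' w'" if "u' 0 = a" for u' w'
    proof
      assume s': "sol (T + 1) u' w'"
      have eq: "u' T = u T" "w' T = w T" using sol_unique[OF s' s(1), of T] that s(2) T by auto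
      have "u' (T + 1) \<le> u T - c"
        using sol_mono(4)[OF s', of T "T + 1"] T by (simp add: eq c_def)
      moreover have "0 < u' (T + 1)" using s' T unfolding sol_def by auto
      ultimately show False using c by simp
    qed
    then obtain T' u' w' where s': "T' \<le> T + 1" "sol T' u' w'" "u' 0 = a" "u' T' = \<delta>"
      using sol_or_hits[of "T + 1" \<delta> a] T \<delta> by auto
    have T': "0 < T'" using s' by (auto simp: sol_def)
    have TT': "T \<le> T'"
    proof (rule ccontr)
      assume "\<not> T \<le> T'"
      hence "u' T' = u T'" "u T \<le> u T'"
        using sol_unique(1)[OF s'(2) s(1), of T'] sol_mono(3)[OF s(1), of T' T] s s' T' by auto
      thus False using s' \<delta> by simp
    qed
    have "w' T = w T" using sol_unique(2)[OF s'(2) s(1), of T] s s' T TT' by auto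
    hence w: "w T \<le> w' T'" using sol_mono(1)[OF s'(2), of T T'] T TT' by auto
    have "w T / (T + 1) ^ (N - 1) \<le> w' T' / T' ^ (N - 1)"
      using w T T' s' by (intro frac_le power_mono) auto
    hence "c \<le> flux_inv (w' T' / T' ^ (N - 1))"
      unfolding c_def using w T T' by (subst flux_inv_le_iff) auto
    thus ?thesis using s' TT' by blast
  qed
  thus ?thesis using T c by blast
qed

text \<open>A solution that did not last until \<open>T\<close> would meet every small level before
  \<open>T\<close>. By then \<open>w\<close> has a positive lower bound, so at a level below
  \<open>c\<close> the inequality defining \<open>will_cross\<close> holds.\<close>

lemma not_cross_imp_sol:
  assumes "0 < a" "\<not> will_cross a" "0 < T"
  shows "\<exists>u w. sol T u w \<and> u 0 = a"
proof (rule ccontr)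
  assume no: "\<not> ?thesis"
  obtain T0 u0 w0 where s0: "T0 \<le> T" "sol T0 u0 w0" "u0 0 = a" "u0 T0 = a/2"
    using sol_or_hits[of T "a/2" a] assms no by auto
  have T0: "0 < T0" using s0 by (auto simp: sol_def)
  have w0: "0 < w0 T0"
  proof -
    have "f (a/2) * T0 ^ N / N \<le> w0 T0"
    proof (rule weight_bounds(1)[where k = "\<lambda>t. f (u0 t)" and S = "{0..T0}" and M = "f a"])
      fix t assume t: "t \<in> {0..T0}"
      have "a/2 \<le> u0 t" "u0 t \<le> a" using sol_mono(3)[OF s0(2), of 0 t] sol_mono(3)[OF s0(2), of t T0] t s0 by auto
      thus "f (a/2) \<le> f (u0 t)" "f (u0 t) \<le> f a" using assms by (auto intro!: f_mono)
    qed (use s0 T0 in \<open>auto simp: sol_def radial_sol_def\<close>)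
    moreover have "0 < f (a/2) * T0 ^ N / N" using f_pos[of "a/2"] assms T0 N_ge_2 by auto
    ultimately show ?thesis by linarith
  qed
  \<comment> \<open>A lower bound, at every time between \<open>T0\<close> and \<open>T\<close>, for
    the right-hand side in \<open>will_cross\<close>: \<open>w\<close> only grows after
    \<open>T0\<close>, and the denominator is at most \<open>(T + 1) ^ (N - 1)\<close>.\<close>
  define c where "c = flux_inv (w0 T0 / (T + 1) ^ (N - 1))"
  have c: "0 < c" unfolding c_def using w0 assms by (intro flux_inv_pos) auto
  define \<delta> where "\<delta> = min (a/4) (c/2)"
  have \<delta>: "0 < \<delta>" "\<delta> < a/2" "\<delta> < c" using assms c by (auto simp: \<delta>_def)
  obtain T' u w where s: "T' \<le> T" "sol T' u w" "u 0 = a" "u T' = \<delta>"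
    using sol_or_hits[of T \<delta> a] \<delta> assms no by auto
  have T': "0 < T'" using s by (auto simp: sol_def)
  have TT': "T0 \<le> T'"
  proof (rule ccontr)
    assume "\<not> T0 \<le> T'"
    hence "u T' = u0 T'" "u0 T0 \<le> u0 T'"
      using sol_unique(1)[OF s(2) s0(2), of T'] sol_mono(3)[OF s0(2), of T' T0] s s0 T' by auto
    thus False using s s0 \<delta> by simp
  qed
  have "w T0 = w0 T0" using sol_unique(2)[OF s(2) s0(2), of T0] s s0 T0 TT' by auto
  hence w: "w0 T0 \<le> w T'" using sol_mono(1)[OF s(2), of T0 T'] T0 TT' by auto
  have "w0 T0 / (T + 1) ^ (N - 1) \<le> w T' / (T' + 1) ^ (N - 1)"
    using w w0 T' s by (intro frac_le power_mono) auto
  hence "c \<le> flux_inv (w T' / (T' + 1) ^ (N - 1))"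
    unfolding c_def using w w0 T' assms by (subst flux_inv_le_iff) auto
  hence "will_cross a" unfolding will_cross_def using s \<delta> by (intro exI[of _ T'] exI[of _ u] exI[of _ w]) auto
  thus False using assms by blast
qed

text \<open>Solutions on growing intervals agree by uniqueness; they are glued by evaluating at time
  \<open>t\<close> the one whose index is \<open>t\<close> rounded up.\<close>

lemma not_cross_imp_global_sol:
  assumes "0 < a" "\<not> will_cross a"
  shows "\<exists>u w. u 0 = a \<and> (\<forall>T>0. sol T u w)"
proof -
  have "\<forall>n. \<exists>u w. sol (real (Suc n)) u w \<and> u 0 = a"
    using not_cross_imp_sol[OF assms] by simp
  then obtain U W where UW: "\<And>n. sol (real (Suc n)) (U n) (W n)" "\<And>n. U n 0 = a" by metis
  define u where "u t = U (nat \<lceil>t\<rceil>) t" for t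
  define w where "w t = W (nat \<lceil>t\<rceil>) t" for t
  have "sol T u w" if T: "0 < T" for T
  proof -
    define n where "n = nat \<lceil>T\<rceil>"
    have n: "T \<le> real (Suc n)" unfolding n_def by linarith
    have s: "sol T (U n) (W n)" by (rule sol_subset[OF UW(1) T n])
    have eq: "u t = U n t" "w t = W n t" if "t \<in> {0..T}" for t
    proof -
      have "t \<le> real (Suc (nat \<lceil>t\<rceil>))" using that by (simp; linarith)
      thus "u t = U n t" "w t = W n t"
        unfolding u_def w_def using sol_unique[OF UW(1) s, of "nat \<lceil>t\<rceil>" t] UW(2) that by auto
    qed
    have "(u has_real_derivative - flux_inv (w t / t ^ (N - 1))) (at t within {0..T}) \<and>
          (w has_real_derivative t ^ (N - 1) * f (u t)) (at t within {0..T})" if t: "t \<in> {0..T}" for t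
      using s t unfolding sol_def radial_sol_def eq[OF t] has_field_derivative_def
      by (auto intro: has_derivative_transform[OF t] simp: eq)
    thus ?thesis using s T eq unfolding sol_def radial_sol_def by auto
  qed
  moreover have "u 0 = a" by (simp add: u_def UW)
  ultimately show ?thesis by blast
qed

end

section \<open>Energy and Pohozaev functionals\<close>

text \<open>Since N / m^* = N / m - 1, the assumptions \<open>r_super\<close>, \<open>r_sub\<close>
  and \<open>s_super\<close> say q^* < r, r < p^* and p^* < s. In this reciprocal form they become
  signs of the coefficients in \<open>DERIV_poh\<close>.\<close>

locale exponents = radial_flux +
  fixes r s :: real
  assumes p_less_r: "p < r" and p_less_N: "p < N"
    and r_super: "N / r < N / q - 1" and r_sub: "N / p - 1 < N / r" and s_super: "N / s < N / p - 1"
    and s_pos: "0 < s"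
begin

definition nonlin :: "real \<Rightarrow> real \<Rightarrow> real" where
  "nonlin l x = x powr (r - 1) + l * x powr (s - 1)"

text \<open>The Hamiltonian of the radial equation: kinetic part plus a primitive of
  \<open>nonlin l\<close>. The coefficient \<open>k\<close> of the \<open>q\<close>-part is 1 for
  the equation itself and small after the rescaling in \<open>exists_crossing\<close>.\<close>

definition energy :: "real \<Rightarrow> real \<Rightarrow> real \<Rightarrow> real \<Rightarrow> real" where
  "energy k l x y = (p - 1) / p * y powr p + k * ((q - 1) / q) * y powr q + x powr r / r + l * x powr s / s"

text \<open>Pohozaev functional with parameter \<open>b\<close>; at a zero of \<open>u\<close> it is positive.\<close>

definition poh :: "real \<Rightarrow> real \<Rightarrow> real \<Rightarrow> (real \<Rightarrow> real) \<Rightarrow> (real \<Rightarrow> real) \<Rightarrow> (real \<Rightarrow> real) \<Rightarrow> real \<Rightarrow> real" where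
  "poh k l b u v w t = t ^ N * energy k l (u t) (v t) - b * w t * u t"

text \<open>What the energy arguments use of a solution. With the velocity as a separate component
  and \<open>k\<close> free, rescaled solutions qualify too. Derivatives are asked for in the open
  interval, since \<open>v\<close> need not be differentiable at 0.\<close>

definition flow :: "real \<Rightarrow> real \<Rightarrow> real \<Rightarrow> (real \<Rightarrow> real) \<Rightarrow> (real \<Rightarrow> real) \<Rightarrow> (real \<Rightarrow> real) \<Rightarrow> bool" where
  "flow k l T u v w \<longleftrightarrow> continuous_on {0..T} u \<and> continuous_on {0..T} v \<and> v 0 = 0 \<and>
     (\<forall>t\<in>{0..T}. 0 < u t \<and> 0 \<le> v t \<and> w t = t ^ (N - 1) * (v t powr (p - 1) + k * v t powr (q - 1))) \<and>
     (\<forall>t\<in>{0<..<T}. 0 < v t \<and> (u has_real_derivative - v t) (at t) \<and> (\<exists>d. (v has_real_derivative d) (at t)) \<and>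
        (w has_real_derivative t ^ (N - 1) * nonlin l (u t)) (at t))"

lemma flowD:
  assumes "flow k l T u v w" "0 < t" "t < T"
  shows "0 < u t" "0 < v t" "(u has_real_derivative - v t) (at t)" "\<exists>d. (v has_real_derivative d) (at t)"
    "(w has_real_derivative t ^ (N - 1) * nonlin l (u t)) (at t)"
    "w t = t ^ (N - 1) * (v t powr (p - 1) + k * v t powr (q - 1))"
  using assms unfolding flow_def by auto

lemma r_s: "r < s" "1 < r" "1 < s"
proof -
  have "N / s < N / r" using s_super r_sub by linarith
  thus "r < s" "1 < r" "1 < s"
    using s_pos p_less_r q_gt_1 q_less_p N_ge_2 by (auto simp: field_simps)
qed

text \<open>The derivative of \<open>w\<close> is computed from its expression in \<open>v\<close>
  and compared with the one the equation prescribes, after division by powers of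
  \<open>t\<close>.\<close>

lemma flow_deriv:
  assumes fl: "flow k l T u v w" and t: "0 < t" "t < T" and d: "(v has_real_derivative d) (at t)"
  shows "((p-1) * v t powr (p-2) + k * (q-1) * v t powr (q-2)) * d
     = nonlin l (u t) - (N - 1) * (v t powr (p-1) + k * v t powr (q-1)) / t"
proof -
  have v: "0 < v t" and w': "(w has_real_derivative t ^ (N - 1) * nonlin l (u t)) (at t)"
    and w: "\<And>\<tau>. \<tau> \<in> {0<..<T} \<Longrightarrow> w \<tau> = \<tau> ^ (N - 1) * (v \<tau> powr (p - 1) + k * v \<tau> powr (q - 1))"
    using fl t unfolding flow_def by auto
  let ?h = "v t powr (p-1) + k * v t powr (q-1)"
  let ?h' = "((p-1) * v t powr (p-2) + k * (q-1) * v t powr (q-2)) * d"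
  have "((\<lambda>\<tau>. \<tau> ^ (N - 1) * (v \<tau> powr (p - 1) + k * v \<tau> powr (q - 1))) has_real_derivative
     (real (N - 1) * t ^ (N - 2)) * ?h + ?h' * t ^ (N - 1)) (at t)"
    by (rule derivative_eq_intros d refl v | simp)+ (simp add: algebra_simps numeral_2_eq_2)
  hence "(w has_real_derivative (real (N - 1) * t ^ (N - 2)) * ?h + ?h' * t ^ (N - 1)) (at t)"
    by (rule has_field_derivative_transform_within_open[of _ _ _ "{0<..<T}"]) (use t w in auto)
  hence "t ^ (N - 1) * nonlin l (u t) = (real (N - 1) * t ^ (N - 2)) * ?h + ?h' * t ^ (N - 1)"
    using w' DERIV_unique by blast
  moreover have "t ^ (N - 1) = t * t ^ (N - 2)" using N_ge_2 by (metis Suc_diff_Suc Suc_1 less_le_trans lessI power_Suc numeral_2_eq_2)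
  ultimately have "t ^ (N - 2) * (t * nonlin l (u t)) = t ^ (N - 2) * (real (N - 1) * ?h + ?h' * t)"
    by (simp only: algebra_simps)
  hence "t * nonlin l (u t) = real (N - 1) * ?h + ?h' * t" using t by simp
  thus ?thesis using t by (simp add: field_simps)
qed

lemma powr_mult_self: "0 < (x::real) \<Longrightarrow> x * x powr a = x powr (a + 1)"
  by (simp add: powr_add)

text \<open>The reaction terms cancel along a solution; what remains is the friction produced by the
  weight \<open>t ^ (N - 1)\<close>.\<close>

lemma DERIV_energy:
  assumes fl: "flow k l T u v w" and t: "0 < t" "t < T"
  shows "((\<lambda>t. energy k l (u t) (v t)) has_real_derivative
     - ((N - 1) / t * (v t powr p + k * v t powr q))) (at t)"
proof -
  have v: "0 < v t" and u: "0 < u t" and u': "(u has_real_derivative - v t) (at t)"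
    using flowD[OF fl t] by auto
  obtain d where d: "(v has_real_derivative d) (at t)" using flowD[OF fl t] by blast
  have pq: "p \<noteq> 0" "q \<noteq> 0" "r \<noteq> 0" "s \<noteq> 0" using q_gt_1 q_less_p r_s by auto
  have "((\<lambda>t. energy k l (u t) (v t)) has_real_derivative
     ((p-1) * v t powr (p-1) + k * (q-1) * v t powr (q-1)) * d - nonlin l (u t) * v t) (at t)"
    unfolding energy_def nonlin_def using u v pq
    by (auto intro!: derivative_eq_intros d u' simp: field_simps)
  also have "((p-1) * v t powr (p-1) + k * (q-1) * v t powr (q-1)) * d
     = v t * (((p-1) * v t powr (p-2) + k * (q-1) * v t powr (q-2)) * d)"
    using powr_mult_self[OF v, of "p-2"] powr_mult_self[OF v, of "q-2"] by (simp add: algebra_simps)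
  also have "\<dots> = v t * (nonlin l (u t) - (N - 1) * (v t powr (p-1) + k * v t powr (q-1)) / t)"
    by (simp only: flow_deriv[OF fl t d])
  also have "\<dots> - nonlin l (u t) * v t = - ((N - 1) / t * (v t * v t powr (p-1) + k * (v t * v t powr (q-1))))"
    by (simp add: field_simps)
  finally show ?thesis using powr_mult_self[OF v, of "p-1"] powr_mult_self[OF v, of "q-1"] by simp
qed

text \<open>Pohozaev identity. Each coefficient changes sign at one of \<open>N / r\<close>,
  \<open>N / s\<close>, \<open>N / p - 1\<close>, \<open>N / q - 1\<close>, so the position of
  \<open>b\<close> among these numbers decides the monotonicity.\<close>

lemma DERIV_poh:
  assumes fl: "flow k l T u v w" and t: "0 < t" "t < T"
  shows "(poh k l b u v w has_real_derivative
     t ^ (N - 1) * ((N / r - b) * u t powr r + l * (N / s - b) * u t powr s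
       + (b - (N / p - 1)) * v t powr p + k * (b - (N / q - 1)) * v t powr q)) (at t)"
proof -
  note [simp] = flowD(1,2)[OF fl t]
  have v: "0 < v t" and u: "0 < u t" and u': "(u has_real_derivative - v t) (at t)"
    and w': "(w has_real_derivative t ^ (N - 1) * nonlin l (u t)) (at t)"
    and w: "w t = t ^ (N - 1) * (v t powr (p - 1) + k * v t powr (q - 1))"
    using flowD[OF fl t] by auto
  have pq: "p \<noteq> 0" "q \<noteq> 0" "r \<noteq> 0" "s \<noteq> 0" using q_gt_1 q_less_p r_s by auto
  have tN: "t ^ N = t * t ^ (N - 1)" using N_ge_2 by (cases N) auto
  let ?E = "energy k l (u t) (v t)" and ?T = "t ^ (N - 1)"
  let ?vp = "v t powr p" and ?vq = "v t powr q" and ?ur = "u t powr r" and ?us = "u t powr s"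
  have "(poh k l b u v w has_real_derivative
     real N * ?T * ?E + - ((N - 1) / t * (?vp + k * ?vq)) * t ^ N
     - b * (?T * nonlin l (u t) * u t + - v t * w t)) (at t)"
    unfolding poh_def[abs_def]
    by (rule derivative_eq_intros DERIV_energy[OF fl t] u' w' refl | simp add: algebra_simps)+
  also have "nonlin l (u t) * u t = ?ur + l * ?us"
    unfolding nonlin_def using powr_mult_self[OF u, of "r-1"] powr_mult_self[OF u, of "s-1"]
    by (simp add: algebra_simps)
  hence "?T * nonlin l (u t) * u t = ?T * (?ur + l * ?us)" by (simp add: mult.assoc)
  also have "v t * w t = ?T * (?vp + k * ?vq)"
  proof -
    have "v t * (v t powr (p - 1) + k * v t powr (q - 1)) = ?vp + k * ?vq"
      using powr_mult_self[OF v, of "p-1"] powr_mult_self[OF v, of "q-1"]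
      by (simp add: distrib_left mult.left_commute)
    thus ?thesis unfolding w by (simp only: mult.left_commute[of "v t"])
  qed
  hence "- v t * w t = - (?T * (?vp + k * ?vq))" by simp
  also have "real N * ?T * ?E + - ((N - 1) / t * (?vp + k * ?vq)) * t ^ N
     - b * (?T * (?ur + l * ?us) + - (?T * (?vp + k * ?vq))) =
     ?T * (N * ?E - (N - 1) * (?vp + k * ?vq) - b * (?ur + l * ?us) + b * (?vp + k * ?vq))"
    unfolding tN using t by (simp add: algebra_simps)
  also have "N * ?E - (N - 1) * (?vp + k * ?vq) - b * (?ur + l * ?us) + b * (?vp + k * ?vq)
     = (N / r - b) * ?ur + l * (N / s - b) * ?us + (b - (N / p - 1)) * ?vp + k * (b - (N / q - 1)) * ?vq"
    unfolding energy_def using pq N_ge_2 by (simp add: field_simps of_nat_diff)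
  finally show ?thesis .
qed

lemma continuous_on_powr_pos:
  fixes g :: "'a::topological_space \<Rightarrow> real"
  shows "continuous_on S g \<Longrightarrow> (\<And>x. x \<in> S \<Longrightarrow> 0 \<le> g x) \<Longrightarrow> 0 < a \<Longrightarrow> continuous_on S (\<lambda>x. g x powr a)"
  by (rule continuous_on_powr') auto

lemma continuous_on_energy:
  assumes "continuous_on S u" "continuous_on S v" "\<And>t. t \<in> S \<Longrightarrow> 0 \<le> u t" "\<And>t. t \<in> S \<Longrightarrow> 0 \<le> v t"
  shows "continuous_on S (\<lambda>t. energy k l (u t) (v t))"
proof -
  have pq: "0 < p" "0 < q" "0 < r" "0 < s" using q_gt_1 q_less_p r_s by auto
  show ?thesis unfolding energy_def divide_inverse
    by (intro continuous_on_add continuous_on_mult continuous_on_const continuous_on_powr_pos assms pq)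
qed

lemma flow_energy_continuous:
  assumes fl: "flow k l T u v w"
  shows "continuous_on {0..T} (\<lambda>t. energy k l (u t) (v t))" "continuous_on {0..T} w"
    "continuous_on {0..T} (poh k l b u v w)"
proof -
  have c: "continuous_on {0..T} u" "continuous_on {0..T} v" and pos: "\<And>t. t \<in> {0..T} \<Longrightarrow> 0 < u t \<and> 0 \<le> v t"
    and w: "\<And>t. t \<in> {0..T} \<Longrightarrow> w t = t ^ (N - 1) * (v t powr (p - 1) + k * v t powr (q - 1))"
    using fl unfolding flow_def by auto
  have pq: "0 < p" "0 < q" "1 < p" "1 < q" "0 < r" "0 < s" using q_gt_1 q_less_p r_s by auto
  show e: "continuous_on {0..T} (\<lambda>t. energy k l (u t) (v t))"
    by (rule continuous_on_energy) (use c pos in \<open>auto simp: less_imp_le\<close>)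
  have "continuous_on {0..T} (\<lambda>t. t ^ (N - 1) * (v t powr (p - 1) + k * v t powr (q - 1)))"
    by (intro continuous_on_add continuous_on_mult continuous_on_const continuous_on_powr_pos continuous_on_power continuous_on_id c)
       (use pos pq in auto)
  thus cw: "continuous_on {0..T} w" by (rule continuous_on_eq) (use w in auto)
  show "continuous_on {0..T} (poh k l b u v w)"
    unfolding poh_def[abs_def] by (intro continuous_intros e cw c)
qed

lemma energy_antimono:
  assumes fl: "flow k l T u v w" and "0 \<le> k" and ab: "0 \<le> a" "a \<le> b" "b \<le> T"
  shows "energy k l (u b) (v b) \<le> energy k l (u a) (v a)"
proof (rule DERIV_nonpos_imp_decreasing_open[OF ab(2)])
  fix t assume "a < t" "t < b"
  hence t: "0 < t" "t < T" using ab by auto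
  have "0 \<le> real (N - 1) / t * (v t powr p + k * v t powr q)"
    using t N_ge_2 assms(2) by (intro mult_nonneg_nonneg divide_nonneg_nonneg add_nonneg_nonneg) auto
  thus "\<exists>y. ((\<lambda>t. energy k l (u t) (v t)) has_real_derivative y) (at t) \<and> y \<le> 0"
    using DERIV_energy[OF fl t] by (intro exI conjI) auto
qed (rule continuous_on_subset[OF flow_energy_continuous(1)[OF fl]], use ab in auto)

lemma flow_0:
  assumes "flow k l T u v w" "0 \<le> T"
  shows "w 0 = 0" "poh k l b u v w 0 = 0" "energy k l (u 0) (v 0) = u 0 powr r / r + l * u 0 powr s / s"
proof -
  show w: "w 0 = 0" using assms N_ge_2 by (auto simp: flow_def)
  show "poh k l b u v w 0 = 0" using w N_ge_2 by (simp add: poh_def)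
  show "energy k l (u 0) (v 0) = u 0 powr r / r + l * u 0 powr s / s"
    using assms q_gt_1 q_less_p by (auto simp: energy_def flow_def)
qed

text \<open>With \<open>N / r < b0 < N / q - 1\<close> the only term of the wrong sign in \<open>DERIV_poh\<close> is the one in \<open>v powr p\<close>,
  and it is absorbed by the one in \<open>v powr q\<close> as soon as \<open>v \<le> v0\<close>, in particular below energy \<open>eps0\<close>.\<close>

definition b0 :: real where "b0 = (N / r + (N / q - 1)) / 2"

definition v0 :: real where "v0 = ((N / q - 1 - b0) / (2 * (b0 - (N / p - 1)))) powr (1 / (p - q))"

definition eps0 :: real where "eps0 = (p - 1) / p * v0 powr p"

lemma b0: "N / r < b0" "b0 < N / q - 1" "N / p - 1 < b0" "N / s < b0" "0 < b0"
proof -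
  have m: "x < (x + y) / 2" "(x + y) / 2 < y" if "x < y" for x y :: real using that by auto
  have 1: "N / r < b0" using m(1)[OF r_super] unfolding b0_def .
  have 2: "b0 < N / q - 1" using m(2)[OF r_super] unfolding b0_def .
  have 3: "N / p - 1 < b0" "N / s < b0" using 1 r_sub s_super by auto
  note * = 1 2 3
  show "N / r < b0" "b0 < N / q - 1" "N / p - 1 < b0" "N / s < b0" using * by auto
  have "0 < N / r" using r_s N_ge_2 by auto
  thus "0 < b0" using * by simp
qed

lemma v0: "0 < v0" "(b0 - (N / p - 1)) * v0 powr (p - q) = (N / q - 1 - b0) / 2" and eps0: "0 < eps0"
proof -
  define A B where "A = N / q - 1 - b0" and "B = b0 - (N / p - 1)"
  have AB: "0 < A" "0 < B" using b0 by (auto simp: A_def B_def)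
  have "v0 = (A / (2 * B)) powr (1 / (p - q))" by (simp add: v0_def A_def B_def)
  hence "0 < v0" "v0 powr (p - q) = A / (2 * B)" using AB q_less_p by (auto simp: powr_powr)
  hence "0 < v0" "B * v0 powr (p - q) = A / 2" using AB by auto
  thus v: "0 < v0" "(b0 - (N / p - 1)) * v0 powr (p - q) = (N / q - 1 - b0) / 2"
    by (auto simp: A_def B_def)
  show "0 < eps0" using v q_gt_1 q_less_p by (auto simp: eps0_def)
qed

lemma energy_le_imp_le_v0:
  assumes "energy k l x y \<le> eps0" "0 \<le> k" "0 \<le> l" "0 \<le> y" "0 < x"
  shows "y \<le> v0"
proof (rule ccontr)
  assume "\<not> y \<le> v0"
  hence "v0 powr p < y powr p" using v0 q_gt_1 q_less_p by (intro powr_less_mono2) auto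
  hence "eps0 < (p - 1) / p * y powr p"
    unfolding eps0_def using q_gt_1 q_less_p by (intro mult_strict_left_mono) auto
  also have "\<dots> \<le> energy k l x y" unfolding energy_def
    using assms q_gt_1 r_s by simp
  finally show False using assms by simp
qed

text \<open>For \<open>v t \<le> v0\<close> the \<open>p\<close>-term uses up at most half of the
  \<open>q\<close>-term. The other half is kept in the bound because \<open>first_decay\<close>
  turns it into a decay rate.\<close>

lemma DERIV_poh_le:
  assumes fl: "flow 1 l T u v w" and t: "0 < t" "t < T" and l: "0 \<le> l" and "v t \<le> v0"
  shows "\<exists>d. (poh 1 l b0 u v w has_real_derivative d) (at t) \<and>
    d \<le> - (t ^ (N - 1) * ((b0 - N / r) * u t powr r + (N / q - 1 - b0) / 2 * v t powr q))"
proof -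
  have v: "0 < v t" using fl t unfolding flow_def by auto
  have "v t powr p = v t powr (p - q) * v t powr q" using v by (simp add: powr_add[symmetric])
  also have "\<dots> \<le> v0 powr (p - q) * v t powr q"
    using v assms q_less_p by (intro mult_right_mono powr_mono2) auto
  finally have "(b0 - (N / p - 1)) * v t powr p \<le> (b0 - (N / p - 1)) * (v0 powr (p - q) * v t powr q)"
    using b0 by (intro mult_left_mono) auto
  also have "\<dots> = (N / q - 1 - b0) / 2 * v t powr q" using v0 by (simp only: mult.assoc[symmetric])
  finally have 1: "(b0 - (N / p - 1)) * v t powr p \<le> (N / q - 1 - b0) / 2 * v t powr q" .
  have 2: "l * (N / s - b0) * u t powr s \<le> 0" using l b0 by (intro mult_nonpos_nonneg mult_nonneg_nonpos) auto
  have "(N / r - b0) * u t powr r + l * (N / s - b0) * u t powr s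
       + (b0 - (N / p - 1)) * v t powr p + 1 * (b0 - (N / q - 1)) * v t powr q
     \<le> - ((b0 - N / r) * u t powr r + (N / q - 1 - b0) / 2 * v t powr q)"
  proof -
    have "1 * (b0 - (N / q - 1)) * v t powr q = - (2 * ((N / q - 1 - b0) / 2 * v t powr q))"
    proof -
      have "1 * (b0 - c) * y = - (2 * ((c - b0) / 2 * y))" for c y :: real by (simp add: field_simps)
      thus ?thesis .
    qed
    moreover have "(N / r - b0) * u t powr r = - ((b0 - N / r) * u t powr r)" by (simp add: algebra_simps)
    ultimately show ?thesis using 1 2 by linarith
  qed
  hence "t ^ (N - 1) * ((N / r - b0) * u t powr r + l * (N / s - b0) * u t powr s
       + (b0 - (N / p - 1)) * v t powr p + 1 * (b0 - (N / q - 1)) * v t powr q)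
     \<le> t ^ (N - 1) * - ((b0 - N / r) * u t powr r + (N / q - 1 - b0) / 2 * v t powr q)"
    using t by (intro mult_left_mono) auto
  thus ?thesis using DERIV_poh[OF fl t, of b0] by (intro exI conjI) (assumption, simp only: mult_minus_right)
qed

lemma poh_decreasing:
  assumes fl: "flow 1 l T u v w" and l: "0 \<le> l" and ab: "0 \<le> a" "a < b" "b \<le> T"
    and E: "energy 1 l (u a) (v a) \<le> eps0"
  shows "poh 1 l b0 u v w b < poh 1 l b0 u v w a"
proof (rule DERIV_neg_imp_decreasing_open[OF ab(2)])
  fix t assume at: "a < t" "t < b"
  hence t: "0 < t" "t < T" using ab by auto
  have uv: "0 < u t" "0 < v t" using fl t unfolding flow_def by auto
  have "energy 1 l (u t) (v t) \<le> eps0"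
    using energy_antimono[OF fl, of a t] ab at t E by auto
  hence "v t \<le> v0" by (rule energy_le_imp_le_v0) (use uv l in auto)
  moreover have "0 < t ^ (N - 1) * ((b0 - N / r) * u t powr r + (N / q - 1 - b0) / 2 * v t powr q)"
    using t uv b0 by (intro mult_pos_pos add_pos_pos) auto
  ultimately show "\<exists>y. (poh 1 l b0 u v w has_real_derivative y) (at t) \<and> y < 0"
    using DERIV_poh_le[OF fl t l] by fastforce
qed (rule continuous_on_subset[OF flow_energy_continuous(3)[OF fl]], use ab in auto)

text \<open>Dividing by \<open>w t / t ^ (N - 1)\<close> turns negativity of the functional into a
  linear bound of \<open>t * v\<close> by \<open>u\<close>. A solution that approaches 0 with slope
  bounded away from 0 violates it.\<close>

lemma poh_neg_imp:
  assumes fl: "flow 1 l T u v w" and l: "0 \<le> l" and t: "0 < t" "t \<le> T" and P: "poh 1 l b0 u v w t < 0"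
  shows "t * ((q - 1) / q) * v t < b0 * u t"
proof (cases "v t = 0")
  case True
  thus ?thesis using fl t b0 by (auto simp: flow_def)
next
  case False
  hence v: "0 < v t" and u: "0 < u t" and w: "w t = t ^ (N - 1) * (v t powr (p - 1) + v t powr (q - 1))"
    using fl t by (auto simp: flow_def less_le)
  let ?h = "v t powr (p - 1) + v t powr (q - 1)"
  have tN: "t ^ N = t * t ^ (N - 1)" using N_ge_2 by (cases N) auto
  have "t ^ (N - 1) * (t * energy 1 l (u t) (v t)) < t ^ (N - 1) * (b0 * ?h * u t)"
    using P unfolding poh_def w tN by (simp add: mult_ac)
  hence 1: "t * energy 1 l (u t) (v t) < b0 * ?h * u t" using t by simp
  \<comment> \<open>The smaller kinetic coefficient serves for both terms, so that the common factor
    \<open>?h\<close> can be split off.\<close>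
  have c: "(q - 1) / q \<le> (p - 1) / p" using q_gt_1 q_less_p by (simp add: field_simps)
  have "(q - 1) / q * v t * ?h = (q - 1) / q * v t powr p + (q - 1) / q * v t powr q"
    using powr_mult_self[OF v, of "p-1"] powr_mult_self[OF v, of "q-1"] by (simp add: distrib_left mult.assoc)
  also have "\<dots> \<le> energy 1 l (u t) (v t)"
  proof -
    have "(q - 1) / q * v t powr p \<le> (p - 1) / p * v t powr p" using c by (rule mult_right_mono) simp
    moreover have "0 \<le> u t powr r / r" "0 \<le> l * u t powr s / s" using l r_s by auto
    ultimately show ?thesis unfolding energy_def by simp
  qed
  finally have "t * ((q - 1) / q * v t * ?h) \<le> t * energy 1 l (u t) (v t)" using t by (intro mult_left_mono) auto
  hence "(t * ((q - 1) / q) * v t) * ?h < (b0 * u t) * ?h" using 1 by (simp add: mult_ac)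
  moreover have "0 < ?h" using v by (intro add_pos_pos) auto
  ultimately show ?thesis by (simp only: mult_less_cancel_right_pos)
qed

end

section \<open>Shooting\<close>

lemma powr_lipschitz:
  fixes a x y :: real
  assumes "0 < x" shows "\<exists>L. L-lipschitz_on {x..y} (\<lambda>z. z powr a)"
proof -
  have "continuous_on {x..y} (\<lambda>z. a * z powr (a - 1))"
    using assms by (intro continuous_intros) auto
  hence "bounded ((\<lambda>z. a * z powr (a - 1)) ` {x..y})"
    by (intro compact_imp_bounded compact_continuous_image) auto
  then obtain L where L: "\<And>z. z \<in> {x..y} \<Longrightarrow> \<bar>a * z powr (a - 1)\<bar> \<le> L" "0 < L"
    unfolding bounded_pos by (auto simp del: atLeastAtMost_iff)
  have "L-lipschitz_on {x..y} (\<lambda>z. z powr a)"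
  proof (rule bounded_derivative_imp_lipschitz)
    fix z assume z: "z \<in> {x..y}"
    show "((\<lambda>z. z powr a) has_derivative (\<lambda>h. a * z powr (a - 1) * h)) (at z within {x..y})"
      using z assms unfolding has_field_derivative_def[symmetric]
      by (auto intro!: derivative_eq_intros)
    show "onorm (\<lambda>h. a * z powr (a - 1) * h) \<le> L"
      by (rule onorm_bound) (use L z in \<open>auto simp: abs_mult intro!: mult_right_mono\<close>)
  qed (use L in auto)
  thus ?thesis by blast
qed

locale problem = exponents +
  fixes l :: real
  assumes l_pos: "0 < l"
begin

lemma radial_ode_nonlin: "radial_ode p q N (nonlin l)"
proof unfold_locales
  fix x y :: real assume x: "0 < x"
  show "0 < nonlin l x" unfolding nonlin_def using x l_pos by (intro add_pos_pos mult_pos_pos) auto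
  assume xy: "x \<le> y"
  show "nonlin l x \<le> nonlin l y"
    unfolding nonlin_def using x xy l_pos r_s by (intro add_mono mult_left_mono powr_mono2) auto
  obtain L1 L2 where "L1-lipschitz_on {x..y} (\<lambda>z. z powr (r - 1))" "L2-lipschitz_on {x..y} (\<lambda>z. z powr (s - 1))"
    using powr_lipschitz[OF x] by metis
  hence "(L1 + \<bar>l\<bar> * L2)-lipschitz_on {x..y} (\<lambda>z. z powr (r - 1) + l * z powr (s - 1))"
    by (intro lipschitz_on_add lipschitz_on_cmult_real)
  thus "\<exists>L. L-lipschitz_on {x..y} (nonlin l)" unfolding nonlin_def[abs_def] by blast
qed

sublocale radial_ode p q N "nonlin l"
  by (rule radial_ode_nonlin)

definition vel :: "(real \<Rightarrow> real) \<Rightarrow> real \<Rightarrow> real" where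
  "vel w t = flux_inv (w t / t ^ (N - 1))"

lemma sol_nonlin_bounds:
  assumes "sol T u w" "t \<in> {0..T}"
  shows "0 < u t" "nonlin l (u T) \<le> nonlin l (u t)" "nonlin l (u t) \<le> nonlin l (u 0)" "0 < nonlin l (u t)"
proof -
  have u: "0 < u t" "0 < u T" using assms by (auto simp: sol_def)
  have m: "u T \<le> u t" "u t \<le> u 0"
    using sol_mono(3)[OF assms(1), of t T] sol_mono(3)[OF assms(1), of 0 t] assms by auto
  show "0 < u t" "nonlin l (u T) \<le> nonlin l (u t)" "nonlin l (u t) \<le> nonlin l (u 0)" "0 < nonlin l (u t)"
    using u m f_mono f_pos by auto
qed

lemma sol_w_pos:
  assumes "sol T u w" "0 < t" "t \<le> T"
  shows "nonlin l (u T) * t ^ N / N \<le> w t" "0 < w t"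
proof -
  have T: "T \<in> {0..T}" using assms by auto
  show *: "nonlin l (u T) * t ^ N / N \<le> w t"
    by (rule weight_bounds(1)[where k = "\<lambda>t. nonlin l (u t)" and S = "{0..T}" and M = "nonlin l (u 0)"])
       (use assms sol_nonlin_bounds[OF assms(1)] in \<open>auto simp: sol_def radial_sol_def\<close>)
  have "0 < nonlin l (u T) * t ^ N / N" using sol_nonlin_bounds(4)[OF assms(1) T] assms N_ge_2 by auto
  thus "0 < w t" using * by linarith
qed

lemma sol_flow:
  assumes s: "sol T u w"
  shows "flow 1 l T u (vel w) w"
proof -
  have T: "0 < T" using s by (simp add: sol_def)
  note b = sol_nonlin_bounds[OF s]
  have w0: "w 0 = 0" using s by (simp add: sol_def radial_sol_def)
  have w': "(w has_real_derivative t ^ (N - 1) * nonlin l (u t)) (at t within {0..T})"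
    and u': "(u has_real_derivative - vel w t) (at t within {0..T})" if "t \<in> {0..T}" for t
    using s that by (auto simp: sol_def radial_sol_def vel_def)
  have at: "at t within {0..T} = at t" if "0 < t" "t < T" for t
    using that by (intro at_within_interior) auto
  note q = continuous_on_weight_quot[where k = "\<lambda>t. nonlin l (u t)" and M = "nonlin l (u 0)", OF w' w0]
  have qc: "continuous_on {0..T} (\<lambda>t. w t / t ^ (N - 1))"
    and q0: "\<And>t. t \<in> {0..T} \<Longrightarrow> 0 \<le> w t / t ^ (N - 1)"
    using q b by (auto simp: less_imp_le)
  have cv: "continuous_on {0..T} (vel w)"
    unfolding vel_def[abs_def] by (rule continuous_on_compose2[OF continuous_on_flux_inv qc]) (use q0 in auto)
  have v0: "vel w 0 = 0" by (simp add: vel_def w0)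
  have wv: "w t = t ^ (N - 1) * (vel w t powr (p - 1) + 1 * vel w t powr (q - 1))" if t: "t \<in> {0..T}" for t
  proof (cases "t = 0")
    case True thus ?thesis using w0 N_ge_2 by simp
  next
    case False
    thus ?thesis using flux_flux_inv[OF q0[OF t]] by (simp add: flux_def vel_def)
  qed
  have vpos: "0 < vel w t" if "0 < t" "t < T" for t
    unfolding vel_def using that sol_w_pos[OF s, of t] by (intro flux_inv_pos divide_pos_pos) auto
  have vd: "\<exists>d. (vel w has_real_derivative d) (at t)" if t: "0 < t" "t < T" for t
  proof -
    have "((\<lambda>t. t ^ (N - 1)) has_real_derivative real (N - 1) * t ^ (N - 1 - 1)) (at t)"
      by (auto intro!: derivative_eq_intros)
    hence "((\<lambda>t. w t / t ^ (N - 1)) has_real_derivative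
      ((t ^ (N - 1) * nonlin l (u t)) * t ^ (N - 1) - w t * (real (N - 1) * t ^ (N - 1 - 1))) / (t ^ (N - 1) * t ^ (N - 1))) (at t)"
      using t w'[of t] at[OF t] by (intro DERIV_divide) auto
    from DERIV_chain2[OF DERIV_flux_inv this] show ?thesis
      unfolding vel_def[abs_def] using t sol_w_pos[OF s, of t] by auto
  qed
  have cu: "continuous_on {0..T} u" using radial_sol_continuous s by (auto simp: sol_def)
  have vnn: "0 \<le> vel w t" if "t \<in> {0..T}" for t
    unfolding vel_def by (rule flux_inv_nonneg[OF q0[OF that]])
  show ?thesis unfolding flow_def
  proof (intro conjI ballI cu cv v0)
    fix t assume t: "t \<in> {0<..<T}"
    show "(u has_real_derivative - vel w t) (at t)" "(w has_real_derivative t ^ (N - 1) * nonlin l (u t)) (at t)"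
      using u'[of t] w'[of t] at[of t] t by auto
  qed (use b(1) vnn vpos vd wv in auto)
qed

text \<open>Energy below \<open>eps0\<close> guarantees that \<open>poh\<close> keeps decreasing
  from time \<open>T\<close> on, so negativity at this one time is permanent. Using strict
  inequalities at a finite time makes the condition open.\<close>

definition slow :: "real \<Rightarrow> bool" where
  "slow a \<longleftrightarrow> (\<exists>T u w. sol T u w \<and> u 0 = a \<and> energy 1 l (u T) (vel w T) < eps0 \<and> poh 1 l b0 u (vel w) w T < 0)"

lemma open_slow: "open (Collect slow)"
proof -
  \<comment> \<open>The two \<open>max 0\<close> extend the energy continuously to the whole plane
    of pairs \<open>(u T, w T)\<close>; on solutions their arguments are nonnegative and nothing
    changes.\<close>
  let ?e = "\<lambda>T z. energy 1 l (max 0 (fst z)) (flux_inv (max 0 (snd z / T ^ (N - 1))))"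
  define Q where "Q T = {z::real\<times>real. ?e T z < eps0} \<inter> {z. T ^ N * ?e T z - b0 * snd z * fst z < 0}" for T :: real
  have "continuous_on UNIV (?e T)" for T :: real
    unfolding divide_inverse
    by (intro continuous_on_energy continuous_on_compose2[OF continuous_flux_inv_max] continuous_intros)
       (auto intro!: flux_inv_nonneg)
  hence "open (Q T)" for T
    unfolding Q_def by (intro open_Int open_Collect_less continuous_intros) auto
  moreover have "Collect slow = {a. \<exists>T u w. sol T u w \<and> u 0 = a \<and> (u T, w T) \<in> Q T}"
  proof (intro Collect_cong)
    fix a
    have "sol T u w \<and> u 0 = a \<and> energy 1 l (u T) (vel w T) < eps0 \<and> poh 1 l b0 u (vel w) w T < 0 \<longleftrightarrow>
      sol T u w \<and> u 0 = a \<and> (u T, w T) \<in> Q T" for T u w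
    proof (cases "sol T u w")
      case True
      have "0 < T" using True by (simp add: sol_def)
      hence "0 \<le> u T" "0 \<le> w T / T ^ (N - 1)"
        using sol_nonlin_bounds(1)[OF True, of T] sol_w_pos(2)[OF True, of T] by auto
      thus ?thesis by (simp add: Q_def poh_def vel_def)
    qed simp
    thus "slow a \<longleftrightarrow> (\<exists>T u w. sol T u w \<and> u 0 = a \<and> (u T, w T) \<in> Q T)" unfolding slow_def by simp
  qed
  ultimately show ?thesis using open_sol_set[of Q] by simp
qed

text \<open>Once slow, a solution obeys \<open>poh_neg_imp\<close> at all later times, so
  \<open>t * v\<close> is at most a multiple of \<open>u\<close>. A crossing solution meets
  arbitrarily small levels with slope at least \<open>c\<close>, which is incompatible.\<close>

lemma slow_cross_disjoint: "\<not> (slow a \<and> will_cross a)"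
proof
  assume "slow a \<and> will_cross a"
  then obtain T1 u1 w1 where s1: "sol T1 u1 w1" "u1 0 = a" "energy 1 l (u1 T1) (vel w1 T1) < eps0" "poh 1 l b0 u1 (vel w1) w1 T1 < 0"
    and wc: "will_cross a" by (auto simp: slow_def)
  obtain T0 c \<delta>0 where T0: "0 < T0" "0 < c" "0 < \<delta>0"
    and re: "\<And>\<delta>. 0 < \<delta> \<Longrightarrow> \<delta> < \<delta>0 \<Longrightarrow> (\<exists>T u w. T0 \<le> T \<and> sol T u w \<and> u 0 = a \<and> u T = \<delta> \<and> c \<le> vel w T)"
    using will_cross_reaches[OF wc] unfolding vel_def by metis
  have T1: "0 < T1" "0 < u1 T1" using s1 by (auto simp: sol_def)
  \<comment> \<open>The level of \<open>u\<close> below which \<open>poh_neg_imp\<close> fails,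
    given time at least \<open>T0\<close> and slope at least \<open>c\<close>. Taking
    \<open>\<delta>\<close> also below \<open>u1 T1\<close> forces the level to be met after
    \<open>T1\<close>, where \<open>poh\<close> is already negative.\<close>
  define c1 where "c1 = T0 * ((q - 1) / q) * c / b0"
  have c1: "0 < c1" using T0 q_gt_1 b0 by (auto simp: c1_def)
  define \<delta> where "\<delta> = min (min \<delta>0 (u1 T1)) c1 / 2"
  have \<delta>: "0 < \<delta>" "\<delta> < \<delta>0" "\<delta> < u1 T1" "\<delta> < c1" using T0 T1 c1 by (auto simp: \<delta>_def)
  obtain T u w where s: "T0 \<le> T" "sol T u w" "u 0 = a" "u T = \<delta>" "c \<le> vel w T" using re \<delta> by blast
  have T: "0 < T" using s by (auto simp: sol_def)
  have TT: "T1 < T"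
  proof (rule ccontr)
    assume "\<not> T1 < T"
    hence "u T = u1 T" "u1 T1 \<le> u1 T"
      using sol_unique(1)[OF s(2) s1(1), of T] sol_mono(3)[OF s1(1), of T T1] s s1 T by auto
    thus False using s \<delta> by simp
  qed
  have eq: "u T1 = u1 T1" "w T1 = w1 T1" using sol_unique[OF s(2) s1(1), of T1] s s1 T1 TT by auto
  note fl = sol_flow[OF s(2)]
  have "poh 1 l b0 u (vel w) w T < poh 1 l b0 u (vel w) w T1"
    by (rule poh_decreasing[OF fl _ _ TT]) (use l_pos T1 s1 eq in \<open>auto simp: vel_def\<close>)
  also have "\<dots> < 0" using s1 eq by (simp add: poh_def vel_def)
  finally have P: "T * ((q - 1) / q) * vel w T < b0 * u T"
    using poh_neg_imp[OF fl] l_pos T by simp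
  have "T0 * ((q - 1) / q) * c \<le> T * ((q - 1) / q) * vel w T"
    using s T0 q_gt_1 by (intro mult_mono) auto
  also have "\<dots> < b0 * \<delta>" using P s by simp
  finally have "c1 < \<delta>" unfolding c1_def using b0(5) by (subst pos_divide_less_eq) (auto simp: mult.commute)
  thus False using \<delta> by simp
qed

text \<open>At time 0 the functional vanishes and the energy is the potential at \<open>a\<close>.
  If that lies below \<open>eps0\<close>, the functional decreases strictly at once, so any positive
  time of existence is good enough; the horizon 1 and the level \<open>a / 2\<close> merely produce
  one.\<close>

lemma small_slow:
  assumes "0 < a" "a powr r / r + l * a powr s / s < eps0"
  shows "slow a"
proof -
  obtain T u w where s: "sol T u w" "u 0 = a"
    using sol_or_hits[of 1 "a/2" a] assms by fastforce
  have T: "0 < T" using s by (auto simp: sol_def)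
  note fl = sol_flow[OF s(1)]
  note f0 = flow_0[OF fl less_imp_le[OF T]]
  have e0: "energy 1 l (u 0) (vel w 0) < eps0" using f0(3) s assms by simp
  have "energy 1 l (u T) (vel w T) \<le> energy 1 l (u 0) (vel w 0)"
    using energy_antimono[OF fl, of 0 T] T by simp
  moreover have "poh 1 l b0 u (vel w) w T < poh 1 l b0 u (vel w) w 0"
    by (rule poh_decreasing[OF fl]) (use l_pos T e0 in auto)
  ultimately show ?thesis unfolding slow_def using s e0 f0(2) by (metis le_less_trans)
qed

text \<open>Besides global existence, the decay analysis needs the failure of \<open>slow\<close> at
  every time: whenever the energy is small, \<open>poh\<close> is nonnegative.\<close>

lemma threshold:
  assumes a1: "0 < a1" "will_cross a1"
  shows "\<exists>u w. (\<forall>T>0. sol T u w) \<and> (\<forall>t>0. energy 1 l (u t) (vel w t) < eps0 \<longrightarrow> 0 \<le> poh 1 l b0 u (vel w) w t)"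
proof -
  have "((\<lambda>a. a powr r / r + l * a powr s / s) \<longlongrightarrow> 0 powr r / r + l * 0 powr s / s) (at_right 0)"
    using r_s by (intro tendsto_intros tendsto_powr') (auto simp: eventually_at_filter)
  hence "((\<lambda>a. a powr r / r + l * a powr s / s) \<longlongrightarrow> 0) (at_right 0)" by simp
  hence "eventually (\<lambda>a. a powr r / r + l * a powr s / s < eps0) (at_right 0)"
    using eps0 by (rule order_tendstoD)
  moreover have "eventually (\<lambda>a. a \<in> {0<..<a1}) (at_right 0)"
    using a1 by (intro eventually_at_right_real)
  ultimately have "eventually (\<lambda>a. a \<in> {0<..<a1} \<and> a powr r / r + l * a powr s / s < eps0) (at_right 0)"
    by (rule eventually_conj[rotated])
  then obtain a0 where a0: "0 < a0" "a0 < a1" "a0 powr r / r + l * a0 powr s / s < eps0"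
    using eventually_happens[of _ "at_right (0::real)"] by auto
  have "slow a0" using small_slow a0 by simp
  have "\<exists>a\<in>{a0..a1}. \<not> slow a \<and> \<not> will_cross a"
  proof (rule ccontr)
    assume "\<not> ?thesis"
    hence "{a0..a1} \<subseteq> Collect slow \<union> Collect will_cross" by auto
    moreover have "Collect slow \<inter> Collect will_cross \<inter> {a0..a1} = {}" using slow_cross_disjoint by auto
    moreover have "Collect slow \<inter> {a0..a1} \<noteq> {}" "Collect will_cross \<inter> {a0..a1} \<noteq> {}"
      using \<open>slow a0\<close> a1 a0 by auto
    ultimately show False using connectedD[OF connected_Icc open_slow open_will_cross] by blast
  qed
  then obtain a where a: "a0 \<le> a" "\<not> slow a" "\<not> will_cross a" by auto
  then obtain u w where u: "u 0 = a" "\<And>T. 0 < T \<Longrightarrow> sol T u w" using not_cross_imp_global_sol[of a] a0 by auto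
  have "0 \<le> poh 1 l b0 u (vel w) w t" if "0 < t" "energy 1 l (u t) (vel w t) < eps0" for t
  proof (rule ccontr)
    assume "\<not> 0 \<le> poh 1 l b0 u (vel w) w t"
    hence "slow a" unfolding slow_def using u(1) u(2)[OF that(1)] that
      by (intro exI[of _ t] exI[of _ u] exI[of _ w]) simp
    thus False using a(2) by blast
  qed
  thus ?thesis using u by blast
qed

end

section \<open>Decay of the threshold solution\<close>

lemma decay_from_1:
  fixes g :: "real \<Rightarrow> real"
  assumes "continuous_on {0..T} g" "1 \<le> T" "0 \<le> K" "0 \<le> \<beta>" and d: "\<And>t. T \<le> t \<Longrightarrow> g t \<le> K * t powr - \<beta>"
  shows "\<exists>C>0. \<forall>t\<ge>0. g t \<le> C * (1 + t) powr - \<beta>"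
proof -
  have "bounded (g ` {0..T})" by (intro compact_imp_bounded compact_continuous_image assms) auto
  then obtain B where B: "0 < B" "\<And>t. t \<in> {0..T} \<Longrightarrow> g t \<le> B"
    unfolding bounded_pos by (auto simp: abs_le_iff simp del: atLeastAtMost_iff)
  define C where "C = B * (1 + T) powr \<beta> + K * 2 powr \<beta>"
  have "g t \<le> C * (1 + t) powr - \<beta>" if t: "0 \<le> t" for t
  proof (cases "t \<le> T")
    case True
    have "(1 + t) powr \<beta> \<le> (1 + T) powr \<beta>" using t True assms by (intro powr_mono2) auto
    hence "1 \<le> (1 + T) powr \<beta> * (1 + t) powr - \<beta>" using t by (simp add: powr_minus field_simps)
    hence "B * 1 \<le> B * ((1 + T) powr \<beta> * (1 + t) powr - \<beta>)" using B by (intro mult_left_mono) auto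
    also have "\<dots> \<le> C * (1 + t) powr - \<beta>" using assms by (simp add: C_def distrib_right mult.assoc)
    finally show ?thesis using B(2)[of t] t True by auto
  next
    case False
    hence t': "1 \<le> t" "T \<le> t" using assms by auto
    have "(1 + t) powr \<beta> \<le> (2 * t) powr \<beta>" using t' assms by (intro powr_mono2) auto
    also have "\<dots> = 2 powr \<beta> * t powr \<beta>" using t' by (simp add: powr_mult)
    finally have "t powr - \<beta> \<le> 2 powr \<beta> * (1 + t) powr - \<beta>" using t' by (simp add: powr_minus field_simps)
    hence "K * t powr - \<beta> \<le> K * (2 powr \<beta> * (1 + t) powr - \<beta>)" using assms by (intro mult_left_mono) auto
    also have "\<dots> \<le> C * (1 + t) powr - \<beta>" using assms B by (simp add: C_def distrib_right mult.assoc)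
    finally show ?thesis using d[OF t'(2)] by simp
  qed
  moreover have "0 < C" using B assms by (auto simp: C_def intro!: add_pos_nonneg)
  ultimately show ?thesis by blast
qed

context problem begin

lemma global_deriv:
  assumes s: "\<And>T. 0 < T \<Longrightarrow> sol T u w" and t: "0 < t"
  shows "(u has_real_derivative - vel w t) (at t)" "(w has_real_derivative t ^ (N - 1) * nonlin l (u t)) (at t)"
    "0 < u t" "0 < vel w t" "w t = t ^ (N - 1) * (vel w t powr (p - 1) + vel w t powr (q - 1))"
proof -
  have "0 < t + 1" "t < t + 1" using t by auto
  note fl = flowD[OF sol_flow[OF s[OF this(1)]] t this(2)]
  show "(u has_real_derivative - vel w t) (at t)" "(w has_real_derivative t ^ (N - 1) * nonlin l (u t)) (at t)"
    "0 < u t" "0 < vel w t" "w t = t ^ (N - 1) * (vel w t powr (p - 1) + vel w t powr (q - 1))"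
    using fl by auto
qed

text \<open>If \<open>u\<close> stayed above \<open>e\<close>, then \<open>w \<tau>\<close> would be
  at least a multiple of \<open>\<tau> ^ N\<close>, so the slope on
  \<open>{\<tau>..2 * \<tau>}\<close> would be at least a fixed \<open>c\<close>. The choice of
  \<open>\<tau>\<close> makes the loss \<open>\<tau> * c\<close> at least
  \<open>u 0\<close>.\<close>

lemma global_u_small:
  assumes s: "\<And>T. 0 < T \<Longrightarrow> sol T u w" and e: "0 < e"
  shows "\<exists>t>0. u t < e"
proof (rule ccontr)
  assume "\<not> ?thesis"
  hence ue: "e \<le> u t" if "0 < t" for t using that by (meson not_less)
  define c where "c = flux_inv (nonlin l e / N / 2 ^ (N - 1))"
  have c: "0 < c" unfolding c_def using f_pos[OF e] N_ge_2 by (intro flux_inv_pos) auto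
  define \<tau> where "\<tau> = max 1 (u 0 / c)"
  have "u 0 / c \<le> \<tau>" by (simp add: \<tau>_def)
  hence "u 0 \<le> \<tau> * c" using c by (simp add: pos_divide_le_eq)
  moreover have "1 \<le> \<tau>" by (simp add: \<tau>_def)
  ultimately have \<tau>: "1 \<le> \<tau>" "u 0 \<le> \<tau> * c" by auto
  have s': "sol (2 * \<tau>) u w" using s \<tau> by simp
  have "nonlin l e * \<tau> ^ N / N \<le> w \<tau>"
  proof -
    have "nonlin l e * \<tau> ^ N / N \<le> nonlin l (u \<tau>) * \<tau> ^ N / N"
      using f_mono[OF e ue[of \<tau>]] \<tau> by (intro divide_right_mono mult_right_mono) auto
    also have "\<dots> \<le> w \<tau>" using sol_w_pos(1)[OF s, of \<tau> \<tau>] \<tau> by auto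
    finally show ?thesis .
  qed
  hence "nonlin l e * \<tau> ^ N / N / (2 * \<tau>) ^ (N - 1) \<le> w \<tau> / (2 * \<tau>) ^ (N - 1)"
    using \<tau> by (intro divide_right_mono) auto
  moreover have "nonlin l e * \<tau> ^ N / N / (2 * \<tau>) ^ (N - 1) = (nonlin l e * \<tau> / N) / 2 ^ (N - 1)"
  proof -
    have "nonlin l e * \<tau> ^ N / N / \<tau> ^ (N - 1) = nonlin l e * \<tau> / N" using \<tau> by (intro weight_quot) auto
    moreover have "nonlin l e * \<tau> ^ N / N / (2 * \<tau>) ^ (N - 1) = (nonlin l e * \<tau> ^ N / N / \<tau> ^ (N - 1)) / 2 ^ (N - 1)"
      by (simp add: power_mult_distrib)
    ultimately show ?thesis by (simp only:)
  qed
  moreover have "nonlin l e / N / 2 ^ (N - 1) \<le> (nonlin l e * \<tau> / N) / 2 ^ (N - 1)"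
    using f_pos[OF e] \<tau> by (intro divide_right_mono) auto
  ultimately have "nonlin l e / N / 2 ^ (N - 1) \<le> w \<tau> / (2 * \<tau>) ^ (N - 1)" by linarith
  moreover have "0 \<le> nonlin l e / N / 2 ^ (N - 1)" using f_pos[OF e] by simp
  ultimately have "c \<le> flux_inv (w \<tau> / (2 * \<tau>) ^ (N - 1))"
    unfolding c_def by (subst flux_inv_le_iff) auto
  hence "\<tau> * c \<le> (2 * \<tau> - \<tau>) * flux_inv (w \<tau> / (2 * \<tau>) ^ (N - 1))" using \<tau> by simp
  moreover have "u (2 * \<tau>) \<le> u \<tau> - (2 * \<tau> - \<tau>) * flux_inv (w \<tau> / (2 * \<tau>) ^ (N - 1))"
    by (rule sol_mono(4)[OF s']) (use \<tau> in auto)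
  ultimately have "u (2 * \<tau>) \<le> u \<tau> - \<tau> * c" by linarith
  moreover have "u \<tau> \<le> u 0" using sol_mono(3)[OF s', of 0 \<tau>] \<tau> by auto
  moreover have "0 < u (2 * \<tau>)" using ue[of "2 * \<tau>"] e \<tau> by auto
  ultimately show False using \<tau> by linarith
qed

text \<open>Once \<open>u\<close> is small, an energy of at least \<open>eps0\<close> must be
  kinetic; the velocity would then stay above \<open>d / 2\<close> and drive \<open>u\<close> below
  0.\<close>

lemma global_energy_small:
  assumes s: "\<And>T. 0 < T \<Longrightarrow> sol T u w"
  shows "\<exists>t\<ge>1. energy 1 l (u t) (vel w t) < eps0"
proof (rule ccontr)
  assume "\<not> ?thesis"
  hence E: "eps0 \<le> energy 1 l (u t) (vel w t)" if "1 \<le> t" for t using that by (meson not_less)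
  define F where "F x = x powr r / r + l * x powr s / s" for x
  define G where "G y = (p - 1) / p * y powr p + (q - 1) / q * y powr q" for y
  have pq: "0 < p" "0 < q" "1 < p" using q_gt_1 q_less_p by auto
  have lim: "(F \<longlongrightarrow> 0) (at_right 0)" "(G \<longlongrightarrow> 0) (at_right 0)"
  proof -
    have "((\<lambda>x. x powr r / r + l * x powr s / s) \<longlongrightarrow> 0 powr r / r + l * 0 powr s / s) (at_right 0)"
      using r_s by (intro tendsto_intros tendsto_powr') (auto simp: eventually_at_filter)
    thus "(F \<longlongrightarrow> 0) (at_right 0)" by (simp add: F_def[abs_def])
    have "((\<lambda>y. (p - 1) / p * y powr p + (q - 1) / q * y powr q) \<longlongrightarrow> (p - 1) / p * 0 powr p + (q - 1) / q * 0 powr q) (at_right 0)"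
      using pq by (intro tendsto_intros tendsto_powr') (auto simp: eventually_at_filter)
    thus "(G \<longlongrightarrow> 0) (at_right 0)" by (simp add: G_def[abs_def])
  qed
  have "eventually (\<lambda>x. F x < eps0 / 2) (at_right 0)" "eventually (\<lambda>x. G x < eps0 / 2) (at_right 0)"
    using eps0 order_tendstoD(2)[OF lim(1), of "eps0/2"] order_tendstoD(2)[OF lim(2), of "eps0/2"] by auto
  then obtain d where d: "0 < d" "\<And>x. 0 < x \<Longrightarrow> x < d \<Longrightarrow> F x < eps0 / 2 \<and> G x < eps0 / 2"
    using eventually_conj unfolding eventually_at_right_field by (metis (no_types, lifting) min_less_iff_conj)
  obtain t1 where t1: "0 < t1" "u t1 < d" using global_u_small[OF s d(1)] by blast
  define t2 where "t2 = max t1 1"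
  have um: "u b \<le> u a" if "0 \<le> a" "a \<le> b" "0 < b" for a b
    using sol_mono(3)[OF s[of b], of a b] that by auto
  have ud: "u t < d" if "t2 \<le> t" for t using um[of t1 t] that t1 by (auto simp: t2_def)
  have v: "d / 2 \<le> vel w t" if t: "t2 \<le> t" for t
  proof (rule ccontr)
    assume a: "\<not> d / 2 \<le> vel w t"
    have t0: "0 < t" "1 \<le> t" using t by (auto simp: t2_def)
    note g = global_deriv[OF s t0(1)]
    have "F (u t) < eps0 / 2" "G (vel w t) < eps0 / 2" using d(2)[of "u t"] d(2)[of "vel w t"] ud[OF t] g a by auto
    moreover have "energy 1 l (u t) (vel w t) = G (vel w t) + F (u t)" by (simp add: energy_def F_def G_def)
    ultimately have "energy 1 l (u t) (vel w t) < eps0" by linarith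
    thus False using E[OF t0(2)] by simp
  qed
  \<comment> \<open>At rate \<open>d / 2\<close> the value \<open>u t2\<close> is used up by this
    time, with \<open>d / 2\<close> to spare.\<close>
  define t3 where "t3 = t2 + 2 * u t2 / d + 1"
  have ut2: "0 < u t2" using global_deriv(3)[OF s, of t2] t1 by (auto simp: t2_def)
  have "0 \<le> 2 * u t2 / d" using d ut2 by simp
  hence t23: "0 < t2" "t2 \<le> t3" by (auto simp: t3_def, simp add: t2_def)
  have "u t3 - u t2 \<le> (- (d/2)) * t3 - (- (d/2)) * t2"
  proof (rule deriv_compare[OF _ _ _ t23(2)])
    fix t assume t: "t \<in> {t2..t3}"
    show "(u has_real_derivative - vel w t) (at t within {t2..t3})"
      using global_deriv(1)[OF s, of t] t t23 by (auto intro: has_field_derivative_at_within)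
    show "((\<lambda>t. (- (d/2)) * t) has_real_derivative (- (d/2))) (at t within {t2..t3})"
      by (auto intro!: derivative_eq_intros)
  qed (use v in auto)
  also have "\<dots> = - (d / 2) * (t3 - t2)" by (simp only: right_diff_distrib)
  also have "\<dots> = - u t2 - d / 2" using d by (simp add: t3_def field_simps)
  finally have "u t3 < 0" using d by simp
  thus False using global_deriv(3)[OF s, of t3] t23 by simp
qed

text \<open>One round of the bootstrap: \<open>flux_inv_le_powr\<close> converts decay of the flux
  into decay of the velocity, and integration from infinity into decay of \<open>u\<close>. The
  hypothesis \<open>q - 1 < \<beta>\<close> makes the velocity rate exceed 1, hence
  integrable.\<close>

lemma decay_step:
  assumes s: "\<And>T. 0 < T \<Longrightarrow> sol T u w" and T0: "1 \<le> T0" and "0 \<le> K" and \<beta>: "q - 1 < \<beta>"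
    and h: "\<And>t. T0 \<le> t \<Longrightarrow> w t / t ^ (N - 1) \<le> K * t powr - \<beta>"
  shows "\<exists>K'\<ge>0. \<forall>t\<ge>T0. vel w t \<le> K' * t powr - (\<beta> / (q - 1)) \<and> u t \<le> K' * t powr - (\<beta> / (q - 1) - 1)"
proof -
  define \<mu> where "\<mu> = \<beta> / (q - 1)"
  have \<mu>: "1 < \<mu>" using \<beta> q_gt_1 by (simp add: \<mu>_def)
  define K1 where "K1 = K powr (1 / (q - 1))"
  have K1: "0 \<le> K1" by (simp add: K1_def)
  have v: "vel w t \<le> K1 * t powr - \<mu>" if t: "T0 \<le> t" for t
  proof -
    have t0: "0 < t" using t T0 by simp
    have h0: "0 \<le> w t / t ^ (N - 1)" using sol_w_pos(2)[OF s[OF t0], of t] t0 by auto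
    have "vel w t \<le> (w t / t ^ (N - 1)) powr (1 / (q - 1))"
      unfolding vel_def by (rule flux_inv_le_powr[OF h0])
    also have "\<dots> \<le> (K * t powr - \<beta>) powr (1 / (q - 1))"
      using h[OF t] h0 q_gt_1 by (intro powr_mono2) auto
    also have "\<dots> = K1 * t powr - \<mu>" using assms by (simp add: K1_def \<mu>_def powr_mult powr_powr)
    finally show ?thesis .
  qed
  define g where "g t = K1 / (\<mu> - 1) * t powr (1 - \<mu>)" for t
  \<comment> \<open>\<open>g t\<close> is the integral of the velocity bound from \<open>t\<close>
    to infinity. Since \<open>u\<close> takes arbitrarily small values, comparison up to a time
    where it is below \<open>e\<close> replaces the limit at infinity.\<close>
  have u: "u t \<le> g t" if t: "T0 \<le> t" for t
  proof (rule field_le_epsilon)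
    fix e :: real assume "0 < e"
    then obtain t1 where t1: "0 < t1" "u t1 < e" using global_u_small[OF s] by blast
    define \<tau> where "\<tau> = max t t1"
    have \<tau>: "t \<le> \<tau>" "0 < t" "0 < \<tau>" using t T0 by (auto simp: \<tau>_def)
    have "g \<tau> - g t \<le> u \<tau> - u t"
    proof (rule deriv_compare[OF _ _ _ \<tau>(1)])
      fix x assume x: "x \<in> {t..\<tau>}"
      hence "0 < x" using \<tau> by auto
      hence "(g has_real_derivative K1 / (\<mu> - 1) * ((1 - \<mu>) * x powr (1 - \<mu> - 1))) (at x within {t..\<tau>})"
        unfolding g_def[abs_def] by (intro DERIV_cmult has_field_derivative_at_within[OF has_real_derivative_powr])
      also have "K1 / (\<mu> - 1) * ((1 - \<mu>) * x powr (1 - \<mu> - 1)) = - (K1 * x powr - \<mu>)"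
      proof -
        have "K1 / (\<mu> - 1) * (1 - \<mu>) = - K1" using \<mu> by (simp add: field_simps)
        thus ?thesis by (simp add: mult.assoc[symmetric])
      qed
      finally show "(g has_real_derivative - (K1 * x powr - \<mu>)) (at x within {t..\<tau>})" .
      show "(u has_real_derivative - vel w x) (at x within {t..\<tau>})"
        using global_deriv(1)[OF s, of x] x \<tau> by (auto intro: has_field_derivative_at_within)
    qed (use v t in auto)
    moreover have "0 \<le> g \<tau>" using K1 \<mu> by (simp add: g_def)
    moreover have "u \<tau> \<le> u t1" using sol_mono(3)[OF s[OF \<tau>(3)], of t1 \<tau>] t1 by (auto simp: \<tau>_def)
    ultimately show "u t \<le> g t + e" using t1 by linarith
  qed
  define K' where "K' = max K1 (K1 / (\<mu> - 1))"
  have "vel w t \<le> K' * t powr - \<mu> \<and> u t \<le> K' * t powr - (\<mu> - 1)" if t: "T0 \<le> t" for t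
  proof
    have "vel w t \<le> K1 * t powr - \<mu>" by (rule v[OF t])
    also have "\<dots> \<le> K' * t powr - \<mu>" by (intro mult_right_mono) (auto simp: K'_def)
    finally show "vel w t \<le> K' * t powr - \<mu>" .
    have "u t \<le> K1 / (\<mu> - 1) * t powr - (\<mu> - 1)" using u[OF t] by (simp add: g_def)
    also have "\<dots> \<le> K' * t powr - (\<mu> - 1)" by (intro mult_right_mono) (auto simp: K'_def)
    finally show "u t \<le> K' * t powr - (\<mu> - 1)" .
  qed
  moreover have "0 \<le> K'" using K1 by (simp add: K'_def le_max_iff_disj)
  ultimately show ?thesis unfolding \<mu>_def by blast
qed

text \<open>A decreasing nonnegative \<open>poh\<close> drops by a bounded amount on \<open>[t, 2t]\<close>, so the mean value theorem bounds
  \<open>t ^ N * v powr q\<close> at some intermediate point.\<close>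

lemma first_decay:
  assumes s: "\<And>T. 0 < T \<Longrightarrow> sol T u w"
    and P: "\<And>t. 0 < t \<Longrightarrow> energy 1 l (u t) (vel w t) < eps0 \<Longrightarrow> 0 \<le> poh 1 l b0 u (vel w) w t"
  shows "\<exists>T0\<ge>1. \<exists>K\<ge>0. \<forall>t\<ge>T0. w t / t ^ (N - 1) \<le> K * t powr - (N * (q - 1) / q)"
proof -
  obtain T0 where T0: "1 \<le> T0" "energy 1 l (u T0) (vel w T0) < eps0" using global_energy_small[OF s] by blast
  have E: "energy 1 l (u t) (vel w t) < eps0" if "T0 \<le> t" for t
    using energy_antimono[OF sol_flow[OF s[of t]], of T0 t] that T0 by auto
  have vv: "0 < vel w t" "vel w t \<le> v0" "0 < u t" if "T0 \<le> t" for t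
  proof -
    have "0 < t" using that T0 by simp
    note g = global_deriv[OF s this]
    thus "0 < vel w t" "0 < u t" by auto
    show "vel w t \<le> v0" by (rule energy_le_imp_le_v0[OF less_imp_le[OF E[OF that]]]) (use g l_pos in auto)
  qed
  let ?P = "poh 1 l b0 u (vel w) w"
  define c where "c = (N / q - 1 - b0) / 2"
  have c: "0 < c" using b0 by (simp add: c_def)
  \<comment> \<open>The bound for \<open>t ^ N * vel w x powr q\<close> at the intermediate point
    \<open>x\<close>.\<close>
  define K0 where "K0 = ?P T0 / c"
  have K0: "0 \<le> K0" using P[of T0] T0 c by (auto simp: K0_def)
  define K where "K = 2 ^ (N - 1) * ((v0 powr (p - q) + 1) * K0 powr ((q - 1) / q))"
  have "w t / t ^ (N - 1) \<le> K * t powr - (N * (q - 1) / q)" if t: "T0 \<le> t" for t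
  proof -
    have t0: "0 < t" "t < 2 * t" "0 < 3 * t" using t T0 by auto
    note fl = sol_flow[OF s[OF t0(3)]]
    have D: "\<exists>d. (?P has_real_derivative d) (at x) \<and> d \<le> - (x ^ (N - 1) * ((b0 - N / r) * u x powr r + c * vel w x powr q))"
      if x: "t \<le> x" "x \<le> 2 * t" for x
      unfolding c_def by (rule DERIV_poh_le[OF fl]) (use x t t0 l_pos vv(2)[of x] in auto)
    then obtain P' where P': "\<And>x. t \<le> x \<Longrightarrow> x \<le> 2 * t \<Longrightarrow> (?P has_real_derivative P' x) (at x)"
      "\<And>x. t \<le> x \<Longrightarrow> x \<le> 2 * t \<Longrightarrow> P' x \<le> - (x ^ (N - 1) * ((b0 - N / r) * u x powr r + c * vel w x powr q))"
      by metis
    obtain x where x: "t < x" "x < 2 * t" "?P (2 * t) - ?P t = (2 * t - t) * P' x"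
      using MVT2[OF t0(2), of ?P P'] P'(1) by auto
    have x0: "0 < x" "T0 \<le> x" using x t t0 by auto
    have Pt: "?P t \<le> ?P T0"
    proof (cases "T0 = t")
      case False
      thus ?thesis using poh_decreasing[OF fl, of T0 t] t T0 t0 l_pos by auto
    qed auto
    have "0 \<le> ?P (2 * t)" using P[of "2 * t"] E[of "2 * t"] t t0 by auto
    hence 1: "t * (- P' x) \<le> ?P T0" using x Pt by simp
    have "x ^ (N - 1) * (c * vel w x powr q) \<le> x ^ (N - 1) * ((b0 - N / r) * u x powr r + c * vel w x powr q)"
      using x0 b0 by (intro mult_left_mono) auto
    also have "\<dots> \<le> - P' x" using P'(2)[of x] x by simp
    finally have "t * (x ^ (N - 1) * (c * vel w x powr q)) \<le> t * (- P' x)" using t0 by (intro mult_left_mono) auto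
    hence "t * (x ^ (N - 1) * (c * vel w x powr q)) \<le> ?P T0" using 1 by linarith
    moreover have "t * (t ^ (N - 1) * (c * vel w x powr q)) \<le> t * (x ^ (N - 1) * (c * vel w x powr q))"
      using x t0 c by (intro mult_left_mono mult_right_mono power_mono) auto
    moreover have "t * t ^ (N - 1) = t ^ N" using N_ge_2 by (cases N) auto
    ultimately have "t ^ N * (c * vel w x powr q) \<le> ?P T0" by (simp add: mult.assoc[symmetric])
    hence "vel w x powr q \<le> K0 / t ^ N" using c t0 by (simp add: K0_def field_simps)
    also have "\<dots> = K0 * t powr - real N" using t0 by (simp add: powr_minus powr_realpow divide_inverse)
    finally have "(vel w x powr q) powr ((q - 1) / q) \<le> (K0 * t powr - real N) powr ((q - 1) / q)"
      using q_gt_1 by (intro powr_mono2) auto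
    hence 2: "vel w x powr (q - 1) \<le> K0 powr ((q - 1) / q) * t powr - (N * (q - 1) / q)"
      using q_gt_1 K0 by (simp add: powr_powr powr_mult)
    have "vel w x powr (p - 1) = vel w x powr (p - q) * vel w x powr (q - 1)"
      by (simp add: powr_add[symmetric])
    also have "\<dots> \<le> v0 powr (p - q) * vel w x powr (q - 1)"
      using vv[OF x0(2)] q_less_p by (intro mult_right_mono powr_mono2) auto
    finally have "vel w x powr (p - 1) + vel w x powr (q - 1) \<le> (v0 powr (p - q) + 1) * vel w x powr (q - 1)"
      by (simp add: distrib_right)
    also have "\<dots> \<le> (v0 powr (p - q) + 1) * (K0 powr ((q - 1) / q) * t powr - (N * (q - 1) / q))"
      using 2 by (intro mult_left_mono) auto
    finally have 3: "vel w x powr (p - 1) + vel w x powr (q - 1) \<le> (v0 powr (p - q) + 1) * (K0 powr ((q - 1) / q) * t powr - (N * (q - 1) / q))" .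
    \<comment> \<open>The velocity is controlled at an unknown point \<open>x\<close> of
      \<open>{t..2 * t}\<close>. Monotonicity of \<open>w\<close> carries the bound back to
      \<open>t\<close>, and \<open>x < 2 * t\<close> costs the factor \<open>2 ^ (N - 1)\<close> in
      \<open>K\<close>.\<close>
    have "w t \<le> w x" using sol_mono(1)[OF s[OF t0(3)], of t x] x t0 by auto
    also have "\<dots> = x ^ (N - 1) * (vel w x powr (p - 1) + vel w x powr (q - 1))" by (rule global_deriv(5)[OF s x0(1)])
    also have "\<dots> \<le> (2 * t) ^ (N - 1) * ((v0 powr (p - q) + 1) * (K0 powr ((q - 1) / q) * t powr - (N * (q - 1) / q)))"
      using x x0 by (intro mult_mono 3 power_mono) auto
    also have "\<dots> = t ^ (N - 1) * (K * t powr - (N * (q - 1) / q))" by (simp add: K_def power_mult_distrib)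
    finally show ?thesis using t0 by (simp add: field_simps)
  qed
  moreover have "0 \<le> K" by (simp add: K_def)
  ultimately show ?thesis using T0 by blast
qed

text \<open>The rate from \<open>first_decay\<close> is borderline: with
  \<open>\<sigma> = N / q - 1\<close> the bound \<open>t powr - \<sigma>\<close> just misses
  integrability to the power q^* over the whole space. Inserted into the equation it gives
  \<open>w' = O(t powr (\<gamma> - 1))\<close> with \<open>\<gamma> < \<sigma>\<close>, because q^*
  < r; a second \<open>decay_step\<close> then improves all rates strictly.\<close>

lemma fast_decay:
  assumes s: "\<And>T. 0 < T \<Longrightarrow> sol T u w"
    and P: "\<And>t. 0 < t \<Longrightarrow> energy 1 l (u t) (vel w t) < eps0 \<Longrightarrow> 0 \<le> poh 1 l b0 u (vel w) w t"
  shows "\<exists>T0\<ge>1. \<exists>K\<ge>0. \<exists>\<beta>>N - N / q. \<exists>\<mu>>N / q. \<forall>t\<ge>T0.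
    w t / t ^ (N - 1) \<le> K * t powr - \<beta> \<and> vel w t \<le> K * t powr - \<mu> \<and> u t \<le> K * t powr - (\<mu> - 1)"
proof -
  obtain T0 K1 where T0: "1 \<le> T0" "0 \<le> K1" and h1: "\<And>t. T0 \<le> t \<Longrightarrow> w t / t ^ (N - 1) \<le> K1 * t powr - (N * (q - 1) / q)"
    using first_decay[OF s P] by blast
  define \<sigma> where "\<sigma> = N / q - 1"
  have \<sigma>: "0 < \<sigma>" "N / r < \<sigma>" using q_gt_1 q_less_p p_less_N r_super by (auto simp: \<sigma>_def field_simps)
  have Nq: "N * (q - 1) / q = N - N / q" using q_gt_1 by (simp add: field_simps)
  have "(q - 1) * 1 < (q - 1) * (N / q)"
    using q_gt_1 q_less_p p_less_N by (intro mult_strict_left_mono) (auto simp: field_simps)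
  hence q1: "q - 1 < N * (q - 1) / q" by (simp add: mult.commute)
  have qq: "N * (q - 1) / q / (q - 1) = N / q" using q_gt_1 by simp
  obtain K2 where K2: "0 \<le> K2" and u2: "\<And>t. T0 \<le> t \<Longrightarrow> u t \<le> K2 * t powr - \<sigma>"
    using decay_step[OF s T0 q1 h1] unfolding qq \<sigma>_def by blast
  \<comment> \<open>The natural exponent \<open>N - (r - 1) * \<sigma>\<close> lies below
    \<open>\<sigma>\<close> because \<open>N < r * \<sigma>\<close>. The maximum with
    \<open>\<sigma> / 2\<close> keeps \<open>\<gamma>\<close> positive, so that
    \<open>t powr (\<gamma> - 1)\<close> integrates to a growing power.\<close>
  define \<gamma> where "\<gamma> = max (N - (r - 1) * \<sigma>) (\<sigma> / 2)"
  have "N < r * \<sigma>" using \<sigma> r_s by (simp add: field_simps)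
  hence \<gamma>: "0 < \<gamma>" "\<gamma> < \<sigma>" "N - (r - 1) * \<sigma> \<le> \<gamma>" using \<sigma> by (auto simp: \<gamma>_def algebra_simps)
  \<comment> \<open>Since \<open>u t \<le> u 0\<close> and \<open>r < s\<close>, the power of order
    \<open>s - 1\<close> is at most \<open>u 0 powr (s - r)\<close> times the one of order
    \<open>r - 1\<close>.\<close>
  define K3 where "K3 = (1 + l * u 0 powr (s - r)) * K2 powr (r - 1)"
  have K3: "0 \<le> K3" using l_pos by (simp add: K3_def)
  have f3: "t ^ (N - 1) * nonlin l (u t) \<le> K3 * t powr (\<gamma> - 1)" if t: "T0 \<le> t" for t
  proof -
    have t0: "0 < t" "1 \<le> t" using t T0 by auto
    have ut: "0 < u t" "u t \<le> u 0" using global_deriv(3)[OF s t0(1)] sol_mono(3)[OF s[OF t0(1)], of 0 t] t0 by auto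
    have "u t powr (s - 1) = u t powr (s - r) * u t powr (r - 1)" by (simp add: powr_add[symmetric])
    also have "\<dots> \<le> u 0 powr (s - r) * u t powr (r - 1)"
      using ut r_s by (intro mult_right_mono powr_mono2) auto
    finally have "nonlin l (u t) \<le> u t powr (r - 1) + l * (u 0 powr (s - r) * u t powr (r - 1))"
      unfolding nonlin_def using l_pos by (intro add_mono mult_left_mono) auto
    also have "\<dots> = (1 + l * u 0 powr (s - r)) * u t powr (r - 1)" by (simp add: algebra_simps)
    also have "\<dots> \<le> (1 + l * u 0 powr (s - r)) * (K2 * t powr - \<sigma>) powr (r - 1)"
      using u2[OF t] ut r_s l_pos by (intro mult_left_mono powr_mono2) auto
    also have "\<dots> = K3 * t powr - ((r - 1) * \<sigma>)" using K2 by (simp add: K3_def powr_mult powr_powr mult.commute)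
    finally have "t ^ (N - 1) * nonlin l (u t) \<le> t ^ (N - 1) * (K3 * t powr - ((r - 1) * \<sigma>))"
      using t0 by (intro mult_left_mono) auto
    also have "\<dots> = K3 * (t powr real (N - 1) * t powr - ((r - 1) * \<sigma>))" using t0 by (simp add: powr_realpow)
    also have "\<dots> = K3 * t powr (real (N - 1) - (r - 1) * \<sigma>)" by (simp add: powr_add[symmetric])
    also have "\<dots> \<le> K3 * t powr (\<gamma> - 1)"
      using \<gamma> t0 K3 N_ge_2 by (intro mult_left_mono powr_mono) (auto simp: of_nat_diff)
    finally show ?thesis .
  qed
  define K4 where "K4 = w T0 + K3 / \<gamma>"
  have w0: "0 \<le> w T0" using sol_w_pos(2)[OF s, of T0 T0] T0 by auto
  have K4: "0 \<le> K4" using w0 K3 \<gamma> by (simp add: K4_def)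
  define \<beta> where "\<beta> = N - 1 - \<gamma>"
  have h4: "w t / t ^ (N - 1) \<le> K4 * t powr - \<beta>" if t: "T0 \<le> t" for t
  proof -
    have t0: "0 < t" "1 \<le> t" using t T0 by auto
    have "w t - w T0 \<le> K3 / \<gamma> * t powr \<gamma> - K3 / \<gamma> * T0 powr \<gamma>"
    proof (rule deriv_compare[OF _ _ _ t])
      fix x assume x: "x \<in> {T0..t}"
      hence x0: "0 < x" using T0 by auto
      show "(w has_real_derivative x ^ (N - 1) * nonlin l (u x)) (at x within {T0..t})"
        using global_deriv(2)[OF s x0] by (rule has_field_derivative_at_within)
      have "((\<lambda>x. K3 / \<gamma> * x powr \<gamma>) has_real_derivative K3 / \<gamma> * (\<gamma> * x powr (\<gamma> - 1))) (at x within {T0..t})"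
        by (intro DERIV_cmult has_field_derivative_at_within[OF has_real_derivative_powr] x0)
      thus "((\<lambda>x. K3 / \<gamma> * x powr \<gamma>) has_real_derivative K3 * x powr (\<gamma> - 1)) (at x within {T0..t})"
        using \<gamma> by simp
    qed (use f3 in auto)
    moreover have "0 \<le> K3 / \<gamma> * T0 powr \<gamma>" using K3 \<gamma> by simp
    moreover have "w T0 * 1 \<le> w T0 * t powr \<gamma>" using w0 t0 \<gamma> by (intro mult_left_mono ge_one_powr_ge_zero) auto
    ultimately have "w t \<le> K4 * t powr \<gamma>" by (simp add: K4_def distrib_right)
    hence "w t / t ^ (N - 1) \<le> K4 * t powr \<gamma> / t ^ (N - 1)" using t0 by (intro divide_right_mono) auto
    also have "\<dots> = K4 * (t powr \<gamma> / t powr real (N - 1))" using t0 by (simp add: powr_realpow)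
    also have "\<dots> = K4 * t powr - \<beta>" using N_ge_2 by (simp add: powr_diff[symmetric] \<beta>_def of_nat_diff algebra_simps)
    finally show ?thesis .
  qed
  have \<beta>: "N - N / q < \<beta>" using \<gamma> by (simp add: \<beta>_def \<sigma>_def)
  hence \<beta>q: "q - 1 < \<beta>" using q1 Nq by simp
  obtain K5 where K5: "0 \<le> K5" and d5: "\<And>t. T0 \<le> t \<Longrightarrow> vel w t \<le> K5 * t powr - (\<beta> / (q - 1)) \<and> u t \<le> K5 * t powr - (\<beta> / (q - 1) - 1)"
    using decay_step[OF s T0(1) K4 \<beta>q h4] by blast
  have \<mu>: "N / q < \<beta> / (q - 1)"
  proof -
    have "N / q * (q - 1) < \<beta>" using \<beta> Nq by (simp add: field_simps)
    thus ?thesis using q_gt_1 by (subst pos_less_divide_eq) auto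
  qed
  define K where "K = max K4 K5"
  have K: "K4 \<le> K" "K5 \<le> K" "0 \<le> K" using K4 by (auto simp: K_def)
  have "w t / t ^ (N - 1) \<le> K * t powr - \<beta> \<and> vel w t \<le> K * t powr - (\<beta> / (q - 1)) \<and> u t \<le> K * t powr - (\<beta> / (q - 1) - 1)"
    if t: "T0 \<le> t" for t
    using h4[OF t] d5[OF t] K by (meson mult_right_mono order_trans powr_ge_zero)
  thus ?thesis using T0(1) K(3) \<beta> \<mu> by blast
qed

text \<open>The interface to the weak formulation. The strict inequalities for
  \<open>\<beta>\<close> and \<open>\<mu>\<close> yield all integrability there; the one-sided
  derivative 0 at 0 makes the radial extension of \<open>u\<close> differentiable at the
  origin.\<close>

lemma radial_profile:
  assumes "0 < a1" "will_cross a1"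
  shows "\<exists>u v h. \<exists>C>0. \<exists>\<beta>>N - N / q. \<exists>\<mu>>N / q.
    continuous_on {0..} u \<and> continuous_on {0..} v \<and> v 0 = 0 \<and> (u has_real_derivative 0) (at_right 0) \<and>
    (\<forall>t\<ge>0. 0 < u t \<and> 0 \<le> v t \<and> h t = v t powr (p - 1) + v t powr (q - 1) \<and>
       h t \<le> C * (1 + t) powr - \<beta> \<and> v t \<le> C * (1 + t) powr - \<mu> \<and> u t \<le> C * (1 + t) powr - (\<mu> - 1)) \<and>
    (\<forall>t>0. (u has_real_derivative - v t) (at t) \<and>
       ((\<lambda>t. t ^ (N - 1) * h t) has_real_derivative t ^ (N - 1) * nonlin l (u t)) (at t))"
proof -
  obtain u w where s: "\<And>T. 0 < T \<Longrightarrow> sol T u w"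
    and P: "\<And>t. 0 < t \<Longrightarrow> energy 1 l (u t) (vel w t) < eps0 \<Longrightarrow> 0 \<le> poh 1 l b0 u (vel w) w t"
    using threshold[OF assms] by blast
  obtain T0 K \<beta> \<mu> where T0: "1 \<le> T0" "0 \<le> K" and \<beta>: "N - N / q < \<beta>" and \<mu>: "N / q < \<mu>"
    and d: "\<And>t. T0 \<le> t \<Longrightarrow> w t / t ^ (N - 1) \<le> K * t powr - \<beta>"
      "\<And>t. T0 \<le> t \<Longrightarrow> vel w t \<le> K * t powr - \<mu>" "\<And>t. T0 \<le> t \<Longrightarrow> u t \<le> K * t powr - (\<mu> - 1)"
    using fast_decay[OF s P] by blast
  define v where "v = vel w"
  define h where "h t = v t powr (p - 1) + v t powr (q - 1)" for t
  have fl: "flow 1 l T u v w" if "0 < T" for T unfolding v_def using sol_flow s that by blast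
  have ub: "0 < u t" "0 \<le> v t" if "0 \<le> t" for t
    using fl[of "t + 1"] that by (auto simp: flow_def)
  have cT: "continuous_on {0..T} u" "continuous_on {0..T} v" if "0 < T" for T
    using fl[OF that] by (auto simp: flow_def)
  have ext: "continuous_on {0..} g" if "\<And>T. 0 < T \<Longrightarrow> continuous_on {0..T} g" for g :: "real \<Rightarrow> real"
  proof (unfold continuous_on_eq_continuous_within, intro ballI)
    fix x :: real assume x: "x \<in> {0..}"
    have "continuous (at x within {0..x+1}) g"
      using that[of "x + 1"] x by (auto simp: continuous_on_eq_continuous_within)
    moreover have "at x within {0..} = at x within {0..x+1}"
      by (rule at_within_nhd[of _ "{..<x+1}"]) auto
    ultimately show "continuous (at x within {0..}) g" by simp
  qed
  have cuv: "continuous_on {0..} u" "continuous_on {0..} v" by (rule ext, rule cT, assumption)+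
  have ch: "continuous_on {0..T0} h"
    unfolding h_def[abs_def] using q_gt_1 q_less_p T0 ub
    by (intro continuous_on_add continuous_on_powr_pos cT) auto
  have hT: "h t = w t / t ^ (N - 1)" if "0 < t" for t
    using global_deriv(5)[OF s that] that by (simp add: h_def v_def)
  have q1: "1 < N / q" "0 < N - N / q"
    using q_gt_1 q_less_p p_less_N by (auto simp: field_simps)
  obtain C1 where C1: "0 < C1" "\<And>t. 0 \<le> t \<Longrightarrow> h t \<le> C1 * (1 + t) powr - \<beta>"
    using decay_from_1[of T0 h K \<beta>] ch T0 d(1) hT \<beta> q1 by auto
  obtain C2 where C2: "0 < C2" "\<And>t. 0 \<le> t \<Longrightarrow> v t \<le> C2 * (1 + t) powr - \<mu>"
    using decay_from_1[of T0 v K \<mu>] cT(2)[of T0] T0 d(2) \<mu> q1 by (auto simp: v_def)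
  obtain C3 where C3: "0 < C3" "\<And>t. 0 \<le> t \<Longrightarrow> u t \<le> C3 * (1 + t) powr - (\<mu> - 1)"
    using decay_from_1[of T0 u K "\<mu> - 1"] cT(1)[of T0] T0 d(3) \<mu> q1 by auto
  define C where "C = max C1 (max C2 C3)"
  have C: "0 < C" "C1 \<le> C" "C2 \<le> C" "C3 \<le> C" using C1(1) by (auto simp: C_def)
  have m: "K' * (1 + t) powr y \<le> C * (1 + t) powr y" if "K' \<le> C" for K' t y
    using that by (intro mult_right_mono) auto
  note D = order_trans[OF C1(2) m[OF C(2)]] order_trans[OF C2(2) m[OF C(3)]] order_trans[OF C3(2) m[OF C(4)]]
  have v0: "v 0 = 0" using fl[of 1] by (simp add: flow_def)
  have ur: "(u has_real_derivative 0) (at_right 0)"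
  proof -
    have "(u has_real_derivative - v 0) (at 0 within {0..1})"
      using s[of 1] unfolding sol_def radial_sol_def v_def vel_def by fastforce
    moreover have "at_right (0::real) = at 0 within {0..1}"
      by (rule at_within_nhd[of _ "{..<1}"]) auto
    ultimately show ?thesis using v0 by simp
  qed
  have dt: "(u has_real_derivative - v t) (at t)"
       "((\<lambda>t. t ^ (N - 1) * h t) has_real_derivative t ^ (N - 1) * nonlin l (u t)) (at t)" if t: "0 < t" for t
  proof -
    show "(u has_real_derivative - v t) (at t)" unfolding v_def by (rule global_deriv(1)[OF s t])
    have "(w has_real_derivative t ^ (N - 1) * nonlin l (u t)) (at t)" by (rule global_deriv(2)[OF s t])
    thus "((\<lambda>t. t ^ (N - 1) * h t) has_real_derivative t ^ (N - 1) * nonlin l (u t)) (at t)"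
      by (rule has_field_derivative_transform_within_open[of _ _ _ "{0<..}"]) (use t hT in auto)
  qed
  show ?thesis
    by (rule exI[of _ u], rule exI[of _ v], rule exI[of _ h], rule exI[of _ C], rule conjI[OF C(1)],
        rule exI[of _ \<beta>], rule conjI[OF \<beta>], rule exI[of _ \<mu>], intro conjI allI impI)
       (rule \<mu> cuv v0 ur ub D h_def dt; assumption)+
qed

end

section \<open>Existence of a crossing solution\<close>

context exponents begin

text \<open>\<open>m\<close> is the scale-invariant decay exponent of the \<open>p\<close>-Laplace
  equation with right-hand side \<open>u powr (r - 1)\<close>. The last two inequalities both
  restate r < p^*.\<close>

lemma sub_exponents:
  defines "m \<equiv> p / (r - p)"
  shows "0 < m" "N - m * r < 0" "N / p - 1 < m"
proof -
  have pos: "0 < p" "0 < r - p" "0 < r" using q_gt_1 q_less_p p_less_r by auto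
  show "0 < m" using pos by (simp add: m_def)
  have *: "N * (r - p) < p * r" using r_sub pos by (simp add: field_simps)
  show "N - m * r < 0" using * pos by (simp add: m_def field_simps)
  have "(N - p) * (r - p) < p * p" using * by (simp add: algebra_simps)
  hence "N - p < p * m" using pos by (simp add: m_def pos_less_divide_eq)
  thus "N / p - 1 < m" using pos by (simp add: field_simps)
qed

lemma powr_small:
  fixes a :: real
  assumes "a < 0" "0 < e" shows "eventually (\<lambda>T. T powr a < e) at_top"
  using order_tendstoD(2)[OF tendsto_neg_powr[OF assms(1) filterlim_ident] assms(2)] .

text \<open>\<open>\<delta>\<close> is twice the bound \<open>C * T powr - m\<close> that will hold
  for \<open>u T\<close>. For large \<open>T\<close> the signs in \<open>sub_exponents\<close> make
  \<open>T ^ N * \<delta> powr r\<close> negligible and put \<open>\<delta>\<close> below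
  \<open>c4 * T powr (1 - N / p)\<close>, the loss of \<open>u\<close> that will be forced after it
  reaches \<open>\<delta>\<close>.\<close>

lemma choose_T:
  assumes "0 < C" "0 < c0" "0 < c4" "0 < t0"
  defines "m \<equiv> p / (r - p)"
  shows "\<exists>T \<delta>. 2 * t0 \<le> T \<and> 0 < \<delta> \<and> \<delta> < 1/2 \<and> 2 * T ^ N * \<delta> powr r \<le> c0 / 8 \<and> \<delta> < c4 * T powr (1 - N / p) \<and> C * T powr - m < \<delta>"
proof -
  note m = sub_exponents[folded m_def]
  have "eventually (\<lambda>T. T powr - m < 1 / (4 * C)) at_top"
    using m assms by (intro powr_small) auto
  moreover have "eventually (\<lambda>T. T powr (N - m * r) < c0 / (16 * (2 * C) powr r)) at_top"
    using m assms by (intro powr_small) auto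
  moreover have "eventually (\<lambda>T. T powr (- m - (1 - N / p)) < c4 / (2 * C)) at_top"
    using m assms by (intro powr_small) auto
  moreover have "eventually (\<lambda>T. 2 * t0 \<le> T) at_top" by (rule eventually_ge_at_top)
  ultimately have "eventually (\<lambda>T. T powr - m < 1 / (4 * C) \<and> T powr (N - m * r) < c0 / (16 * (2 * C) powr r) \<and>
     T powr (- m - (1 - N / p)) < c4 / (2 * C) \<and> 2 * t0 \<le> T) at_top"
    by eventually_elim auto
  then obtain T where T: "T powr - m < 1 / (4 * C)" "T powr (N - m * r) < c0 / (16 * (2 * C) powr r)"
    "T powr (- m - (1 - N / p)) < c4 / (2 * C)" "2 * t0 \<le> T"
    using eventually_happens'[OF trivial_limit_at_top_linorder] by blast
  have T0: "0 < T" using T assms by simp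
  define \<delta> where "\<delta> = 2 * C * T powr - m"
  have "0 < \<delta>" "\<delta> < 1/2" "C * T powr - m < \<delta>" using T T0 assms by (auto simp: \<delta>_def field_simps)
  moreover have "T ^ N * \<delta> powr r = (2 * C) powr r * T powr (N - m * r)"
  proof -
    have "\<delta> powr r = (2 * C) powr r * T powr - (m * r)" using assms by (simp add: \<delta>_def powr_mult powr_powr)
    moreover have "T ^ N = T powr N" using T0 by (simp add: powr_realpow)
    ultimately show ?thesis by (simp add: powr_add[symmetric])
  qed
  hence "2 * T ^ N * \<delta> powr r \<le> c0 / 8" using T(2) assms(1) by (simp add: field_simps)
  moreover have "\<delta> < c4 * T powr (1 - N / p)"
  proof -
    have "\<delta> = (2 * C * T powr (- m - (1 - N / p))) * T powr (1 - N / p)" by (simp add: \<delta>_def powr_add[symmetric])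
    also have "\<dots> < c4 * T powr (1 - N / p)" using T T0 assms by (intro mult_strict_right_mono) (auto simp: field_simps)
    finally show ?thesis .
  qed
  ultimately show ?thesis using T by blast
qed

text \<open>Subcritical regime: with \<open>N / p - 1 < b < N / r\<close> the functional \<open>poh\<close> stays above a positive constant up to a
  large time \<open>T\<close> when \<open>k\<close> and \<open>l\<close> are small. Since \<open>u\<close> decays like \<open>T powr - (p / (r - p))\<close>, this lower bound is then
  carried by \<open>v\<close>, and the resulting slope is too large for \<open>u\<close> to stay positive up to \<open>2 * T\<close>.\<close>

lemma scaled_flow_crosses:
  "\<exists>e>0. \<forall>k l u v w. 0 \<le> k \<longrightarrow> k \<le> e \<longrightarrow> 0 \<le> l \<longrightarrow> l \<le> e \<longrightarrow> u 0 = 1 \<longrightarrow> \<not> (\<forall>T>0. flow k l T u v w)"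
proof -
  have pq: "1 < p" "1 < q" "0 < N" "p - 1 > 0" "1 < r" "1 < s" using q_gt_1 q_less_p N_ge_2 r_s by auto
  \<comment> \<open>A velocity bound: the energy is at most 2 when \<open>u 0 = 1\<close> and
    \<open>l \<le> 1\<close>, and \<open>(p - 1) / p * Vm powr p = 2\<close>. Consequently
    \<open>u\<close> stays above 1/2 up to the time \<open>t0\<close>.\<close>
  define Vm where "Vm = (2 * p / (p - 1)) powr (1 / p)"
  define t0 where "t0 = 1 / (2 * Vm)"
  \<comment> \<open>This position of \<open>b\<close> makes the \<open>r\<close>-term and the
    \<open>p\<close>-term in \<open>DERIV_poh\<close> gains. The constants \<open>c1\<close> and
    \<open>c2\<close> bound the losses from the \<open>s\<close>-term and the \<open>q\<close>-term,
    which carry the small factors \<open>l\<close> and \<open>k\<close>.\<close>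
  define b where "b = (N / p - 1 + N / r) / 2"
  define c1 where "c1 = b - N / s"
  define c2 where "c2 = (N / q - 1 - b) * Vm powr q"
  \<comment> \<open>The gain of \<open>poh\<close> on \<open>{0..t0}\<close> from the
    \<open>r\<close>-term, where \<open>u\<close> is at least 1/2.\<close>
  define c0 where "c0 = (N / r - b) * (1/2) powr r * (t0 ^ N / N)"
  \<comment> \<open>\<open>a\<close> and \<open>\<eta>\<close> are the exponents in
    \<open>v \<ge> const * t powr \<eta> * u powr (a + 1)\<close>, which follows from integrating
    the equation once; solving this differential inequality bounds \<open>u T\<close> by
    \<open>CU\<close> times a power of \<open>T\<close>.\<close>
  define a where "a = (r - p) / (p - 1)"
  define \<eta> where "\<eta> = 1 / (p - 1)"
  define c3 where "c3 = a * (1 / (2 * N)) powr \<eta> / (\<eta> + 1)"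
  define CU where "CU = (c3 / 2) powr (- 1 / a)"
  \<comment> \<open>Chosen so that \<open>c4 * T powr (1 - N / p)\<close> is a lower bound for the
    loss of \<open>u\<close> on \<open>{T1..2 * T1}\<close> for every \<open>T1\<close> in question
    up to \<open>T\<close>.\<close>
  define c4 where "c4 = (1 / 2 ^ N) powr \<eta> * (c0 / 4) powr (1 / p)"
  have Vm: "0 < Vm" "Vm powr p = 2 * p / (p - 1)" using pq by (auto simp: Vm_def powr_powr)
  have t0: "0 < t0" using Vm by (simp add: t0_def)
  have m: "x < (x + y) / 2" "(x + y) / 2 < y" if "x < y" for x y :: real using that by auto
  have b: "N / p - 1 < b" "b < N / r" using m[OF r_sub] by (auto simp: b_def)
  have bp: "0 < N / p - 1" using p_less_N pq by (simp add: field_simps)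
  have b': "N / s < b" "b < N / q - 1" "0 < b" using b bp s_super r_super by auto
  have c: "0 < c1" "0 < c2" "0 < c0" using b b' Vm t0 pq by (auto simp: c1_def c2_def c0_def)
  have a1: "0 < a" "0 < \<eta>" using pq p_less_r by (auto simp: a_def \<eta>_def)
  hence "0 < c3" using pq unfolding c3_def by (intro divide_pos_pos mult_pos_pos) auto
  moreover from this have "0 < CU" by (simp add: CU_def)
  moreover have "0 < c4" using c unfolding c4_def by simp
  ultimately have a: "0 < a" "0 < \<eta>" "0 < c3" "0 < CU" "0 < c4" using a1 by auto
  have "\<eta> + 1 = p / (p - 1)" using pq by (simp add: \<eta>_def field_simps)
  hence ea: "(\<eta> + 1) / a = p / (r - p)" using pq by (simp add: a_def)
  obtain T \<delta> where T: "2 * t0 \<le> T" "0 < \<delta>" "\<delta> < 1/2" "2 * T ^ N * \<delta> powr r \<le> c0 / 8"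
    "\<delta> < c4 * T powr (1 - N / p)" "CU * T powr - (p / (r - p)) < \<delta>"
    using choose_T[OF a(4) c(3) a(5) t0] by blast
  have T0: "0 < T" "t0 < T" using T t0 by auto
  \<comment> \<open>\<open>y0\<close> bounds \<open>t * u t powr (r - 1) / N\<close> from below
    while \<open>t \<ge> t0\<close> and \<open>u t \<ge> \<delta>\<close>; \<open>v1\<close> bounds
    \<open>V1 powr (p - 1)\<close> from below. Neither involves \<open>k\<close> or
    \<open>l\<close>, so \<open>e\<close> can be chosen after them.\<close>
  define y0 where "y0 = t0 * \<delta> powr (r - 1) / N"
  define v1 where "v1 = ((c0 / 4) powr (1 / p) * T powr - (N / p)) powr (p - 1)"
  have y0: "0 < y0" "0 < v1" using t0 T c T0 pq by (auto simp: y0_def v1_def)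
  \<comment> \<open>The entries after 1 keep, in turn, the losses of \<open>poh\<close> up to
    \<open>T\<close> below \<open>c0 / 2\<close>, the \<open>q\<close>-part of the flux below
    \<open>y0 / 2\<close>, the \<open>q\<close>-part of the energy times \<open>T ^ N\<close> below
    \<open>c0 / 8\<close>, and the \<open>q\<close>-part of the flux after \<open>T1\<close> below
    \<open>v1 / 2 ^ N\<close>.\<close>
  define e where "e = Min {1, c0 / 2 / ((c1 + c2) * T ^ N / N), y0 / 2 / Vm powr (q - 1), c0 / 8 / (Vm powr q * T ^ N), v1 / 2 ^ N / Vm powr (q - 1)}"
  have e: "0 < e" "e \<le> 1" "e \<le> c0 / 2 / ((c1 + c2) * T ^ N / N)" "e \<le> y0 / 2 / Vm powr (q - 1)"
    "e \<le> c0 / 8 / (Vm powr q * T ^ N)" "e \<le> v1 / 2 ^ N / Vm powr (q - 1)"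
    using c y0 Vm T0 pq by (auto simp: e_def)
  have False if k: "0 \<le> k" "k \<le> e" and l: "0 \<le> l" "l \<le> e" and u0: "u 0 = 1" and fl: "\<And>T. 0 < T \<Longrightarrow> flow k l T u v w" for k l u v w
  proof -
    have kk: "k * Vm powr (q - 1) \<le> y0 / 2" "k * (Vm powr q * T ^ N) \<le> c0 / 8" "k * Vm powr (q - 1) \<le> v1 / 2 ^ N" "k \<le> 1" "l \<le> 1"
      using order_trans[OF k(2) e(4)] order_trans[OF k(2) e(5)] order_trans[OF k(2) e(6)] k l e(2) Vm T0
      by (auto simp: pos_le_divide_eq mult_ac)
    have "l * c1 + k * c2 \<le> e * c1 + e * c2" using k l c by (intro add_mono mult_right_mono) auto
    also have "\<dots> = e * (c1 + c2)" by (simp add: algebra_simps)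
    finally have "(l * c1 + k * c2) * (T ^ N / N) \<le> e * (c1 + c2) * (T ^ N / N)"
      using T0 by (intro mult_right_mono) auto
    also have "\<dots> = e * ((c1 + c2) * T ^ N / N)" by simp
    also have "\<dots> \<le> c0 / 2" using e(3) c T0 pq by (subst (asm) pos_le_divide_eq) auto
    finally have kl: "(l * c1 + k * c2) * (T ^ N / N) \<le> c0 / 2" .
    have cont: "continuous_on {x..y} u" "continuous_on {x..y} v" "continuous_on {x..y} w" "continuous_on {x..y} (poh k l b u v w)"
      if "0 \<le> x" for x y
    proof -
      have f: "flow k l (max y 1) u v w" by (rule fl) auto
      have sub: "{x..y} \<subseteq> {0..max y 1}" using that by auto
      show "continuous_on {x..y} u" "continuous_on {x..y} v" "continuous_on {x..y} w" "continuous_on {x..y} (poh k l b u v w)"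
        using continuous_on_subset[OF _ sub] flow_energy_continuous[OF f] f by (auto simp: flow_def)
    qed
    have D: "0 < v t" "0 < u t" "(u has_real_derivative - v t) (at t)" "(w has_real_derivative t ^ (N - 1) * nonlin l (u t)) (at t)"
      "w t = t ^ (N - 1) * (v t powr (p - 1) + k * v t powr (q - 1))" if "0 < t" for t
      using flowD[OF fl that, of "t + 1"] that by auto
    have P': "(poh k l b u v w has_real_derivative
      t ^ (N - 1) * ((N / r - b) * u t powr r + l * (N / s - b) * u t powr s
       + (b - (N / p - 1)) * v t powr p + k * (b - (N / q - 1)) * v t powr q)) (at t)" if "0 < t" for t
      by (rule DERIV_poh[OF fl[of "t + 1"]]) (use that in auto)
    have v_le: "v t \<le> Vm" if "0 < t" for t
    proof (rule ccontr)
      assume "\<not> v t \<le> Vm"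
      hence "Vm powr p < v t powr p" using Vm pq by (intro powr_less_mono2) auto
      hence "(p - 1) / p * Vm powr p < (p - 1) / p * v t powr p" using pq by (intro mult_strict_left_mono) auto
      moreover have "(p - 1) / p * Vm powr p = 2" unfolding Vm(2) using pq by (simp add: field_simps)
      ultimately have "2 < (p - 1) / p * v t powr p" by simp
      also have "\<dots> \<le> energy k l (u t) (v t)" unfolding energy_def using k l pq by simp
      also have "\<dots> \<le> energy k l (u 0) (v 0)" using energy_antimono[OF fl[OF that] k(1), of 0 t] that by simp
      also have "\<dots> = 1 / r + l * 1 / s" using flow_0(3)[OF fl[OF that]] that u0 by simp
      also have "\<dots> \<le> 1 + 1" using pq kk l by (intro add_mono) (auto simp: field_simps)
      finally show False by simp
    qed
    have u_mono: "u y \<le> u x" if "0 \<le> x" "x \<le> y" for x y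
    proof -
      have "u y - u x \<le> 0 - 0"
      proof (rule deriv_compare_open[OF that(2) cont(1)[OF that(1)], of "\<lambda>_. 0" "\<lambda>_. 0"])
        fix t assume "x < t"
        hence "0 < t" using that by simp
        from D[OF this] show "\<exists>f'. (u has_real_derivative f') (at t) \<and> f' \<le> 0" by (intro exI conjI) auto
      qed (auto intro!: derivative_eq_intros)
      thus ?thesis by simp
    qed
    have u_lower: "u x - c * (y - x) \<le> u y" if "0 \<le> x" "x \<le> y" "\<And>t. x < t \<Longrightarrow> t < y \<Longrightarrow> v t \<le> c" for x y c
    proof -
      have "(\<lambda>t. (- c) * t) y - (\<lambda>t. (- c) * t) x \<le> u y - u x"
      proof (rule deriv_compare_open[OF that(2) _ cont(1)[OF that(1)], where g' = "\<lambda>t. - v t"])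
        fix t assume t: "x < t" "t < y"
        show "\<exists>f'. ((\<lambda>t. - c * t) has_real_derivative f') (at t) \<and> f' \<le> - v t"
          using that(3)[OF t] by (intro exI[of _ "- c"] conjI) (auto intro!: derivative_eq_intros)
        show "(u has_real_derivative - v t) (at t)" using D[of t] t that by auto
      qed (intro continuous_intros)
      thus ?thesis by (simp add: algebra_simps)
    qed
    have ut0: "1/2 \<le> u t" if "0 \<le> t" "t \<le> t0" for t
    proof -
      have "u 0 - Vm * (t - 0) \<le> u t" by (rule u_lower) (use that v_le in auto)
      moreover have "Vm * t \<le> Vm * t0" using that Vm by (intro mult_left_mono) auto
      moreover have "Vm * t0 = 1/2" using Vm by (simp add: t0_def)
      ultimately show ?thesis using u0 by simp
    qed
    have P'_ge: "\<exists>d. (poh k l b u v w has_real_derivative d) (at t) \<and>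
        t ^ (N - 1) * ((N / r - b) * u t powr r - (l * c1 + k * c2)) \<le> d" if "0 < t" for t
    proof (rule exI, rule conjI[OF P'[OF that]])
      have "u t \<le> 1" using u_mono[of 0 t] u0 that by simp
      hence "u t powr s \<le> 1 powr s" using D(2)[OF that] pq by (intro powr_mono2) auto
      hence "l * (c1 * u t powr s) \<le> l * (c1 * 1)" using l c by (intro mult_left_mono) auto
      hence e1: "l * (c1 * u t powr s) \<le> l * c1" by simp
      have "v t powr q \<le> Vm powr q" using v_le[OF that] D(1)[OF that] pq by (intro powr_mono2) auto
      hence e2: "k * ((N / q - 1 - b) * v t powr q) \<le> k * c2" unfolding c2_def using k b' by (intro mult_left_mono) auto
      have e3: "0 \<le> (b - (N / p - 1)) * v t powr p" using b by simp
      have e4: "l * (N / s - b) * u t powr s = - (l * (c1 * u t powr s))" unfolding c1_def by (simp add: algebra_simps)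
      have e5: "k * (b - (N / q - 1)) * v t powr q = - (k * ((N / q - 1 - b) * v t powr q))"
      proof -
        have "k * (b - x) * y = - (k * ((x - b) * y))" for x y by (simp add: algebra_simps)
        thus ?thesis .
      qed
      have "x - (L + K) \<le> x + A + B + C" if "A' \<le> L" "C' \<le> K" "0 \<le> B" "A = - A'" "C = - C'"
        for x L K A A' B C C' :: real using that by linarith
      from this[OF e1 e2 e3 e4 e5, of "(N / r - b) * u t powr r"] show "t ^ (N - 1) * ((N / r - b) * u t powr r - (l * c1 + k * c2)) \<le>
        t ^ (N - 1) * ((N / r - b) * u t powr r + l * (N / s - b) * u t powr s + (b - (N / p - 1)) * v t powr p + k * (b - (N / q - 1)) * v t powr q)"
        by (rule mult_left_mono) (use that in auto)
    qed
    have P_inc: "C * y ^ N / N - C * x ^ N / N \<le> poh k l b u v w y - poh k l b u v w x"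
      if "0 \<le> x" "x \<le> y" "\<And>t. x < t \<Longrightarrow> t < y \<Longrightarrow> C \<le> (N / r - b) * u t powr r - (l * c1 + k * c2)" for x y C
    proof -
      have "- poh k l b u v w y - - poh k l b u v w x \<le> (\<lambda>t. (-C) * t ^ N / N) y - (\<lambda>t. (-C) * t ^ N / N) x"
      proof (rule deriv_compare_open[OF that(2) _ _ _ DERIV_power_N])
        fix t assume t: "x < t" "t < y"
        hence t0: "0 < t" using that by simp
        obtain d where d: "(poh k l b u v w has_real_derivative d) (at t)"
          "t ^ (N - 1) * ((N / r - b) * u t powr r - (l * c1 + k * c2)) \<le> d" using P'_ge[OF t0] by blast
        have "t ^ (N - 1) * C \<le> t ^ (N - 1) * ((N / r - b) * u t powr r - (l * c1 + k * c2))"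
          using that(3)[OF t] t0 by (intro mult_left_mono) auto
        thus "\<exists>f'. ((\<lambda>t. - poh k l b u v w t) has_real_derivative f') (at t) \<and> f' \<le> t ^ (N - 1) * - C"
          using d by (intro exI[of _ "- d"] conjI DERIV_minus) auto
      qed (intro continuous_intros cont that | use pq in simp)+
      thus ?thesis by simp
    qed
    \<comment> \<open>Up to \<open>t0\<close> the gain is at least \<open>c0\<close>; later gains
      are dropped, and the losses over all of \<open>{0..T}\<close> amount to at most
      \<open>c0 / 2\<close>.\<close>
    have P_ge: "c0 / 2 \<le> poh k l b u v w t" if t: "t0 \<le> t" "t \<le> T" for t
    proof -
      define X where "X = l * c1 + k * c2"
      let ?y = "(N / r - b) * (1/2) powr r"
      have x0: "0 \<le> X" unfolding X_def using l k c by simp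
      have "(?y - X) * t0 ^ N / N - (?y - X) * 0 ^ N / N \<le> poh k l b u v w t0 - poh k l b u v w 0"
      proof (rule P_inc[folded X_def])
        fix \<tau> assume "0 < \<tau>" "\<tau> < t0"
        hence "(1/2) powr r \<le> u \<tau> powr r" using ut0[of \<tau>] pq by (intro powr_mono2) auto
        thus "?y - X \<le> (N / r - b) * u \<tau> powr r - X" using b by (intro diff_right_mono mult_left_mono) auto
      qed (use t0 in auto)
      moreover have "poh k l b u v w 0 = 0" using flow_0(2)[OF fl[of 1]] by simp
      moreover have "(- X) * t ^ N / N - (- X) * t0 ^ N / N \<le> poh k l b u v w t - poh k l b u v w t0"
        by (rule P_inc[folded X_def]) (use t0 t b in auto)
      moreover have "(?y - X) * t0 ^ N / N = c0 - X * t0 ^ N / N" by (simp add: c0_def diff_divide_distrib left_diff_distrib)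
      moreover have "(0::real) ^ N = 0" using pq by simp
      ultimately have "c0 - X * (t ^ N / N) \<le> poh k l b u v w t" by simp
      moreover have "X * (t ^ N / N) \<le> X * (T ^ N / N)" using t t0 x0 by (intro mult_left_mono divide_right_mono power_mono) auto
      ultimately show ?thesis using kl[folded X_def] by linarith
    qed
    have h_ge: "t * u t powr (r - 1) / N \<le> v t powr (p - 1) + k * v t powr (q - 1)" if t: "0 < t" for t
    proof -
      have "- w t - - w 0 \<le> (\<lambda>\<tau>. (- (u t powr (r - 1))) * \<tau> ^ N / N) t - (\<lambda>\<tau>. (- (u t powr (r - 1))) * \<tau> ^ N / N) 0"
      proof (rule deriv_compare_open[OF _ _ _ _ DERIV_power_N])
        fix \<tau> assume \<tau>: "0 < \<tau>" "\<tau> < t"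
        have "u t powr (r - 1) \<le> u \<tau> powr (r - 1)" using u_mono[of \<tau> t] \<tau> D(2)[OF t] pq by (intro powr_mono2) auto
        hence "u t powr (r - 1) \<le> nonlin l (u \<tau>)" unfolding nonlin_def using l by (simp add: add_increasing2)
        hence "\<tau> ^ (N - 1) * u t powr (r - 1) \<le> \<tau> ^ (N - 1) * nonlin l (u \<tau>)" using \<tau> by (intro mult_left_mono) auto
        thus "\<exists>f'. ((\<lambda>t. - w t) has_real_derivative f') (at \<tau>) \<and> f' \<le> \<tau> ^ (N - 1) * - (u t powr (r - 1))"
          by (intro exI[of _ "- (\<tau> ^ (N - 1) * nonlin l (u \<tau>))"] conjI[OF DERIV_minus[OF D(4)[OF \<tau>(1)]]]) simp
      qed (intro continuous_intros cont | use pq t in simp)+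
      moreover have "w 0 = 0" using flow_0(1)[OF fl[of 1]] by simp
      ultimately have "u t powr (r - 1) * t ^ N / N \<le> w t" using pq by (simp add: power_0_left)
      hence "u t powr (r - 1) * t ^ N / N / t ^ (N - 1) \<le> w t / t ^ (N - 1)" using t by (intro divide_right_mono) auto
      thus ?thesis unfolding weight_quot[OF t] using D(5)[OF t] t by (simp add: mult.commute)
    qed
    have kv: "k * v t powr (q - 1) \<le> k * Vm powr (q - 1)" if "0 < t" for t
      using v_le[OF that] D(1)[OF that] pq k by (intro mult_left_mono powr_mono2) auto
    \<comment> \<open>While \<open>u\<close> is at least \<open>\<delta>\<close>, half of the bound
      \<open>h_ge\<close> is left for the \<open>p\<close>-part of the flux. The resulting
      differential inequality makes \<open>u powr - a\<close> grow like
      \<open>t powr (\<eta> + 1)\<close>, so that \<open>u T\<close> falls below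
      \<open>\<delta>\<close>.\<close>
    have "\<not> (\<forall>t\<in>{t0..T}. \<delta> \<le> u t)"
    proof
      assume A: "\<forall>t\<in>{t0..T}. \<delta> \<le> u t"
      have v_ge: "(1 / (2 * N)) powr \<eta> * t powr \<eta> * u t powr (a + 1) \<le> v t" if t: "t0 \<le> t" "t \<le> T" for t
      proof -
        have tp: "0 < t" using t t0 by simp
        have "y0 \<le> t * u t powr (r - 1) / N"
          unfolding y0_def using A t T pq t0 by (intro divide_right_mono mult_mono powr_mono2) auto
        moreover have "y / 2 \<le> A" if "y0 \<le> y" "y \<le> A + B" "B \<le> C" "C \<le> y0 / 2" for y A B C
          using that by linarith
        ultimately have "t * u t powr (r - 1) / N / 2 \<le> v t powr (p - 1)"
          using h_ge[OF tp] kv[OF tp] kk(1) by blast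
        hence "(t * u t powr (r - 1) / N / 2) powr \<eta> \<le> (v t powr (p - 1)) powr \<eta>"
          using tp a by (intro powr_mono2) auto
        also have "\<dots> = v t" using D(1)[OF tp] pq by (simp add: powr_powr \<eta>_def)
        also have "(t * u t powr (r - 1) / N / 2) powr \<eta> = ((1 / (2 * N)) * (t * u t powr (r - 1))) powr \<eta>" by (simp add: field_simps)
        also have "\<dots> = (1 / (2 * N)) powr \<eta> * (t powr \<eta> * (u t powr (r - 1)) powr \<eta>)" by (simp only: powr_mult)
        also have "(u t powr (r - 1)) powr \<eta> = u t powr (a + 1)"
          using pq by (simp add: powr_powr \<eta>_def a_def field_simps)
        finally show ?thesis by (simp add: mult.assoc)
      qed
      have "c3 * T powr (\<eta> + 1) - c3 * t0 powr (\<eta> + 1) \<le> u T powr - a - u t0 powr - a"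
      proof (rule deriv_compare_open[where g' = "\<lambda>t. a * u t powr (- a - 1) * v t"])
        fix t assume t: "t0 < t" "t < T"
        hence tp: "0 < t" using t0 by simp
        have "u t powr (- a - 1) * u t powr (a + 1) = 1" using D(2)[OF tp] by (simp add: powr_add[symmetric])
        hence "a * ((1 / (2 * N)) powr \<eta> * t powr \<eta>) = a * u t powr (- a - 1) * ((1 / (2 * N)) powr \<eta> * t powr \<eta> * u t powr (a + 1))"
          by (simp add: mult_ac)
        also have "\<dots> \<le> a * u t powr (- a - 1) * v t" using v_ge[of t] t a by (intro mult_left_mono) auto
        finally have 1: "c3 * ((\<eta> + 1) * t powr (\<eta> + 1 - 1)) \<le> a * u t powr (- a - 1) * v t" using a by (simp add: c3_def mult.assoc)
        show "\<exists>f'. ((\<lambda>t. c3 * t powr (\<eta> + 1)) has_real_derivative f') (at t) \<and> f' \<le> a * u t powr (- a - 1) * v t"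
          by (rule exI, rule conjI[OF DERIV_cmult[OF has_real_derivative_powr[OF tp]] 1])
        have "((\<lambda>t. u t powr - a) has_real_derivative (- a * u t powr (- a - 1)) * - v t) (at t)"
          by (rule DERIV_chain2[OF has_real_derivative_powr[OF D(2)[OF tp]] D(3)[OF tp]])
        thus "((\<lambda>t. u t powr - a) has_real_derivative a * u t powr (- a - 1) * v t) (at t)" by simp
      next
        show "continuous_on {t0..T} (\<lambda>t. c3 * t powr (\<eta> + 1))" using t0 by (intro continuous_intros) auto
        have "u t \<noteq> 0" if "t \<in> {t0..T}" for t using D(2)[of t] that t0 by auto
        thus "continuous_on {t0..T} (\<lambda>t. u t powr - a)" using t0 by (intro continuous_intros cont) auto
      qed (use T0 in auto)
      moreover have "t0 powr (\<eta> + 1) \<le> T powr (\<eta> + 1) / 2"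
      proof -
        have "t0 powr (\<eta> + 1) \<le> (T / 2) powr (\<eta> + 1)" using T t0 a by (intro powr_mono2) auto
        also have "\<dots> = T powr (\<eta> + 1) / (2 powr \<eta> * 2)" using T0 by (simp add: powr_divide powr_add)
        also have "\<dots> \<le> T powr (\<eta> + 1) / (1 * 2)" using a by (intro divide_left_mono mult_mono ge_one_powr_ge_zero) auto
        finally show ?thesis by simp
      qed
      hence "c3 * t0 powr (\<eta> + 1) \<le> c3 * (T powr (\<eta> + 1) / 2)" using a by (intro mult_left_mono) auto
      moreover have "0 \<le> u t0 powr - a" by simp
      moreover have "c3 / 2 * T powr (\<eta> + 1) = c3 * (T powr (\<eta> + 1) / 2)" by simp
      ultimately have "c3 / 2 * T powr (\<eta> + 1) \<le> u T powr - a" by linarith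
      hence "(u T powr - a) powr (- 1 / a) \<le> (c3 / 2 * T powr (\<eta> + 1)) powr (- 1 / a)"
        using a T0 by (intro powr_mono2') auto
      also have "\<dots> = CU * T powr - (p / (r - p))"
        unfolding ea[symmetric] powr_mult powr_powr CU_def by simp
      also have "(u T powr - a) powr (- 1 / a) = u T" using a D(2)[of T] T0 by (simp add: powr_powr)
      finally have "u T < \<delta>" using T(6) by linarith
      moreover have "\<delta> \<le> u T" using A T0 by simp
      ultimately show False by simp
    qed
    then obtain t' where t': "t0 \<le> t'" "t' \<le> T" "u t' < \<delta>" by auto
    hence uT: "u T < \<delta>" using u_mono[of t' T] t0 by simp
    have "\<exists>T1\<ge>t0. T1 \<le> T \<and> u T1 = \<delta>"
      using IVT2'[of u T \<delta> t0] uT ut0[of t0] T t0 T0 cont(1)[of t0 T] by auto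
    \<comment> \<open>When \<open>u = \<delta>\<close>, the potential part of the energy is
      negligible by the choice of \<open>\<delta>\<close>, so the lower bound for \<open>poh\<close>
      has to be carried by the velocity \<open>V1\<close>.\<close>
    then obtain T1 where T1: "t0 \<le> T1" "T1 \<le> T" "u T1 = \<delta>" by blast
    have T1p: "0 < T1" using T1 t0 by simp
    define V1 where "V1 = v T1"
    have V1: "0 < V1" using D(1)[OF T1p] by (simp add: V1_def)
    have "c0 / 2 \<le> T1 ^ N * energy k l (u T1) (v T1) - b * w T1 * u T1"
      using P_ge[OF T1(1,2)] by (simp add: poh_def)
    moreover have "0 \<le> b * w T1 * u T1" using b' D[OF T1p] T1p k by simp
    ultimately have "c0 / 2 \<le> T1 ^ N * energy k l \<delta> V1" using T1 by (simp add: V1_def)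
    also have "energy k l \<delta> V1 \<le> V1 powr p + k * Vm powr q + 2 * \<delta> powr r"
    proof -
      have 1: "(p - 1) / p * V1 powr p \<le> 1 * V1 powr p" using pq by (intro mult_right_mono) auto
      have "(q - 1) / q * V1 powr q \<le> 1 * Vm powr q"
        using pq v_le[OF T1p] V1 unfolding V1_def by (intro mult_mono powr_mono2) auto
      hence 2: "k * ((q - 1) / q * V1 powr q) \<le> k * Vm powr q" using k by (intro mult_left_mono) auto
      have dl: "x / y \<le> x" if "0 \<le> x" "1 < y" for x y :: real
        using that mult_left_mono[of 1 y x] by (simp add: pos_divide_le_eq)
      have "\<delta> powr r / r \<le> \<delta> powr r" using pq by (intro dl) auto
      moreover have "l * \<delta> powr s / s \<le> \<delta> powr r"
      proof -
        have "l * \<delta> powr s / s \<le> l * \<delta> powr s" using pq l by (intro dl) auto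
        also have "\<dots> \<le> 1 * \<delta> powr r" using T r_s kk l by (intro mult_mono powr_mono') auto
        finally show ?thesis by simp
      qed
      ultimately show ?thesis using 1 2 unfolding energy_def by (simp add: mult.assoc)
    qed
    finally have "c0 / 2 \<le> T1 ^ N * (V1 powr p + k * Vm powr q + 2 * \<delta> powr r)" using T1p by simp
    also have "\<dots> = T1 ^ N * V1 powr p + T1 ^ N * (k * Vm powr q + 2 * \<delta> powr r)" by (simp add: algebra_simps)
    also have "T1 ^ N * (k * Vm powr q + 2 * \<delta> powr r) \<le> T ^ N * (k * Vm powr q + 2 * \<delta> powr r)"
      using T1 T1p k by (intro mult_right_mono power_mono) auto
    also have "\<dots> = k * (Vm powr q * T ^ N) + 2 * T ^ N * \<delta> powr r" by (simp add: algebra_simps)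
    finally have "c0 / 4 \<le> T1 ^ N * V1 powr p" using kk(2) T(4) by linarith
    hence "c0 / 4 \<le> T1 powr N * V1 powr p" using T1p by (simp add: powr_realpow)
    hence "(c0 / 4) powr (1 / p) \<le> (T1 powr N * V1 powr p) powr (1 / p)" using c pq by (intro powr_mono2) auto
    also have "\<dots> = T1 powr (N / p) * V1" using pq V1 by (simp add: powr_mult powr_powr)
    finally have V1_ge: "(c0 / 4) powr (1 / p) * T1 powr - (N / p) \<le> V1" using T1p by (simp add: powr_minus field_simps)
    have "T powr - (N / p) \<le> T1 powr - (N / p)" using T1 T1p pq by (intro powr_mono2') auto
    hence "(c0 / 4) powr (1 / p) * T powr - (N / p) \<le> V1"
      using V1_ge c by (meson mult_left_mono order_trans powr_ge_zero)
    hence v1: "v1 \<le> V1 powr (p - 1)" unfolding v1_def using pq by (intro powr_mono2) auto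
    \<comment> \<open>Monotonicity of \<open>w\<close> preserves the velocity up to a constant on
      the doubled interval: the weight costs \<open>2 ^ (N - 1)\<close>, and the spare factor 2 in
      \<open>2 ^ N\<close> absorbs the \<open>q\<close>-part.\<close>
    have v_ge: "(1 / 2 ^ N) powr \<eta> * V1 \<le> v t" if t: "T1 < t" "t < 2 * T1" for t
    proof -
      have tp: "0 < t" using t T1p by simp
      have "- w t - - w T1 \<le> (\<lambda>_. 0) t - (\<lambda>_. 0) T1"
      proof (rule deriv_compare_open[where f = "\<lambda>t. - w t" and g = "\<lambda>_. 0" and g' = "\<lambda>_. 0"])
        fix \<tau> assume "T1 < \<tau>" "\<tau> < t"
        hence \<tau>: "0 < \<tau>" using T1p by simp
        have "0 \<le> \<tau> ^ (N - 1) * nonlin l (u \<tau>)" using \<tau> D(2)[OF \<tau>] l by (simp add: nonlin_def)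
        thus "\<exists>f'. ((\<lambda>t. - w t) has_real_derivative f') (at \<tau>) \<and> f' \<le> 0"
          by (intro exI[of _ "- (\<tau> ^ (N - 1) * nonlin l (u \<tau>))"] conjI[OF DERIV_minus[OF D(4)[OF \<tau>]]]) simp
      qed (use t T1p in \<open>auto intro!: continuous_intros cont derivative_eq_intros\<close>)
      hence wm: "w T1 \<le> w t" by simp
      have "T1 ^ (N - 1) * V1 powr (p - 1) \<le> w T1"
        unfolding D(5)[OF T1p] V1_def using k T1p by (intro mult_left_mono) auto
      also have "\<dots> \<le> t ^ (N - 1) * (v t powr (p - 1) + k * v t powr (q - 1))" using wm D(5)[OF tp] by simp
      also have "\<dots> \<le> (2 * T1) ^ (N - 1) * (v t powr (p - 1) + k * v t powr (q - 1))"
        using t tp k by (intro mult_right_mono power_mono) auto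
      also have "\<dots> = T1 ^ (N - 1) * (2 ^ (N - 1) * (v t powr (p - 1) + k * v t powr (q - 1)))" by (simp add: power_mult_distrib)
      finally have "V1 powr (p - 1) \<le> 2 ^ (N - 1) * (v t powr (p - 1) + k * v t powr (q - 1))" using T1p by simp
      moreover have "2 ^ N = 2 * (2::real) ^ (N - 1)" using pq by (cases N) auto
      ultimately have "2 * V1 powr (p - 1) \<le> 2 ^ N * (v t powr (p - 1) + k * v t powr (q - 1))" by simp
      hence "2 * (V1 powr (p - 1) / 2 ^ N) \<le> v t powr (p - 1) + k * v t powr (q - 1)" by (simp add: field_simps)
      moreover have "k * v t powr (q - 1) \<le> V1 powr (p - 1) / 2 ^ N"
        using kv[OF tp] kk(3) divide_right_mono[OF v1, of "2 ^ N"] by simp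
      ultimately have "V1 powr (p - 1) / 2 ^ N \<le> v t powr (p - 1)" by linarith
      hence "(V1 powr (p - 1) / 2 ^ N) powr \<eta> \<le> (v t powr (p - 1)) powr \<eta>" using a by (intro powr_mono2) auto
      moreover have "(V1 powr (p - 1) / 2 ^ N) powr \<eta> = (1 / 2 ^ N) powr \<eta> * V1"
        using V1 pq by (simp add: powr_divide powr_powr \<eta>_def)
      moreover have "(v t powr (p - 1)) powr \<eta> = v t" using D(1)[OF tp] pq by (simp add: powr_powr \<eta>_def)
      ultimately show ?thesis by simp
    qed
    have "u (2 * T1) - u T1 \<le> (\<lambda>t. (- ((1 / 2 ^ N) powr \<eta> * V1)) * t) (2 * T1) - (\<lambda>t. (- ((1 / 2 ^ N) powr \<eta> * V1)) * t) T1"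
    proof (rule deriv_compare_open[where f = u and g = "\<lambda>t. (- ((1 / 2 ^ N) powr \<eta> * V1)) * t" and g' = "\<lambda>_. - ((1 / 2 ^ N) powr \<eta> * V1)"])
      fix t assume t: "T1 < t" "t < 2 * T1"
      show "\<exists>f'. (u has_real_derivative f') (at t) \<and> f' \<le> - ((1 / 2 ^ N) powr \<eta> * V1)"
        using v_ge[OF t] D(3)[of t] t T1p by (intro exI[of _ "- v t"] conjI) auto
      show "((\<lambda>t. (- ((1 / 2 ^ N) powr \<eta> * V1)) * t) has_real_derivative - ((1 / 2 ^ N) powr \<eta> * V1)) (at t)"
        by (auto intro!: derivative_eq_intros)
    qed (use T1p in \<open>auto intro!: continuous_intros cont\<close>)
    hence "(1 / 2 ^ N) powr \<eta> * V1 * T1 \<le> \<delta> - u (2 * T1)" using T1 by (simp add: algebra_simps)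
    hence 1: "(1 / 2 ^ N) powr \<eta> * V1 * T1 < \<delta>" using D(2)[of "2 * T1"] T1p by simp
    have "c4 * T powr (1 - N / p) \<le> c4 * T1 powr (1 - N / p)"
      using T1 T1p a bp by (intro mult_left_mono powr_mono2') auto
    also have "\<dots> = (1 / 2 ^ N) powr \<eta> * ((c0 / 4) powr (1 / p) * T1 powr - (N / p)) * T1"
      using T1p by (simp add: c4_def powr_diff powr_minus field_simps)
    also have "\<dots> \<le> (1 / 2 ^ N) powr \<eta> * V1 * T1"
      using V1_ge T1p by (intro mult_right_mono mult_left_mono) auto
    finally show False using 1 T(5) by linarith
  qed
  thus ?thesis using e(1) by blast
qed

text \<open>The rescaling \<open>u t = a * U (t / \<rho>)\<close> with \<open>\<rho> powr p = a powr (p - r)\<close> turns the equation into the one with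
  coefficients \<open>k\<close> of the \<open>q\<close>-term and \<open>l * a powr (s - r)\<close>, where \<open>k\<close> tends to \<open>0\<close> as \<open>a\<close> grows.\<close>

lemma exists_crossing:
  "\<exists>a>0. \<exists>l0>0. \<forall>l. 0 < l \<and> l < l0 \<longrightarrow> radial_ode.will_cross p q N (nonlin l) a"
proof -
  obtain e where e: "0 < e"
    and cross: "\<And>k l u v w. 0 \<le> k \<Longrightarrow> k \<le> e \<Longrightarrow> 0 \<le> l \<Longrightarrow> l \<le> e \<Longrightarrow> u 0 = 1 \<Longrightarrow> \<not> (\<forall>T>0. flow k l T u v w)"
    using scaled_flow_crosses by blast
  have pq: "0 < p" "0 < r" using q_gt_1 q_less_p r_s by auto
  have "r / p * (q - p) < 0" using pq q_less_p by (intro mult_pos_neg) auto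
  from powr_small[OF this e] have "eventually (\<lambda>a. 0 < a \<and> a powr (r / p * (q - p)) < e) at_top"
    by (intro eventually_conj eventually_gt_at_top)
  then obtain a :: real where a: "0 < a" "a powr (r / p * (q - p)) < e"
    using eventually_happens'[OF trivial_limit_at_top_linorder] by blast
  \<comment> \<open>\<open>a\<close> was fixed through the coefficient \<open>k\<close> alone;
    \<open>l0\<close> then makes \<open>l * a powr (s - r)\<close> at most \<open>e\<close>.\<close>
  define l0 where "l0 = e * a powr (r - s)"
  have "radial_ode.will_cross p q N (nonlin l) a" if l: "0 < l" "l < l0" for l
  proof (rule ccontr)
    interpret problem p q N r s l by unfold_locales (rule l)
    assume "\<not> will_cross a"
    then obtain u w where u0: "u 0 = a" and s: "\<And>T. 0 < T \<Longrightarrow> sol T u w"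
      using not_cross_imp_global_sol a by blast
    define \<rho> where "\<rho> = a powr (- (r - p) / p)"
    \<comment> \<open>The factor by which the rescaling multiplies velocities. Expressed in the new
      velocity \<open>V\<close>, the flux times \<open>m powr (p - 1)\<close> has the coefficient
      \<open>m powr (p - q)\<close> in its \<open>q\<close>-term, which is the \<open>k\<close>
      below.\<close>
    define m where "m = \<rho> / a"
    have \<rho>: "0 < \<rho>" "\<rho> powr p = a powr (p - r)" using a pq by (auto simp: \<rho>_def powr_powr)
    have m: "0 < m" using \<rho> a by (simp add: m_def)
    have m_eq: "m = a powr (- r / p)"
    proof -
      have "m = a powr (- (r - p) / p) / a powr 1" using a by (simp add: m_def \<rho>_def)
      also have "\<dots> = a powr (- (r - p) / p - 1)" by (simp add: powr_diff)
      also have "- (r - p) / p - 1 = - r / p" using pq by (simp add: field_simps)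
      finally show ?thesis .
    qed
    define k where "k = m powr (p - q)"
    have k: "0 \<le> k" "k \<le> e"
    proof -
      have "k = a powr (- r / p * (p - q))" by (simp add: k_def m_eq powr_powr)
      also have "- r / p * (p - q) = r / p * (q - p)" using pq by (simp add: field_simps)
      finally show "0 \<le> k" "k \<le> e" using a by auto
    qed
    define l' where "l' = l * a powr (s - r)"
    have l': "0 \<le> l'" "l' \<le> e"
    proof -
      have "l' \<le> l0 * a powr (s - r)" unfolding l'_def using l by (intro mult_right_mono) auto
      also have "\<dots> = e * (a powr (r - s) * a powr (s - r))" by (simp add: l0_def)
      also have "\<dots> = e" using a by (simp add: powr_add[symmetric])
      finally show "0 \<le> l'" "l' \<le> e" using l by (auto simp: l'_def)
    qed
    define U where "U t = u (\<rho> * t) / a" for t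
    define V where "V t = m * vel w (\<rho> * t)" for t
    define W where "W t = m powr (p - 1) / \<rho> ^ (N - 1) * w (\<rho> * t)" for t
    have "flow k l' T U V W" if T: "0 < T" for T
    proof -
      have fl: "flow 1 l (\<rho> * T) u (vel w) w" using s \<rho> T by (intro sol_flow) auto
      have sc: "\<rho> * t \<in> {0..\<rho> * T}" if "t \<in> {0..T}" for t using that \<rho> by auto
      have c: "continuous_on {0..\<rho> * T} u" "continuous_on {0..\<rho> * T} (vel w)" "vel w 0 = 0"
        and pw: "\<And>t. t \<in> {0..\<rho> * T} \<Longrightarrow> 0 < u t \<and> 0 \<le> vel w t \<and> w t = t ^ (N - 1) * (vel w t powr (p - 1) + 1 * vel w t powr (q - 1))"
        using fl by (auto simp: flow_def)
      have "continuous_on {0..T} U" unfolding U_def[abs_def]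
        using a by (intro continuous_intros continuous_on_compose2[OF c(1)]) (use sc in auto)
      moreover have "continuous_on {0..T} V" unfolding V_def[abs_def]
        by (intro continuous_intros continuous_on_compose2[OF c(2)]) (use sc in auto)
      moreover have "V 0 = 0" by (simp add: V_def c)
      moreover have "0 < U t \<and> 0 \<le> V t \<and> W t = t ^ (N - 1) * (V t powr (p - 1) + k * V t powr (q - 1))" if t: "t \<in> {0..T}" for t
      proof -
        note f = pw[OF sc[OF t]]
        let ?v = "vel w (\<rho> * t)"
        have "k * V t powr (q - 1) = m powr (p - q) * m powr (q - 1) * ?v powr (q - 1)"
          using m f by (simp add: k_def V_def powr_mult)
        also have "m powr (p - q) * m powr (q - 1) = m powr (p - 1)" by (simp add: powr_add[symmetric])
        finally have "t ^ (N - 1) * (V t powr (p - 1) + k * V t powr (q - 1)) = t ^ (N - 1) * (m powr (p - 1) * (?v powr (p - 1) + ?v powr (q - 1)))"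
          using m f by (simp add: V_def powr_mult distrib_left)
        also have "\<dots> = W t" using \<rho> f by (simp add: W_def power_mult_distrib)
        finally show ?thesis using f m a by (auto simp: U_def V_def)
      qed
      moreover have "0 < V t \<and> (U has_real_derivative - V t) (at t) \<and> (\<exists>d. (V has_real_derivative d) (at t)) \<and>
        (W has_real_derivative t ^ (N - 1) * nonlin l' (U t)) (at t)" if t: "t \<in> {0<..<T}" for t
      proof -
        have tp: "0 < t" "0 < \<rho> * t" "\<rho> * t < \<rho> * T" using t \<rho> by auto
        note D = flowD[OF fl tp(2,3)]
        have i: "((\<lambda>t. \<rho> * t) has_real_derivative \<rho>) (at t)" by (auto intro!: derivative_eq_intros)
        have "(U has_real_derivative - vel w (\<rho> * t) * \<rho> / a) (at t)"
          unfolding U_def[abs_def] by (intro DERIV_cdivide DERIV_chain2[OF D(3) i])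
        hence 1: "(U has_real_derivative - V t) (at t)" by (simp add: V_def m_def mult.commute)
        obtain d where d: "(vel w has_real_derivative d) (at (\<rho> * t))" using D(4) by blast
        have 2: "\<exists>d. (V has_real_derivative d) (at t)"
          unfolding V_def[abs_def] by (rule exI, rule DERIV_cmult, rule DERIV_chain2[OF d i])
        have "(W has_real_derivative m powr (p - 1) / \<rho> ^ (N - 1) * (((\<rho> * t) ^ (N - 1) * nonlin l (u (\<rho> * t))) * \<rho>)) (at t)"
          unfolding W_def[abs_def] by (intro DERIV_cmult DERIV_chain2[OF D(5) i])
        also have "m powr (p - 1) / \<rho> ^ (N - 1) * (((\<rho> * t) ^ (N - 1) * nonlin l (u (\<rho> * t))) * \<rho>)
          = t ^ (N - 1) * (m powr (p - 1) * \<rho> * nonlin l (u (\<rho> * t)))"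
          using \<rho> by (simp add: power_mult_distrib)
        also have "m powr (p - 1) * \<rho> = a powr (1 - r)"
        proof -
          have "m powr (p - 1) * \<rho> = \<rho> powr (p - 1) * \<rho> powr 1 * a powr (1 - p)"
            unfolding m_def powr_divide using \<rho>(1) powr_minus[of a "p - 1"] by (simp add: divide_inverse)
          also have "\<rho> powr (p - 1) * \<rho> powr 1 = a powr (p - r)" unfolding powr_add[symmetric] using \<rho>(2) by simp
          finally show ?thesis by (simp add: powr_add[symmetric])
        qed
        also have "u (\<rho> * t) = a * U t" using a by (simp add: U_def)
        also have "a powr (1 - r) * nonlin l (a * U t) = nonlin l' (U t)"
        proof -
          have U: "0 < U t" using D(1) a by (simp add: U_def)
          have "a powr (1 - r) * a powr (r - 1) = 1" "a powr (1 - r) * a powr (s - 1) = a powr (s - r)"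
            using a by (simp_all add: powr_add[symmetric])
          moreover have "a powr (1 - r) * nonlin l (a * U t) = (a powr (1 - r) * a powr (r - 1)) * U t powr (r - 1)
            + l * (a powr (1 - r) * a powr (s - 1)) * U t powr (s - 1)"
            using U a by (simp add: nonlin_def powr_mult algebra_simps)
          ultimately show ?thesis by (simp add: nonlin_def l'_def)
        qed
        finally show ?thesis using 1 2 D(2) m by (simp add: V_def)
      qed
      ultimately show ?thesis unfolding flow_def by blast
    qed
    moreover have "U 0 = 1" using u0 a by (simp add: U_def)
    ultimately show False using cross[OF k l', of U V W] by blast
  qed
  moreover have "0 < l0" using e a by (simp add: l0_def)
  ultimately show ?thesis using a(1) by blast
qed

end

section \<open>Test functions and weak gradients\<close>

text \<open>Polynomials in \<open>1 / t\<close> times \<open>exp (- (1 / t))\<close> form a class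
  closed under differentiation, with \<open>P\<close> passing to \<open>X^2 * (P - P')\<close>.
  \<open>flat 1\<close> is the standard smooth function vanishing on the nonpositive
  half-line.\<close>

definition flat :: "real poly \<Rightarrow> real \<Rightarrow> real" where
  "flat P t = (if t \<le> 0 then 0 else poly P (1 / t) * exp (- (1 / t)))"

lemma tendsto_poly_div_exp: "((\<lambda>x. poly P x / exp x) \<longlongrightarrow> (0::real)) at_top"
proof -
  have "((\<lambda>x. \<Sum>i\<le>degree P. coeff P i * (x ^ i / exp x)) \<longlongrightarrow> (\<Sum>i\<le>degree P. coeff P i * 0)) at_top"
    by (intro tendsto_sum tendsto_mult tendsto_const tendsto_power_div_exp_0)
  thus ?thesis by (simp add: poly_altdef sum_divide_distrib)
qed

lemma flat_div_tendsto_0: "((\<lambda>t. flat P t / t) \<longlongrightarrow> 0) (at 0)"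
proof (rule filterlim_split_at)
  have "((\<lambda>t. 0) \<longlongrightarrow> (0::real)) (at_left 0)" by simp
  thus "((\<lambda>t. flat P t / t) \<longlongrightarrow> 0) (at_left 0)"
    by (rule Lim_transform_eventually) (auto simp: flat_def eventually_at_filter)
  have "((\<lambda>t. poly (pCons 0 P) (inverse t) / exp (inverse t)) \<longlongrightarrow> (0::real)) (at_right 0)"
    by (rule filterlim_compose[OF tendsto_poly_div_exp filterlim_inverse_at_top_right])
  moreover have "eventually (\<lambda>t. poly (pCons 0 P) (inverse t) / exp (inverse t) = flat P t / t) (at_right 0)"
    by (auto simp: flat_def eventually_at_filter exp_minus field_simps)
  ultimately show "((\<lambda>t. flat P t / t) \<longlongrightarrow> 0) (at_right 0)"
    by (rule Lim_transform_eventually)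
qed

lemma DERIV_flat: "(flat P has_real_derivative flat ([:0, 0, 1:] * (P - pderiv P)) t) (at t)"
proof (cases "t = 0")
  case True
  thus ?thesis using flat_div_tendsto_0[of P]
    by (simp add: has_field_derivative_iff flat_def[of _ 0])
next
  case False
  show ?thesis
  proof (cases "t < 0")
    case True
    have "((\<lambda>t. 0) has_real_derivative 0) (at t)" by simp
    hence "(flat P has_real_derivative 0) (at t)"
      by (rule has_field_derivative_transform_within_open[of _ _ _ "{..<0}"]) (use True in \<open>auto simp: flat_def\<close>)
    thus ?thesis using True by (simp add: flat_def)
  next
    case F: False
    hence t: "0 < t" using False by simp
    have i: "((\<lambda>t. 1 / t) has_real_derivative - (1 / t)\<^sup>2) (at t)"
      using t by (auto intro!: derivative_eq_intros simp: power2_eq_square)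
    have "((\<lambda>t. poly P (1 / t) * exp (- (1 / t))) has_real_derivative
      (poly (pderiv P) (1 / t) * - (1 / t)\<^sup>2) * exp (- (1 / t)) + (exp (- (1 / t)) * - (- (1 / t)\<^sup>2)) * poly P (1 / t)) (at t)"
      by (intro DERIV_mult DERIV_chain2[OF poly_DERIV i] DERIV_chain2[OF DERIV_exp] DERIV_minus i)
    also have "(poly (pderiv P) (1 / t) * - (1 / t)\<^sup>2) * exp (- (1 / t)) + (exp (- (1 / t)) * - (- (1 / t)\<^sup>2)) * poly P (1 / t)
      = flat ([:0, 0, 1:] * (P - pderiv P)) t"
      using t by (simp add: flat_def power2_eq_square algebra_simps)
    finally show ?thesis
      by (rule has_field_derivative_transform_within_open[of _ _ _ "{0<..}"]) (use t in \<open>auto simp: flat_def\<close>)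
  qed
qed

text \<open>A generated class of smooth functions that contains its own directional derivatives by
  \<open>smooth_expr_deriv\<close>. All orders of smoothness then follow by one induction, without
  computing higher derivatives.\<close>

inductive smooth_expr :: "(real ^ 'n \<Rightarrow> real) \<Rightarrow> bool" where
  const: "smooth_expr (\<lambda>x. c)"
| coord: "smooth_expr (\<lambda>x. x $ i)"
| add: "smooth_expr f \<Longrightarrow> smooth_expr g \<Longrightarrow> smooth_expr (\<lambda>x. f x + g x)"
| mult: "smooth_expr f \<Longrightarrow> smooth_expr g \<Longrightarrow> smooth_expr (\<lambda>x. f x * g x)"
| flat: "smooth_expr f \<Longrightarrow> smooth_expr (\<lambda>x. flat P (f x))"

lemma smooth_expr_deriv:
  "smooth_expr f \<Longrightarrow> \<exists>D. (\<forall>x. (f has_derivative D x) (at x)) \<and> (\<forall>v. smooth_expr (\<lambda>x. D x v))"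
proof (induction rule: smooth_expr.induct)
  case (const c)
  show ?case by (rule exI[of _ "\<lambda>x v. 0"]) (auto intro: smooth_expr.const)
next
  case (coord i)
  show ?case
    by (rule exI[of _ "\<lambda>x v. v $ i"]) (auto intro!: smooth_expr.const bounded_linear_imp_has_derivative bounded_linear_vec_nth)
next
  case (add f g)
  then obtain D1 D2 where "\<forall>x. (f has_derivative D1 x) (at x)" "\<forall>v. smooth_expr (\<lambda>x. D1 x v)"
    "\<forall>x. (g has_derivative D2 x) (at x)" "\<forall>v. smooth_expr (\<lambda>x. D2 x v)" by blast
  thus ?case
    by (intro exI[of _ "\<lambda>x v. D1 x v + D2 x v"]) (auto intro!: smooth_expr.intros has_derivative_add)
next
  case (mult f g)
  then obtain D1 D2 where "\<forall>x. (f has_derivative D1 x) (at x)" "\<forall>v. smooth_expr (\<lambda>x. D1 x v)"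
    "\<forall>x. (g has_derivative D2 x) (at x)" "\<forall>v. smooth_expr (\<lambda>x. D2 x v)" by blast
  thus ?case using mult.hyps
    by (intro exI[of _ "\<lambda>x v. f x * D2 x v + D1 x v * g x"]) (auto intro!: smooth_expr.intros has_derivative_mult)
next
  case (flat f P)
  then obtain D1 where D: "\<forall>x. (f has_derivative D1 x) (at x)" "\<forall>v. smooth_expr (\<lambda>x. D1 x v)" by blast
  have "((\<lambda>x. flat P (f x)) has_derivative (\<lambda>v. D1 x v * flat ([:0, 0, 1:] * (P - pderiv P)) (f x))) (at x)" for x
    by (rule DERIV_compose_FDERIV[OF DERIV_flat]) (use D in auto)
  moreover have "smooth_expr (\<lambda>x. D1 x v * flat ([:0, 0, 1:] * (P - pderiv P)) (f x))" for v
    using D(2) flat.hyps by (intro smooth_expr.mult smooth_expr.flat) auto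
  ultimately show ?case
    by (intro exI[of _ "\<lambda>x v. D1 x v * flat ([:0, 0, 1:] * (P - pderiv P)) (f x)"]) blast
qed

lemma partial_deriv_eq: "(f has_derivative D) (at x) \<Longrightarrow> partial_deriv i f x = D (axis i 1)"
  unfolding partial_deriv_def by (metis frechet_derivative_at)

lemma smooth_expr_C_k: "smooth_expr f \<Longrightarrow> C_k k f"
proof (induction k arbitrary: f)
  case 0
  obtain D where "\<forall>x. (f has_derivative D x) (at x)" using smooth_expr_deriv[OF 0] by blast
  hence "continuous (at x) f" for x using has_derivative_continuous by blast
  thus ?case by (simp add: continuous_on_eq_continuous_at)
next
  case (Suc k)
  obtain D where D: "\<And>x. (f has_derivative D x) (at x)" "\<And>v. smooth_expr (\<lambda>x. D x v)"
    using smooth_expr_deriv[OF Suc.prems] by blast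
  have "partial_deriv i f = (\<lambda>x. D x (axis i 1))" for i
    using partial_deriv_eq[OF D(1)] by blast
  thus ?case using D Suc.IH by (auto simp: differentiable_def)
qed

lemma smooth_expr_test_function:
  assumes "smooth_expr f" and "\<And>x. f x \<noteq> 0 \<Longrightarrow> norm x \<le> R"
  shows "test_function f"
proof -
  have "closure {x. f x \<noteq> 0} \<subseteq> cball 0 R" by (rule closure_minimal) (use assms in auto)
  hence "bounded (closure {x. f x \<noteq> 0})" using bounded_subset bounded_cball by blast
  thus ?thesis using smooth_expr_C_k[OF assms(1)] by (simp add: test_function_def compact_eq_bounded_closed)
qed

lemma smooth_expr_sum: "(\<And>i. i \<in> I \<Longrightarrow> smooth_expr (f i)) \<Longrightarrow> smooth_expr (\<lambda>x. \<Sum>i\<in>I. f i x)"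
  by (induction I rule: infinite_finite_induct) (auto intro: smooth_expr.intros)

lemma smooth_expr_prod: "(\<And>i. i \<in> I \<Longrightarrow> smooth_expr (f i)) \<Longrightarrow> smooth_expr (\<lambda>x. \<Prod>i\<in>I. f i x)"
  by (induction I rule: infinite_finite_induct) (auto intro: smooth_expr.intros)

lemma smooth_expr_power: "smooth_expr f \<Longrightarrow> smooth_expr (\<lambda>x. f x ^ n)"
  by (induction n) (auto intro: smooth_expr.intros)

lemma smooth_expr_norm_sq: "smooth_expr (\<lambda>x::real^'n. (norm x)\<^sup>2)"
proof -
  have "smooth_expr (\<lambda>x::real^'n. \<Sum>i\<in>UNIV. x $ i * x $ i)"
    by (intro smooth_expr_sum smooth_expr.intros)
  moreover have "(norm x)\<^sup>2 = (\<Sum>i\<in>UNIV. x $ i * x $ i)" for x :: "real^'n"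
    by (simp add: power2_norm_eq_inner inner_vec_def)
  ultimately show ?thesis by simp
qed

lemma test_functionD:
  assumes "test_function \<phi>"
  shows "\<exists>D. (\<forall>x. (\<phi> has_derivative D x) (at x)) \<and> (\<forall>x i. partial_deriv i \<phi> x = D x (axis i 1)) \<and>
    (\<forall>v. continuous_on UNIV (\<lambda>x. D x v))"
    and "\<exists>R. \<forall>x. R < norm x \<longrightarrow> \<phi> x = 0" and "continuous_on UNIV (partial_deriv i \<phi>)" "continuous_on UNIV \<phi>"
proof -
  have C: "C_k k \<phi>" for k using assms by (simp add: test_function_def)
  show cp: "continuous_on UNIV (partial_deriv i \<phi>)" for i using C[of "Suc 0"] by simp
  show "continuous_on UNIV \<phi>" using C[of 0] by simp
  have d: "(\<phi> has_derivative frechet_derivative \<phi> (at x)) (at x)" for x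
    using C[of "Suc 0"] frechet_derivative_works by auto
  have "continuous_on UNIV (\<lambda>x. frechet_derivative \<phi> (at x) v)" for v
  proof -
    have "frechet_derivative \<phi> (at x) v = (\<Sum>i\<in>UNIV. v $ i * partial_deriv i \<phi> x)" for x
    proof -
      interpret bounded_linear "frechet_derivative \<phi> (at x)" using d has_derivative_bounded_linear by blast
      have "frechet_derivative \<phi> (at x) v = frechet_derivative \<phi> (at x) (\<Sum>i\<in>UNIV. v $ i *\<^sub>R axis i 1)"
        by (simp add: basis_expansion scalar_mult_eq_scaleR[symmetric])
      thus ?thesis by (simp add: sum scaleR partial_deriv_def)
    qed
    thus ?thesis by (auto intro!: continuous_intros cp)
  qed
  thus "\<exists>D. (\<forall>x. (\<phi> has_derivative D x) (at x)) \<and> (\<forall>x i. partial_deriv i \<phi> x = D x (axis i 1)) \<and>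
    (\<forall>v. continuous_on UNIV (\<lambda>x. D x v))"
    using d by (intro exI[of _ "\<lambda>x. frechet_derivative \<phi> (at x)"]) (auto simp: partial_deriv_def)
  have "bounded (closure {x. \<phi> x \<noteq> 0})" using assms by (simp add: test_function_def compact_eq_bounded_closed)
  then obtain R where "\<And>x. x \<in> closure {x. \<phi> x \<noteq> 0} \<Longrightarrow> norm x \<le> R" unfolding bounded_iff by blast
  hence "\<forall>x. R < norm x \<longrightarrow> \<phi> x = 0" by (meson closure_subset in_mono mem_Collect_eq not_le)
  thus "\<exists>R. \<forall>x. R < norm x \<longrightarrow> \<phi> x = 0" by blast
qed

lemma has_derivative_continuous_on_UNIV:
  assumes "\<And>x. (f has_derivative D x) (at x)" shows "continuous_on UNIV f"
  unfolding continuous_on_eq_continuous_at[OF open_UNIV] using has_derivative_continuous[OF assms] by blast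

lemma integrable_compact_support:
  fixes f :: "real ^ 'n \<Rightarrow> 'b::euclidean_space"
  assumes "continuous_on UNIV f" "\<And>x. R < norm x \<Longrightarrow> f x = 0"
  shows "integrable lborel f"
proof -
  have "integrable lborel (\<lambda>x. indicator (cball 0 R) x *\<^sub>R f x)"
    by (rule borel_integrable_compact) (use assms(1) continuous_on_subset in auto)
  moreover have "indicator (cball 0 R) x *\<^sub>R f x = f x" for x
    using assms(2)[of x] by (auto simp: indicator_def)
  ultimately show ?thesis by simp
qed

lemma lborel_translate:
  fixes f :: "'a::euclidean_space \<Rightarrow> real"
  assumes "f \<in> borel_measurable borel"
  shows "(\<integral>x. f (c + x) \<partial>lborel) = (\<integral>x. f x \<partial>lborel)"
  using integral_distr[of "(+) c" lborel borel f] assms by (simp add: lborel_distr_plus)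

text \<open>Translation invariance makes every difference quotient integrate to zero, so no Fubini
  argument along a coordinate is needed.\<close>

lemma integral_directional_derivative_0:
  fixes F :: "real ^ 'n \<Rightarrow> real"
  assumes F: "\<And>x. (F has_derivative F' x) (at x)" and c: "continuous_on UNIV (\<lambda>x. F' x v)"
    and supp: "\<And>x. R < norm x \<Longrightarrow> F x = 0"
  shows "(\<integral>x. F' x v \<partial>lborel) = 0"
proof -
  define Q where "Q n x = (F (x + (1 / real (Suc n)) *\<^sub>R v) - F x) * real (Suc n)" for n x
  have cF: "continuous_on UNIV F"
    by (rule has_derivative_continuous_on_UNIV[OF F])
  have mF: "F \<in> borel_measurable borel" using cF by (rule borel_measurable_continuous_onI)
  have iF: "integrable lborel F" by (rule integrable_compact_support[OF cF supp])
  have iFt: "integrable lborel (\<lambda>x. F (x + h))" for h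
  proof (rule integrable_compact_support[where R = "R + norm h"])
    show "continuous_on UNIV (\<lambda>x. F (x + h))"
      by (rule continuous_on_compose2[OF cF]) (auto intro!: continuous_intros)
    fix x :: "real ^ 'n" assume "R + norm h < norm x"
    thus "F (x + h) = 0" using supp[of "x + h"] norm_diff_ineq[of x h] by linarith
  qed
  have Q0: "(\<integral>x. Q n x \<partial>lborel) = 0" for n
  proof -
    have "(\<integral>x. F (x + h) \<partial>lborel) = (\<integral>x. F x \<partial>lborel)" for h
      using lborel_translate[OF mF, of h] by (simp add: add.commute)
    thus ?thesis unfolding Q_def using iF iFt by (simp add: Bochner_Integration.integral_diff)
  qed
  \<comment> \<open>This ball contains the intermediate points \<open>x + z *\<^sub>R v\<close> of
    the mean value theorem for \<open>norm x \<le> R + norm v\<close> and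
    \<open>0 \<le> z \<le> 1\<close>; for larger \<open>x\<close> the quotient vanishes.\<close>
  let ?K = "cball (0 :: real ^ 'n) (R + 2 * norm v)"
  have "bounded ((\<lambda>x. F' x v) ` ?K)"
    by (intro compact_imp_bounded compact_continuous_image continuous_on_subset[OF c]) auto
  then obtain B where B: "0 < B" "\<And>x. x \<in> ?K \<Longrightarrow> \<bar>F' x v\<bar> \<le> B" unfolding bounded_pos by auto
  have Qb: "norm (Q n x) \<le> B * indicator (cball 0 (R + norm v)) x" for n x
  proof (cases "norm x \<le> R + norm v")
    case False
    let ?h = "(1 / real (Suc n)) *\<^sub>R v"
    have "norm ?h = 1 / real (Suc n) * norm v" by simp
    also have "\<dots> \<le> 1 * norm v" by (intro mult_right_mono) auto
    finally have "norm ?h \<le> norm v" by simp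
    hence "R < norm x" "R < norm (x + ?h)" using False norm_diff_ineq[of x ?h] norm_ge_zero[of v] by linarith+
    thus ?thesis using supp B by (simp add: Q_def)
  next
    case True
    let ?d = "1 / real (Suc n)"
    have d: "0 < ?d" "?d \<le> 1" by auto
    have "((\<lambda>\<tau>. F (x + \<tau> *\<^sub>R v)) has_real_derivative F' (x + \<tau> *\<^sub>R v) v) (at \<tau>)" for \<tau>
    proof -
      have "((\<lambda>\<tau>. x + \<tau> *\<^sub>R v) has_vector_derivative v) (at \<tau>)"
        by (auto intro!: derivative_eq_intros)
      hence "((\<lambda>\<tau>. F (x + \<tau> *\<^sub>R v)) has_vector_derivative F' (x + \<tau> *\<^sub>R v) v) (at \<tau>)"
        using vector_derivative_diff_chain_within[of "\<lambda>\<tau>. x + \<tau> *\<^sub>R v" v \<tau> UNIV F "F' (x + \<tau> *\<^sub>R v)"] F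
        by (auto simp: o_def intro: has_derivative_at_withinI)
      thus ?thesis by (simp add: has_real_derivative_iff_has_vector_derivative)
    qed
    then obtain z where z: "0 < z" "z < ?d" "F (x + ?d *\<^sub>R v) - F (x + 0 *\<^sub>R v) = (?d - 0) * F' (x + z *\<^sub>R v) v"
      using MVT2[OF d(1), of "\<lambda>\<tau>. F (x + \<tau> *\<^sub>R v)" "\<lambda>\<tau>. F' (x + \<tau> *\<^sub>R v) v"] by blast
    have "z \<le> 1" using z(2) d(2) by (rule order_trans[OF less_imp_le])
    hence "z * norm v \<le> 1 * norm v" by (intro mult_right_mono) auto
    hence "norm (x + z *\<^sub>R v) \<le> R + 2 * norm v"
      using True norm_triangle_ineq[of x "z *\<^sub>R v"] z by simp
    hence "\<bar>F' (x + z *\<^sub>R v) v\<bar> \<le> B" by (intro B) auto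
    moreover have "Q n x = F' (x + z *\<^sub>R v) v"
    proof -
      have "F (x + ?d *\<^sub>R v) - F x = ?d * F' (x + z *\<^sub>R v) v" using z(3) by simp
      thus ?thesis unfolding Q_def by simp
    qed
    ultimately show ?thesis using True by simp
  qed
  have lim: "(\<lambda>n. Q n x) \<longlonglongrightarrow> F' x v" for x
  proof -
    interpret bounded_linear "F' x" using F has_derivative_bounded_linear by blast
    have "((\<lambda>\<tau>. x + \<tau> *\<^sub>R v) has_vector_derivative v) (at 0)"
      by (auto intro!: derivative_eq_intros)
    hence "((\<lambda>\<tau>. F (x + \<tau> *\<^sub>R v)) has_vector_derivative F' x v) (at 0)"
      using vector_derivative_diff_chain_within[of "\<lambda>\<tau>. x + \<tau> *\<^sub>R v" v 0 UNIV F "F' x"] F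
      by (auto simp: o_def intro: has_derivative_at_withinI)
    hence "((\<lambda>\<tau>. F (x + \<tau> *\<^sub>R v)) has_real_derivative F' x v) (at 0)"
      by (simp add: has_real_derivative_iff_has_vector_derivative)
    hence "((\<lambda>h. (F (x + h *\<^sub>R v) - F x) / h) \<longlongrightarrow> F' x v) (at 0)"
      by (simp add: has_field_derivative_iff)
    moreover have "filterlim (\<lambda>n. 1 / real (Suc n)) (at 0) sequentially"
      by (rule filterlim_atI[OF lim_1_over_n[THEN LIMSEQ_Suc]]) auto
    ultimately have "((\<lambda>n. (F (x + (1 / real (Suc n)) *\<^sub>R v) - F x) / (1 / real (Suc n))) \<longlonglongrightarrow> F' x v)"
      by (rule filterlim_compose)
    thus ?thesis by (simp add: Q_def)
  qed
  have "(\<lambda>n. \<integral>x. Q n x \<partial>lborel) \<longlonglongrightarrow> (\<integral>x. F' x v \<partial>lborel)"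
  proof (rule integral_dominated_convergence)
    show "(\<lambda>x. F' x v) \<in> borel_measurable lborel"
      using c by (simp add: borel_measurable_continuous_onI)
    show "Q n \<in> borel_measurable lborel" for n
      unfolding Q_def[abs_def] using cF
      by (simp, intro borel_measurable_continuous_onI continuous_intros continuous_on_compose2[OF cF]) auto
    show "integrable lborel (\<lambda>x. B * indicator (cball 0 (R + norm v)) x)"
      using emeasure_lborel_cball_finite by (intro integrable_mult_right integrable_real_indicator) auto
  qed (use lim Qb in auto)
  thus ?thesis by (simp add: Q0 LIMSEQ_const_iff)
qed

lemma locally_integrable_continuous:
  fixes f :: "real ^ 'n \<Rightarrow> 'b::euclidean_space"
  assumes "continuous_on UNIV f" shows "locally_integrable f"
  unfolding locally_integrable_def
proof (intro allI impI)
  fix K :: "(real ^ 'n) set" assume K: "compact K"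
  have "set_integrable lborel K f" unfolding set_integrable_def
    by (rule borel_integrable_compact[OF K]) (use assms continuous_on_subset in auto)
  moreover have "K \<in> sets borel" using K by (simp add: borel_compact)
  ultimately show "f absolutely_integrable_on K"
    unfolding set_integrable_def
    using borel_measurable_integrable by (subst integrable_completion) auto
qed

text \<open>The product \<open>u * \<phi>\<close> has compact support, so its derivative along each
  coordinate axis integrates to zero.\<close>

lemma weak_gradient_C1:
  fixes u :: "real ^ 'n \<Rightarrow> real"
  assumes u: "\<And>x. (u has_derivative (\<lambda>h. G x \<bullet> h)) (at x)" and G: "continuous_on UNIV G"
  shows "is_weak_gradient u G"
  unfolding is_weak_gradient_def
proof (intro conjI allI impI)
  have cu: "continuous_on UNIV u"
    by (rule has_derivative_continuous_on_UNIV[OF u])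
  show "locally_integrable u" "locally_integrable G" using cu G by (auto intro: locally_integrable_continuous)
  fix \<phi> :: "real ^ 'n \<Rightarrow> real" and i assume t: "test_function \<phi>"
  obtain D where D: "\<And>x. (\<phi> has_derivative D x) (at x)" "\<And>x i. partial_deriv i \<phi> x = D x (axis i 1)"
    "\<And>v. continuous_on UNIV (\<lambda>x. D x v)" using test_functionD(1)[OF t] by blast
  obtain R where R: "\<And>x. R < norm x \<Longrightarrow> \<phi> x = 0" using test_functionD(2)[OF t] by blast
  have R': "D x v = 0" if "R < norm x" for x v
  proof -
    have "open {x::real^'n. R < norm x}" by (intro open_Collect_less continuous_intros)
    hence "(\<phi> has_derivative (\<lambda>h. 0)) (at x)"
      using has_derivative_transform_within_open[of "\<lambda>_. 0" "\<lambda>_. 0" x UNIV "{x. R < norm x}" \<phi>] R that by auto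
    thus ?thesis using D(1) has_derivative_unique by metis
  qed
  have c1: "continuous_on UNIV (\<lambda>x. u x * partial_deriv i \<phi> x)" "continuous_on UNIV (\<lambda>x. G x $ i * \<phi> x)"
    using test_functionD(3,4)[OF t] cu G by (auto intro!: continuous_intros)
  have int: "integrable lborel (\<lambda>x. u x * partial_deriv i \<phi> x)" "integrable lborel (\<lambda>x. G x $ i * \<phi> x)"
    by (rule integrable_compact_support[OF c1(1), of R] integrable_compact_support[OF c1(2), of R]; simp add: R R' D(2))+
  have "(\<integral>x. u x * D x (axis i 1) + (G x \<bullet> axis i 1) * \<phi> x \<partial>lborel) = 0"
  proof (rule integral_directional_derivative_0)
    show "((\<lambda>x. u x * \<phi> x) has_derivative (\<lambda>h. u x * D x h + (G x \<bullet> h) * \<phi> x)) (at x)" for x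
      using u D(1) by (rule has_derivative_mult)
    show "continuous_on UNIV (\<lambda>x. u x * D x (axis i 1) + (G x \<bullet> axis i 1) * \<phi> x)"
      using cu G D(3) test_functionD(4)[OF t] by (intro continuous_intros)
  qed (use R in auto)
  hence "(\<integral>x. u x * partial_deriv i \<phi> x \<partial>lborel) + (\<integral>x. G x $ i * \<phi> x \<partial>lborel) = 0"
    using int by (subst Bochner_Integration.integral_add[symmetric]) (auto simp: D(2) inner_axis)
  thus "(\<integral>x. u x * partial_deriv i \<phi> x \<partial>lebesgue) = - (\<integral>x. G x $ i * \<phi> x \<partial>lebesgue)"
    using int borel_measurable_integrable by (subst (1 2) integral_completion) auto
qed

section \<open>Almost everywhere uniqueness of weak gradients\<close>

lemma AE_0_if_box_integrals_0:
  fixes g :: "'a::euclidean_space \<Rightarrow> real"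
  assumes g: "integrable lborel g" and box: "\<And>a b. (\<integral>x. indicator (box a b) x * g x \<partial>lborel) = 0"
  shows "AE x in lborel. g x = 0"
proof (rule sigma_finite_measure.density_zero[OF sigma_finite_lborel g])
  fix A :: "'a set" assume "A \<in> sets lborel"
  hence A: "A \<in> sigma_sets UNIV (range (\<lambda>(a, b). box a b))" by (simp add: borel_eq_box)
  have sig: "B \<in> sets borel" if "B \<in> sigma_sets UNIV (range (\<lambda>(a, b). box a b))" for B :: "'a set"
    using that by (simp add: borel_eq_box)
  have si: "set_integrable lborel B g" if "B \<in> sets borel" for B
    using g that by (metis set_integrable_subset set_integrable_def UNIV_I integrable_mult_indicator sets_lborel)
  have st: "Int_stable (range (\<lambda>(a, b). box a b :: 'a set))"
    unfolding Int_stable_def by (auto simp: box_Int_box)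
  have subP: "range (\<lambda>(a, b). box a b :: 'a set) \<subseteq> Pow UNIV" by simp
  \<comment> \<open>The complement case of the Dynkin induction over the boxes needs the integral
    over the whole space, which is the limit over growing boxes.\<close>
  have whole: "(\<integral>x. g x \<partial>lborel) = 0"
  proof -
    have "(\<lambda>n. \<integral>x. indicator (box (- real n *\<^sub>R One) (real n *\<^sub>R One)) x * g x \<partial>lborel) \<longlonglongrightarrow> (\<integral>x. g x \<partial>lborel)"
    proof (rule integral_dominated_convergence[where w = "\<lambda>x. norm (g x)"])
      show "AE x in lborel. (\<lambda>n. indicator (box (- real n *\<^sub>R One) (real n *\<^sub>R One)) x * g x) \<longlonglongrightarrow> g x"
      proof (rule AE_I2)
        fix x :: 'a
        obtain n0 where n0: "norm x < real n0" using reals_Archimedean2 by blast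
        have "x \<in> box (- real n *\<^sub>R One) (real n *\<^sub>R One)" if "n0 \<le> n" for n
        proof -
          have "\<bar>x \<bullet> b\<bar> < real n" if "b \<in> Basis" for b
            using Basis_le_norm[OF that, of x] n0 \<open>n0 \<le> n\<close> by linarith
          thus ?thesis by (auto simp: mem_box abs_less_iff minus_less_iff)
        qed
        hence "eventually (\<lambda>n. indicator (box (- real n *\<^sub>R One) (real n *\<^sub>R One)) x * g x = g x) sequentially"
          by (auto simp: eventually_sequentially intro!: exI[of _ n0])
        thus "(\<lambda>n. indicator (box (- real n *\<^sub>R One) (real n *\<^sub>R One)) x * g x) \<longlonglongrightarrow> g x"
          by (rule tendsto_eventually)
      qed
    qed (use g in \<open>auto simp: indicator_def\<close>)
    thus ?thesis by (simp add: box LIMSEQ_const_iff)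
  qed
  show "set_lebesgue_integral lborel A g = 0"
    using st subP A
  proof (induction A rule: sigma_sets_induct_disjoint)
    case (basic B)
    thus ?case using box by (auto simp: set_lebesgue_integral_def)
  next
    case (compl B)
    have B: "B \<in> sets borel" using compl by (simp add: sig)
    have "set_lebesgue_integral lborel (UNIV - B) g + set_lebesgue_integral lborel B g = set_lebesgue_integral lborel ((UNIV - B) \<union> B) g"
      by (subst set_integral_Un) (use B si in auto)
    thus ?case using compl.IH whole by (simp add: set_lebesgue_integral_def)
  next
    case (union B)
    have B: "B i \<in> sets borel" for i using union by (intro sig) auto
    have "set_lebesgue_integral lborel (\<Union>i. B i) g = (\<Sum>i. set_lebesgue_integral lborel (B i) g)"
      by (rule lebesgue_integral_countable_add) (use B si union in \<open>auto simp: disjoint_family_on_def\<close>)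
    thus ?case using union.IH by simp
  qed (auto simp: set_lebesgue_integral_def)
qed

lemma locally_integrable_set_integrable:
  "locally_integrable f \<Longrightarrow> integrable lebesgue (\<lambda>x. indicator (cball 0 R) x *\<^sub>R f x)"
  unfolding locally_integrable_def set_integrable_def[symmetric] by auto

lemma locally_integrable_measurable:
  fixes f :: "real ^ 'n \<Rightarrow> 'b::euclidean_space"
  assumes "locally_integrable f" shows "f \<in> borel_measurable lebesgue"
proof (rule borel_measurable_LIMSEQ_metric)
  show "(\<lambda>x. indicator (cball 0 (real n)) x *\<^sub>R f x) \<in> borel_measurable lebesgue" for n
    using locally_integrable_set_integrable[OF assms] by (rule borel_measurable_integrable)
  fix x :: "real ^ 'n"
  obtain n0 where n0: "norm x < real n0" using reals_Archimedean2 by blast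
  have "eventually (\<lambda>n. indicator (cball 0 (real n)) x *\<^sub>R f x = f x) sequentially"
    unfolding eventually_sequentially using n0 by (intro exI[of _ n0]) (auto simp: indicator_def)
  thus "(\<lambda>n. indicator (cball 0 (real n)) x *\<^sub>R f x) \<longlonglongrightarrow> f x" by (rule tendsto_eventually)
qed

lemma locally_integrable_component:
  fixes g :: "real ^ 'n \<Rightarrow> real ^ 'm"
  assumes "locally_integrable g" shows "locally_integrable (\<lambda>x. g x $ i)"
  using assms absolutely_integrable_linear[where f = g and h = "\<lambda>v. v $ i", OF _ bounded_linear_vec_nth]
  by (auto simp: locally_integrable_def o_def)

lemma integrable_locally_mult:
  fixes f \<psi> :: "real ^ 'n \<Rightarrow> real"
  assumes f: "locally_integrable f" and c: "\<psi> \<in> borel_measurable borel" and B: "\<And>x. \<bar>\<psi> x\<bar> \<le> B"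
    and supp: "\<And>x. R < norm x \<Longrightarrow> \<psi> x = 0"
  shows "integrable lebesgue (\<lambda>x. f x * \<psi> x)"
proof (rule Bochner_Integration.integrable_bound)
  show "integrable lebesgue (\<lambda>x. B * norm (indicator (cball 0 R) x *\<^sub>R f x))"
    by (intro integrable_mult_right integrable_norm locally_integrable_set_integrable f)
  have "\<psi> \<in> borel_measurable lebesgue" using c by (simp add: measurable_completion)
  thus "(\<lambda>x. f x * \<psi> x) \<in> borel_measurable lebesgue"
    using locally_integrable_measurable[OF f] by (rule borel_measurable_times[rotated])
  have "norm (f x * \<psi> x) \<le> norm (B * norm (indicator (cball 0 R) x *\<^sub>R f x))" for x
  proof (cases "R < norm x")
    case False
    have "0 \<le> B" using B[of x] by simp
    thus ?thesis using False mult_left_mono[OF B, of "\<bar>f x\<bar>" x] by (simp add: abs_mult mult.commute)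
  qed (use supp in auto)
  thus "AE x in lebesgue. norm (f x * \<psi> x) \<le> norm (B * norm (indicator (cball 0 R) x *\<^sub>R f x))" by simp
qed

lemma continuous_compact_support_bounded:
  fixes \<psi> :: "real ^ 'n \<Rightarrow> real"
  assumes c: "continuous_on UNIV \<psi>" and supp: "\<And>x. R < norm x \<Longrightarrow> \<psi> x = 0"
  shows "\<exists>B>0. \<forall>x. \<bar>\<psi> x\<bar> \<le> B"
proof -
  have "bounded (\<psi> ` cball 0 R)"
    by (intro compact_imp_bounded compact_continuous_image continuous_on_subset[OF c]) auto
  then obtain B where B: "0 < B" "\<And>x. x \<in> cball 0 R \<Longrightarrow> \<bar>\<psi> x\<bar> \<le> B" unfolding bounded_pos by auto
  have "\<bar>\<psi> x\<bar> \<le> B" for x using B supp[of x] by (cases "R < norm x") auto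
  thus ?thesis using B by blast
qed

lemma integrable_locally_mult_continuous:
  fixes f \<psi> :: "real ^ 'n \<Rightarrow> real"
  assumes "locally_integrable f" "continuous_on UNIV \<psi>" "\<And>x. R < norm x \<Longrightarrow> \<psi> x = 0"
  shows "integrable lebesgue (\<lambda>x. f x * \<psi> x)"
  using integrable_locally_mult[OF assms(1) borel_measurable_continuous_onI[OF assms(2)] _ assms(3)]
    continuous_compact_support_bounded[OF assms(2,3)] by blast

lemma flat_1: "0 \<le> flat 1 t" "flat 1 t \<le> 1" "t \<le> 0 \<Longrightarrow> flat 1 t = 0"
  by (auto simp: flat_def)

lemma flat_1_lim: "0 < t \<Longrightarrow> (\<lambda>n. flat 1 (real (Suc n) * t)) \<longlonglongrightarrow> 1"
proof -
  assume t: "0 < t"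
  have "(\<lambda>n. exp (- (1 / real (Suc n) * (1 / t)))) \<longlonglongrightarrow> exp (- (0 * (1 / t)))"
    by (intro tendsto_intros lim_1_over_n[THEN LIMSEQ_Suc])
  moreover have "exp (- (1 / real (Suc n) * (1 / t))) = flat 1 (real (Suc n) * t)" for n
    using t by (simp add: flat_def zero_less_mult_iff not_le)
  ultimately show ?thesis by simp
qed

text \<open>Smooth approximations of the indicator of a box: each factor vanishes on the wrong side
  of one face and tends to 1 on the other side.\<close>

definition box_bump :: "real ^ 'n \<Rightarrow> real ^ 'n \<Rightarrow> nat \<Rightarrow> real ^ 'n \<Rightarrow> real" where
  "box_bump a b n x = (\<Prod>i\<in>UNIV. flat 1 (real (Suc n) * (x $ i - a $ i)) * flat 1 (real (Suc n) * (b $ i - x $ i)))"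

lemma box_bump_props:
  shows "smooth_expr (box_bump a b n)" "0 \<le> box_bump a b n x" "box_bump a b n x \<le> 1"
    and "x \<notin> box a b \<Longrightarrow> box_bump a b n x = 0" "(\<lambda>n. box_bump a b n x) \<longlonglongrightarrow> indicator (box a b) x"
proof -
  have "smooth_expr (\<lambda>x. x $ i + (-1) * a $ i)" "smooth_expr (\<lambda>x. b $ i + (-1) * x $ i)" for i
    by (intro smooth_expr.intros)+
  hence "smooth_expr (\<lambda>x. x $ i - a $ i)" "smooth_expr (\<lambda>x. b $ i - x $ i)" for i by simp_all
  thus "smooth_expr (box_bump a b n)"
    unfolding box_bump_def[abs_def] by (intro smooth_expr_prod smooth_expr.intros)
  show "0 \<le> box_bump a b n x" unfolding box_bump_def by (intro prod_nonneg ballI mult_nonneg_nonneg flat_1)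
  have "box_bump a b n x \<le> (\<Prod>i\<in>(UNIV::'a set). 1)"
    unfolding box_bump_def by (intro prod_mono conjI mult_nonneg_nonneg mult_le_one flat_1)
  thus "box_bump a b n x \<le> 1" by simp
  show z: "box_bump a b n x = 0" if out: "x \<notin> box a b" for n
  proof -
    obtain i where "x $ i \<le> a $ i \<or> b $ i \<le> x $ i" using out by (auto simp: mem_box_cart not_less)
    hence "flat 1 (real (Suc n) * (x $ i - a $ i)) * flat 1 (real (Suc n) * (b $ i - x $ i)) = 0"
      using flat_1(3)[of "real (Suc n) * (x $ i - a $ i)"] flat_1(3)[of "real (Suc n) * (b $ i - x $ i)"]
      by (auto simp: mult_nonneg_nonpos)
    thus ?thesis unfolding box_bump_def by (intro prod_zero) auto
  qed
  show "(\<lambda>n. box_bump a b n x) \<longlonglongrightarrow> indicator (box a b) x"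
  proof (cases "x \<in> box a b")
    case True
    hence "(\<lambda>n. box_bump a b n x) \<longlonglongrightarrow> (\<Prod>i\<in>(UNIV::'a set). 1 * 1)"
      unfolding box_bump_def by (intro tendsto_prod tendsto_mult flat_1_lim) (auto simp: mem_box_cart)
    thus ?thesis using True by simp
  next
    case False thus ?thesis using z by simp
  qed
qed

lemma box_bump_support: "\<exists>R. \<forall>n x. R < norm x \<longrightarrow> box_bump a b n x = 0"
proof -
  obtain R where "\<And>x. x \<in> box a b \<Longrightarrow> norm x \<le> R"
    using bounded_box[of a b] unfolding bounded_iff by blast
  hence "\<forall>n x. R < norm x \<longrightarrow> box_bump a b n x = 0" using box_bump_props(4) by (meson not_le)
  thus ?thesis by blast
qed

text \<open>Testing with box bumps shows that the difference of two weak gradients has zero integral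
  over every box. This allows the arbitrary representative \<open>weak_grad U\<close> to be replaced
  by an explicit gradient.\<close>

lemma weak_gradient_unique:
  assumes g: "is_weak_gradient u g1" "is_weak_gradient u g2"
  shows "AE x in lebesgue. g1 x = g2 x"
proof -
  have comp: "AE x in lebesgue. g1 x $ i = g2 x $ i" for i
  proof -
    define d where "d x = g1 x $ i - g2 x $ i" for x
    have li: "locally_integrable (\<lambda>x. g1 x $ i)" "locally_integrable (\<lambda>x. g2 x $ i)"
      using g locally_integrable_component by (auto simp: is_weak_gradient_def)
    have ld: "locally_integrable d"
      using li unfolding locally_integrable_def d_def[abs_def] by (auto intro: set_integral_diff)
    have box0: "(\<integral>x. d x * indicator (box a b) x \<partial>lebesgue) = 0" for a b
    proof -
      obtain R where R: "\<And>n x. R < norm x \<Longrightarrow> box_bump a b n x = 0" using box_bump_support by metis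
      have t: "test_function (box_bump a b n)" for n
        by (rule smooth_expr_test_function[OF box_bump_props(1)]) (use R not_le in blast)
      have i: "integrable lebesgue (\<lambda>x. g1 x $ i * box_bump a b n x)" "integrable lebesgue (\<lambda>x. g2 x $ i * box_bump a b n x)" for n
        by (rule integrable_locally_mult_continuous[OF li(1) test_functionD(4)[OF t] R]
            integrable_locally_mult_continuous[OF li(2) test_functionD(4)[OF t] R]; assumption)+
      have "(\<integral>x. g1 x $ i * box_bump a b n x \<partial>lebesgue) = (\<integral>x. g2 x $ i * box_bump a b n x \<partial>lebesgue)" for n
      proof -
        have "(\<integral>x. u x * partial_deriv i (box_bump a b n) x \<partial>lebesgue) = - (\<integral>x. g x $ i * box_bump a b n x \<partial>lebesgue)"
          if "is_weak_gradient u g" for g using that t[of n] unfolding is_weak_gradient_def by blast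
        from this[OF g(1)] this[OF g(2)] show ?thesis by simp
      qed
      hence 0: "(\<integral>x. d x * box_bump a b n x \<partial>lebesgue) = 0" for n
        using i by (simp add: d_def left_diff_distrib Bochner_Integration.integral_diff)
      have "(\<lambda>n. \<integral>x. d x * box_bump a b n x \<partial>lebesgue) \<longlonglongrightarrow> (\<integral>x. d x * indicator (box a b) x \<partial>lebesgue)"
      proof (rule integral_dominated_convergence[where w = "\<lambda>x. norm (indicator (cball 0 R) x *\<^sub>R d x)"])
        show "integrable lebesgue (\<lambda>x. norm (indicator (cball 0 R) x *\<^sub>R d x))"
          by (intro integrable_norm locally_integrable_set_integrable ld)
        have md: "d \<in> borel_measurable lebesgue" by (rule locally_integrable_measurable[OF ld])
        show "(\<lambda>x. d x * indicator (box a b) x) \<in> borel_measurable lebesgue"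
          using md by (intro borel_measurable_times borel_measurable_indicator) auto
        show "(\<lambda>x. d x * box_bump a b n x) \<in> borel_measurable lebesgue" for n
          using md test_functionD(4)[OF t]
          by (intro borel_measurable_times) (simp_all add: measurable_completion borel_measurable_continuous_onI)
        show "AE x in lebesgue. (\<lambda>n. d x * box_bump a b n x) \<longlonglongrightarrow> d x * indicator (box a b) x"
          by (intro AE_I2 tendsto_intros box_bump_props)
        have "norm (d x * box_bump a b n x) \<le> norm (indicator (cball 0 R) x *\<^sub>R d x)" for n x
        proof (cases "R < norm x")
          case False
          have "\<bar>d x\<bar> * \<bar>box_bump a b n x\<bar> \<le> \<bar>d x\<bar> * 1"
            using box_bump_props(2,3)[of a b n x] by (intro mult_left_mono) auto
          thus ?thesis using False by (simp add: abs_mult)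
        qed (simp add: R)
        thus "AE x in lebesgue. norm (d x * box_bump a b n x) \<le> norm (indicator (cball 0 R) x *\<^sub>R d x)" for n by simp
      qed
      thus ?thesis by (simp add: 0 LIMSEQ_const_iff)
    qed
    have md: "d \<in> borel_measurable lebesgue" by (rule locally_integrable_measurable[OF ld])
    \<comment> \<open>The box criterion asks for functions integrable with respect to
      \<open>lborel\<close>, whereas \<open>d\<close> is Lebesgue measurable and only locally
      integrable. Hence a Borel version, cut off to large boxes.\<close>
    then obtain d' where d': "d' \<in> borel_measurable lborel" "AE x in lborel. d x = d' x"
      using completion_ex_borel_measurable_real by blast
    have dl: "AE x in lebesgue. d x = d' x" using d'(2) by (rule AE_completion)
    have md': "d' \<in> borel_measurable lebesgue" using d'(1) by (rule measurable_completion)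
    let ?b = "\<lambda>n. box (- real n *\<^sub>R One) (real n *\<^sub>R One) :: (real ^ 'a) set"
    have "AE x in lborel. indicator (?b n) x * d' x = 0" for n
    proof (rule AE_0_if_box_integrals_0)
      obtain R where R: "\<And>x. x \<in> ?b n \<Longrightarrow> norm x \<le> R"
        using bounded_box unfolding bounded_iff by metis
      have "x \<notin> ?b n" if "R < norm x" for x using R[of x] that by auto
      hence "integrable lebesgue (\<lambda>x. d x * indicator (?b n) x)"
        by (intro integrable_locally_mult[OF ld, where B = 1 and R = R]) (auto simp: indicator_def)
      hence "integrable lebesgue (\<lambda>x. indicator (?b n) x * d' x)"
      proof (rule integrable_cong_AE_imp)
        show "(\<lambda>x. indicator (?b n) x * d' x) \<in> borel_measurable lebesgue"
          using md' by (intro borel_measurable_times borel_measurable_indicator) auto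
        show "AE x in lebesgue. d x * indicator (?b n) x = indicator (?b n) x * d' x"
          using dl by (auto elim!: AE_mp)
      qed
      thus "integrable lborel (\<lambda>x. indicator (?b n) x * d' x)"
        using d'(1) by (subst (asm) integrable_completion) auto
      fix a b :: "real ^ 'a"
      obtain a' b' where ab: "box a b \<inter> ?b n = box a' b'" using box_Int_box[of a b] by blast
      have "(\<integral>x. indicator (box a b) x * (indicator (?b n) x * d' x) \<partial>lborel) = (\<integral>x. indicator (box a b) x * (indicator (?b n) x * d' x) \<partial>lebesgue)"
      proof (rule integral_completion[symmetric])
        show "(\<lambda>x. indicator (box a b) x * (indicator (?b n) x * d' x)) \<in> borel_measurable lborel"
          using d'(1) by (intro borel_measurable_times borel_measurable_indicator) auto
      qed
      also have "\<dots> = (\<integral>x. d x * indicator (box a' b') x \<partial>lebesgue)"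
      proof (rule integral_cong_AE)
        show "(\<lambda>x. indicator (box a b) x * (indicator (?b n) x * d' x)) \<in> borel_measurable lebesgue"
          "(\<lambda>x. d x * indicator (box a' b') x) \<in> borel_measurable lebesgue"
          using md md' by (intro borel_measurable_times borel_measurable_indicator; simp)+
        have "indicator (box a' b') x = indicator (box a b) x * (indicator (?b n) x :: real)" for x
          unfolding ab[symmetric] by (auto simp: indicator_def)
        thus "AE x in lebesgue. indicator (box a b) x * (indicator (?b n) x * d' x) = d x * indicator (box a' b') x"
          using dl by (auto elim!: AE_mp)
      qed
      also have "\<dots> = 0" by (rule box0)
      finally show "(\<integral>x. indicator (box a b) x * (indicator (?b n) x * d' x) \<partial>lborel) = 0" .
    qed
    hence "AE x in lborel. \<forall>n. indicator (?b n) x * d' x = 0" by (subst AE_all_countable) blast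
    hence "AE x in lborel. d' x = 0"
    proof (rule AE_mp, intro AE_I2 impI)
      fix x :: "real ^ 'a" assume a: "\<forall>n. indicator (?b n) x * d' x = 0"
      obtain n where n: "norm x < real n" using reals_Archimedean2 by blast
      have "\<bar>x \<bullet> b\<bar> < real n" if "b \<in> Basis" for b using Basis_le_norm[OF that, of x] n by linarith
      hence "x \<in> ?b n" by (auto simp: mem_box abs_less_iff minus_less_iff)
      thus "d' x = 0" using a by (metis indicator_simps(1) mult_1)
    qed
    hence "AE x in lebesgue. d' x = 0" by (rule AE_completion)
    with dl show ?thesis by (auto simp: d_def elim!: AE_mp)
  qed
  have "AE x in lebesgue. \<forall>i\<in>UNIV. g1 x $ i = g2 x $ i" using comp by (intro AE_finite_allI) auto
  thus ?thesis by (auto simp: vec_eq_iff)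
qed

text \<open>Dyadic decomposition: where \<open>1 + norm x\<close> lies between \<open>2 ^ k\<close>
  and \<open>2 ^ Suc k\<close>, the function is at most \<open>2 powr (- k * \<beta>)\<close>, on a
  ball of volume proportional to \<open>2 ^ k\<close> to the power of the dimension. A geometric
  series majorises the integral.\<close>

lemma integrable_radial_decay:
  assumes \<beta>: "real CARD('n) < \<beta>"
  shows "integrable lebesgue (\<lambda>x :: real ^ 'n. (1 + norm x) powr - \<beta>)"
proof -
  let ?f = "\<lambda>x :: real ^ 'n. (1 + norm x) powr - \<beta>"
  let ?n = "CARD('n)"
  let ?B = "\<lambda>k. ball (0 :: real ^ 'n) (2 ^ Suc k)"
  have cf: "continuous_on UNIV ?f"
    by (intro continuous_intros) (auto simp: add_nonneg_eq_0_iff)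
  have mf: "?f \<in> borel_measurable borel" using cf by (rule borel_measurable_continuous_onI)
  define c where "c k = 2 powr (- real k * \<beta>)" for k :: nat
  have term_le: "a k \<le> (\<Sum>j. a j)" for a :: "nat \<Rightarrow> ennreal" and k
    using sum_le_suminf[of a "{k}"] by simp
  have bound: "ennreal (?f x) \<le> (\<Sum>k. ennreal (c k) * indicator (?B k) x)" for x
  proof -
    define k where "k = nat \<lfloor>log 2 (1 + norm x)\<rfloor>"
    have nx: "0 < 1 + norm x" using norm_ge_zero[of x] by linarith
    have l0: "0 \<le> log 2 (1 + norm x)" using nx by (subst zero_le_log_cancel_iff) auto
    hence k: "real k \<le> log 2 (1 + norm x)" "log 2 (1 + norm x) < real k + 1" unfolding k_def by linarith+
    have "2 powr real k \<le> 1 + norm x" using k(1) nx by (subst (asm) le_log_iff) auto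
    hence "?f x \<le> (2 powr real k) powr - \<beta>" using \<beta> by (intro powr_mono2') auto
    also have "\<dots> = c k" by (simp add: c_def powr_powr)
    finally have 1: "?f x \<le> c k" .
    have "1 + norm x < 2 powr (real k + 1)" using k(2) nx by (subst (asm) log_less_iff) auto
    also have "\<dots> = 2 ^ Suc k" by (simp add: powr_add powr_realpow)
    finally have "x \<in> ?B k" by simp
    hence "ennreal (?f x) \<le> ennreal (c k) * indicator (?B k) x" using 1 by (simp add: ennreal_leI)
    also have "\<dots> \<le> (\<Sum>k. ennreal (c k) * indicator (?B k) x)" by (rule term_le)
    finally show ?thesis .
  qed
  define \<rho> where "\<rho> = (2::real) powr (?n - \<beta>)"
  have \<rho>: "0 < \<rho>" "\<rho> < 1" using \<beta> by (auto simp: \<rho>_def powr_less_one)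
  define C where "C = unit_ball_vol (real ?n) * 2 ^ ?n"
  have shell: "ennreal (c k) * emeasure lborel (?B k) = ennreal (C * \<rho> ^ k)" for k
  proof -
    have "emeasure lborel (?B k) = ennreal (unit_ball_vol (real ?n) * (2 ^ Suc k) ^ ?n)"
      by (subst emeasure_ball) auto
    hence "ennreal (c k) * emeasure lborel (?B k) = ennreal (c k * (unit_ball_vol (real ?n) * (2 ^ Suc k) ^ ?n))"
      by (simp add: ennreal_mult' c_def)
    also have "c k * (unit_ball_vol (real ?n) * (2 ^ Suc k) ^ ?n) = C * (c k * (2 ^ k) ^ ?n)"
      by (simp add: C_def power_mult_distrib)
    also have "c k * (2 ^ k) ^ ?n = \<rho> ^ k"
    proof -
      have "(2 ^ k) ^ ?n = 2 powr (real k * ?n)" by (simp add: powr_realpow[symmetric] powr_powr)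
      hence "c k * (2 ^ k) ^ ?n = 2 powr ((?n - \<beta>) * real k)" by (simp add: c_def powr_add[symmetric] algebra_simps)
      also have "\<dots> = \<rho> powr real k" by (simp add: \<rho>_def powr_powr)
      finally show ?thesis using \<rho> by (simp add: powr_realpow)
    qed
    finally show ?thesis .
  qed
  have "(\<integral>\<^sup>+x. ennreal (?f x) \<partial>lborel) \<le> (\<integral>\<^sup>+x. (\<Sum>k. ennreal (c k) * indicator (?B k) x) \<partial>lborel)"
    by (rule nn_integral_mono) (rule bound)
  also have "\<dots> = (\<Sum>k. \<integral>\<^sup>+x. ennreal (c k) * indicator (?B k) x \<partial>lborel)"
  proof (rule nn_integral_suminf)
    fix k
    have [measurable]: "?B k \<in> sets borel" by (rule borel_open) simp
    show "(\<lambda>x. ennreal (c k) * indicator (?B k) x) \<in> borel_measurable lborel" by measurable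
  qed
  also have "\<dots> = (\<Sum>k. ennreal (C * \<rho> ^ k))" by (simp add: nn_integral_cmult_indicator shell del: power_Suc)
  also have "\<dots> = ennreal (\<Sum>k. C * \<rho> ^ k)"
    using \<rho> by (intro suminf_ennreal2 summable_mult summable_geometric) (auto simp: C_def)
  also have "\<dots> < \<infinity>" by simp
  finally have "integrable lborel ?f"
    using mf by (intro integrableI_bounded) auto
  thus ?thesis using mf by (subst integrable_completion) auto
qed

section \<open>Radial vector fields against weak gradients\<close>

text \<open>Written in terms of the squared norm, so that composition stays within
  \<open>smooth_expr\<close>. As \<open>R\<close> grows it tends to \<open>flat 1 1\<close> rather
  than to 1; this nonzero constant appears on both sides of the limit identity and is cancelled in
  \<open>radial_weak_identity\<close>.\<close>

definition cutoff :: "real \<Rightarrow> real \<Rightarrow> real" where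
  "cutoff R \<rho> = flat 1 (1 - \<rho> / R\<^sup>2)"

text \<open>\<open>[:0, 0, 1:]\<close> is \<open>X^2 * (P - P')\<close> for \<open>P = 1\<close>, as
  required by \<open>DERIV_flat\<close>.\<close>

definition cutoff' :: "real \<Rightarrow> real \<Rightarrow> real" where
  "cutoff' R \<rho> = - flat [:0, 0, 1:] (1 - \<rho> / R\<^sup>2) / R\<^sup>2"

lemma DERIV_cutoff: "(cutoff R has_real_derivative cutoff' R \<rho>) (at \<rho>)"
proof -
  have "((\<lambda>\<rho>. 1 - \<rho> / R\<^sup>2) has_real_derivative - (1 / R\<^sup>2)) (at \<rho>)"
    using DERIV_diff[OF DERIV_const DERIV_cdivide[OF DERIV_ident]] by fastforce
  from DERIV_chain2[OF DERIV_flat[of 1] this] show ?thesis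
    unfolding cutoff_def[abs_def] cutoff'_def by simp
qed

lemma cutoff_outside:
  assumes "0 < R" "R \<le> t" shows "cutoff R (t\<^sup>2) = 0" "cutoff' R (t\<^sup>2) = 0"
proof -
  have "R\<^sup>2 \<le> t\<^sup>2" using assms by (intro power_mono) auto
  hence "1 - t\<^sup>2 / R\<^sup>2 \<le> 0" using assms by (simp add: field_simps)
  thus "cutoff R (t\<^sup>2) = 0" "cutoff' R (t\<^sup>2) = 0" by (auto simp: cutoff_def cutoff'_def flat_def)
qed

lemma cutoff_bounds: "0 \<le> cutoff R \<rho>" "cutoff R \<rho> \<le> 1"
  unfolding cutoff_def by (rule flat_1)+

lemma continuous_on_flat: "continuous_on UNIV (flat P)"
  using DERIV_flat DERIV_isCont continuous_at_imp_continuous_on by blast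

lemma flat_bounded: "\<exists>B>0. \<forall>t\<le>1. \<bar>flat P t\<bar> \<le> B"
proof -
  have "bounded (flat P ` {0..1})"
    by (intro compact_imp_bounded compact_continuous_image continuous_on_subset[OF continuous_on_flat]) auto
  then obtain B where B: "0 < B" "\<And>t. t \<in> {0..1} \<Longrightarrow> \<bar>flat P t\<bar> \<le> B" unfolding bounded_pos by auto
  have "\<bar>flat P t\<bar> \<le> B" if "t \<le> 1" for t using B(2)[of t] B(1) that by (cases "0 \<le> t") (auto simp: flat_def)
  thus ?thesis using B by blast
qed

lemma cutoff'_bound: "\<exists>B>0. \<forall>R>0. \<forall>t\<ge>0. \<bar>cutoff' R (t\<^sup>2)\<bar> \<le> B / R\<^sup>2"
proof -
  obtain B where B: "0 < B" "\<And>t. t \<le> 1 \<Longrightarrow> \<bar>flat [:0, 0, 1:] t\<bar> \<le> B" using flat_bounded by blast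
  have "\<bar>cutoff' R (t\<^sup>2)\<bar> \<le> B / R\<^sup>2" if "0 < R" for R t :: real
    using B(2)[of "1 - t\<^sup>2 / R\<^sup>2"] that unfolding cutoff'_def
    by (simp add: abs_divide divide_right_mono)
  thus ?thesis using B by blast
qed

text \<open>The field \<open>x G(\<bar>x\<bar>\<^sup>2)\<close> has divergence \<open>N G + 2 \<rho> G'\<close>, so a polynomial divergence in
  \<open>\<rho> = \<bar>x\<bar>\<^sup>2\<close> is produced by a polynomial \<open>G\<close>.\<close>

lemma cutoff_polynomial_identity:
  fixes \<phi> :: "real ^ 'n \<Rightarrow> real" and a :: "nat \<Rightarrow> real" and m :: nat
  assumes wg: "is_weak_gradient \<phi> g" and R: "0 < R"
  defines "K \<equiv> \<lambda>\<rho>. \<Sum>j\<le>m. a j * \<rho> ^ j"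
  defines "G \<equiv> \<lambda>\<rho>. \<Sum>j\<le>m. a j / (CARD('n) + 2 * j) * \<rho> ^ j"
  shows "(\<integral>x. \<phi> x * (K ((norm x)\<^sup>2) * cutoff R ((norm x)\<^sup>2) + 2 * (norm x)\<^sup>2 * G ((norm x)\<^sup>2) * cutoff' R ((norm x)\<^sup>2)) \<partial>lebesgue)
     = - (\<integral>x. (g x \<bullet> x) * (G ((norm x)\<^sup>2) * cutoff R ((norm x)\<^sup>2)) \<partial>lebesgue)"
proof -
  let ?N = "real CARD('n)"
  define G' where "G' \<rho> = (\<Sum>j\<le>m. a j / (?N + 2 * j) * (j * \<rho> ^ (j - 1)))" for \<rho> :: real
  have dG: "(G has_real_derivative G' \<rho>) (at \<rho>)" for \<rho>
    unfolding G_def G'_def by (rule derivative_eq_intros refl)+ (auto intro!: sum.cong)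
  have NG: "?N * G \<rho> + 2 * \<rho> * G' \<rho> = K \<rho>" for \<rho>
  proof -
    have "?N * (a j / (?N + 2 * j) * \<rho> ^ j) + 2 * \<rho> * (a j / (?N + 2 * j) * (j * \<rho> ^ (j - 1))) = a j * \<rho> ^ j" for j
    proof -
      have rj: "\<rho> * (j * \<rho> ^ (j - 1)) = j * \<rho> ^ j" by (cases j) (auto simp: algebra_simps)
      have "?N * (a j / (?N + 2 * j) * \<rho> ^ j) + 2 * \<rho> * (a j / (?N + 2 * j) * (j * \<rho> ^ (j - 1)))
        = a j / (?N + 2 * j) * (?N + 2 * j) * \<rho> ^ j"
      proof -
        have gen: "n * (A * X) + 2 * \<rho> * (A * Y) = A * (n + c) * X" if "\<rho> * Y = i * X" "c = 2 * i" for n A X Y c i :: real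
        proof -
          have "n * (A * X) + 2 * \<rho> * (A * Y) = n * (A * X) + 2 * A * (\<rho> * Y)" by simp
          also have "\<dots> = A * (n + c) * X" unfolding that by (simp add: algebra_simps)
          finally show ?thesis .
        qed
        show ?thesis by (rule gen[OF rj]) simp
      qed
      moreover have "?N + 2 * real j \<noteq> 0" by (simp add: add_nonneg_eq_0_iff)
      ultimately show ?thesis by simp
    qed
    thus ?thesis unfolding G_def G'_def K_def sum_distrib_left sum.distrib[symmetric] by simp
  qed
  let ?s = "\<lambda>x :: real ^ 'n. (norm x)\<^sup>2"
  define F where "F \<rho> = G \<rho> * cutoff R \<rho>" for \<rho> :: real
  define F' where "F' \<rho> = G' \<rho> * cutoff R \<rho> + cutoff' R \<rho> * G \<rho>" for \<rho> :: real
  have dF: "(F has_real_derivative F' \<rho>) (at \<rho>)" for \<rho>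
    unfolding F_def[abs_def] F'_def by (intro DERIV_mult dG DERIV_cutoff)
  have F_out: "F (?s x) = 0" "F' (?s x) = 0" if "R < norm x" for x
    using cutoff_outside[OF R, of "norm x"] that by (auto simp: F_def F'_def)
  \<comment> \<open>The components of the cut-off field. Summing the defining identities of the weak
    gradient, with the \<open>i\<close>-th component in direction \<open>i\<close>, produces the
    divergence.\<close>
  define \<psi> where "\<psi> i x = x $ i * F (?s x)" for i and x :: "real ^ 'n"
  have sm: "smooth_expr (\<psi> i)" for i
  proof -
    have "smooth_expr (\<lambda>x::real^'n. G (?s x))"
      unfolding G_def by (intro smooth_expr_sum smooth_expr.intros smooth_expr_power smooth_expr_norm_sq)
    moreover have "smooth_expr (\<lambda>x::real^'n. flat 1 (1 + (- 1 / R\<^sup>2) * ?s x))"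
      by (intro smooth_expr.intros smooth_expr_norm_sq)
    ultimately have "smooth_expr (\<lambda>x::real^'n. x $ i * (G (?s x) * flat 1 (1 + (- 1 / R\<^sup>2) * ?s x)))"
      by (intro smooth_expr.mult smooth_expr.coord)
    thus ?thesis by (simp add: \<psi>_def[abs_def] F_def cutoff_def)
  qed
  have t: "test_function (\<psi> i)" for i
  proof (rule smooth_expr_test_function[OF sm])
    show "norm x \<le> R" if "\<psi> i x \<noteq> 0" for x using F_out(1)[of x] that by (cases "R < norm x") (auto simp: \<psi>_def)
  qed
  have pd: "partial_deriv i (\<psi> i) x = 2 * (x $ i)\<^sup>2 * F' (?s x) + F (?s x)" for i x
  proof -
    have "(?s has_derivative (\<lambda>h. 2 * (x \<bullet> h))) (at x)"
      unfolding power2_norm_eq_inner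
      by (rule has_derivative_eq_rhs[OF has_derivative_inner[OF has_derivative_ident has_derivative_ident]]) (auto simp: inner_commute)
    hence "((\<lambda>x. F (?s x)) has_derivative (\<lambda>h. 2 * (x \<bullet> h) * F' (?s x))) (at x)"
      by (rule DERIV_compose_FDERIV[OF dF])
    hence "(\<psi> i has_derivative (\<lambda>h. x $ i * (2 * (x \<bullet> h) * F' (?s x)) + h $ i * F (?s x))) (at x)"
      unfolding \<psi>_def[abs_def]
      by (intro has_derivative_mult bounded_linear_imp_has_derivative bounded_linear_vec_nth)
    from partial_deriv_eq[OF this, of i] show ?thesis by (simp add: inner_axis power2_eq_square)
  qed
  have li: "locally_integrable \<phi>" "locally_integrable (\<lambda>x. g x $ i)" for i
    using wg locally_integrable_component by (auto simp: is_weak_gradient_def)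
  have i1: "integrable lebesgue (\<lambda>x. \<phi> x * partial_deriv i (\<psi> i) x)" for i
    by (rule integrable_locally_mult_continuous[where R = R, OF li(1) test_functionD(3)[OF t]]) (use F_out in \<open>auto simp: pd\<close>)
  have i2: "integrable lebesgue (\<lambda>x. g x $ i * \<psi> i x)" for i
    by (rule integrable_locally_mult_continuous[where R = R, OF li(2) test_functionD(4)[OF t]]) (use F_out in \<open>auto simp: \<psi>_def\<close>)
  have "(\<integral>x. (\<Sum>i\<in>UNIV. \<phi> x * partial_deriv i (\<psi> i) x) \<partial>lebesgue) = (\<Sum>i\<in>UNIV. \<integral>x. \<phi> x * partial_deriv i (\<psi> i) x \<partial>lebesgue)"
    by (rule Bochner_Integration.integral_sum) (rule i1)
  also have "\<dots> = (\<Sum>i\<in>UNIV. - (\<integral>x. g x $ i * \<psi> i x \<partial>lebesgue))"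
    using wg t unfolding is_weak_gradient_def by (intro sum.cong refl) blast
  also have "\<dots> = - (\<integral>x. (\<Sum>i\<in>UNIV. g x $ i * \<psi> i x) \<partial>lebesgue)"
    by (simp add: sum_negf Bochner_Integration.integral_sum i2)
  also have "(\<lambda>x. \<Sum>i\<in>UNIV. g x $ i * \<psi> i x) = (\<lambda>x. (g x \<bullet> x) * (G (?s x) * cutoff R (?s x)))"
    by (simp add: \<psi>_def F_def inner_vec_def sum_distrib_right mult.assoc)
  also have "(\<lambda>x. \<Sum>i\<in>UNIV. \<phi> x * partial_deriv i (\<psi> i) x) =
    (\<lambda>x. \<phi> x * (K (?s x) * cutoff R (?s x) + 2 * ?s x * G (?s x) * cutoff' R (?s x)))"
  proof
    fix x :: "real ^ 'n"
    have s: "?s x = (\<Sum>i\<in>UNIV. (x $ i)\<^sup>2)"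
      unfolding power2_norm_eq_inner inner_vec_def by (simp add: power2_eq_square)
    have "(\<Sum>i\<in>UNIV. \<phi> x * partial_deriv i (\<psi> i) x) = \<phi> x * (\<Sum>i\<in>UNIV. 2 * F' (?s x) * (x $ i)\<^sup>2 + F (?s x))"
      by (simp add: pd sum_distrib_left mult_ac)
    also have "(\<Sum>i\<in>UNIV. 2 * F' (?s x) * (x $ i)\<^sup>2 + F (?s x)) = 2 * F' (?s x) * ?s x + ?N * F (?s x)"
      unfolding sum.distrib sum_distrib_left[symmetric] s[symmetric] by simp
    also have "\<dots> = (?N * G (?s x) + 2 * ?s x * G' (?s x)) * cutoff R (?s x) + 2 * ?s x * G (?s x) * cutoff' R (?s x)"
      by (simp add: F_def F'_def algebra_simps)
    finally show "(\<Sum>i\<in>UNIV. \<phi> x * partial_deriv i (\<psi> i) x) = \<phi> x * (K (?s x) * cutoff R (?s x) + 2 * ?s x * G (?s x) * cutoff' R (?s x))"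
      by (simp only: NG)
  qed
  finally show ?thesis .
qed

text \<open>Stone-Weierstrass is applied to \<open>k\<close> alone, as a function of the squared
  radius. The approximation of \<open>h\<close> is automatic: \<open>t ^ N * G (t\<^sup>2)\<close>
  and \<open>t ^ (N - 1) * h t\<close> both vanish at 0, and their derivatives differ by at most
  \<open>e * t ^ (N - 1)\<close>.\<close>

lemma radial_polynomial_approx:
  fixes h k :: "real \<Rightarrow> real"
  assumes "1 \<le> N" "0 < R" "0 < e" and ck: "continuous_on {0..} k" and ch: "continuous_on {0..} h" and h0: "h 0 = 0"
    and dh: "\<And>t. 0 < t \<Longrightarrow> ((\<lambda>t. t ^ (N - 1) * h t) has_real_derivative t ^ (N - 1) * k t) (at t)"
  shows "\<exists>m a. \<forall>t\<in>{0..R}. \<bar>(\<Sum>j\<le>m. a j * (t\<^sup>2) ^ j) - k t\<bar> \<le> e \<and>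
     \<bar>t * (\<Sum>j\<le>m. a j / (real N + 2 * j) * (t\<^sup>2) ^ j) - h t\<bar> \<le> e * t / N"
proof -
  have "continuous_on {0..R\<^sup>2} (\<lambda>\<rho>. k (sqrt \<rho>))"
    by (rule continuous_on_compose2[OF ck]) (auto intro!: continuous_intros)
  then obtain P where P: "real_polynomial_function P" "\<And>\<rho>. \<rho> \<in> {0..R\<^sup>2} \<Longrightarrow> \<bar>k (sqrt \<rho>) - P \<rho>\<bar> < e"
    using Stone_Weierstrass_real_polynomial_function[OF compact_Icc _ assms(3)] by metis
  obtain a m where a: "P = (\<lambda>\<rho>. \<Sum>j\<le>m. a j * \<rho> ^ j)" using P(1) real_polynomial_function_iff_sum by auto
  define K where "K \<rho> = (\<Sum>j\<le>m. a j * \<rho> ^ j)" for \<rho>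
  define G where "G \<rho> = (\<Sum>j\<le>m. a j / (real N + 2 * j) * \<rho> ^ j)" for \<rho>
  have K: "\<bar>K (t\<^sup>2) - k t\<bar> \<le> e" if "t \<in> {0..R}" for t
    using P(2)[of "t\<^sup>2"] that power_mono[of t R 2] unfolding a K_def by (simp add: abs_minus_commute)
  have dG: "((\<lambda>t. t ^ N * G (t\<^sup>2)) has_real_derivative t ^ (N - 1) * K (t\<^sup>2)) (at t)" for t
  proof -
    have eq: "(\<lambda>t. t ^ N * G (t\<^sup>2)) = (\<lambda>t. \<Sum>j\<le>m. a j / (real N + 2 * j) * t ^ (N + 2 * j))"
    proof -
      have "t ^ (N + 2 * j) = t ^ N * (t\<^sup>2) ^ j" for t :: real and j by (simp only: power_add power_mult)
      thus ?thesis by (simp add: G_def sum_distrib_left mult.left_commute)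
    qed
    have "((\<lambda>t. \<Sum>j\<le>m. a j / (real N + 2 * j) * t ^ (N + 2 * j)) has_real_derivative
      (\<Sum>j\<le>m. a j / (real N + 2 * j) * (real (N + 2 * j) * t ^ (N + 2 * j - 1)))) (at t)"
      by (rule derivative_eq_intros refl)+ (auto intro!: sum.cong)
    also have "(\<Sum>j\<le>m. a j / (real N + 2 * j) * (real (N + 2 * j) * t ^ (N + 2 * j - 1))) = t ^ (N - 1) * K (t\<^sup>2)"
      unfolding K_def sum_distrib_left
    proof (rule sum.cong[OF refl])
      fix j
      have "N + 2 * j - 1 = (N - 1) + 2 * j" using assms(1) by simp
      hence "t ^ (N + 2 * j - 1) = t ^ (N - 1) * (t\<^sup>2) ^ j" by (simp only: power_add power_mult)
      moreover have "real N + 2 * real j \<noteq> 0" using assms(1) by simp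
      ultimately show "a j / (real N + 2 * j) * (real (N + 2 * j) * t ^ (N + 2 * j - 1)) = t ^ (N - 1) * (a j * (t\<^sup>2) ^ j)"
        by simp
    qed
    finally show ?thesis unfolding eq .
  qed
  have "\<bar>t * G (t\<^sup>2) - h t\<bar> \<le> e * t / N" if t: "t \<in> {0..R}" for t
  proof (cases "t = 0")
    case True thus ?thesis by (simp add: h0)
  next
    case False
    hence t0: "0 < t" using t by simp
    define d where "d s = s ^ N * G (s\<^sup>2) - s ^ (N - 1) * h s" for s
    have dd: "(d has_real_derivative s ^ (N - 1) * (K (s\<^sup>2) - k s)) (at s)" if "0 < s" for s
      unfolding d_def[abs_def] right_diff_distrib by (intro DERIV_diff dG dh that)
    have cG: "continuous_on UNIV (\<lambda>t. t ^ N * G (t\<^sup>2))"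
      using dG DERIV_isCont continuous_at_imp_continuous_on by blast
    have "continuous_on {0..t} h" by (rule continuous_on_subset[OF ch]) auto
    hence cd: "continuous_on {0..t} d" unfolding d_def[abs_def]
      by (intro continuous_on_diff continuous_on_subset[OF cG] continuous_on_mult continuous_intros) auto
    have dE: "((\<lambda>s. e * s ^ N / N) has_real_derivative s ^ (N - 1) * e) (at s)" for s
      using assms(1) by (auto intro!: derivative_eq_intros)
    have cE: "continuous_on {0..t} (\<lambda>s. e * s ^ N / N)" using assms(1) by (intro continuous_intros) auto
    have Ks: "s ^ (N - 1) * (K (s\<^sup>2) - k s) \<le> s ^ (N - 1) * e" "- (s ^ (N - 1) * (K (s\<^sup>2) - k s)) \<le> s ^ (N - 1) * e"
      if "0 < s" "s < t" for s
      unfolding mult_minus_right[symmetric] using K[of s] that t by (intro mult_left_mono; auto simp: abs_le_iff)+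
    have "d t - d 0 \<le> e * t ^ N / N - e * 0 ^ N / N"
    proof (rule deriv_compare_open[OF _ cd cE _ dE])
      fix s assume s: "0 < s" "s < t"
      show "\<exists>f'. (d has_real_derivative f') (at s) \<and> f' \<le> s ^ (N - 1) * e"
        using dd[OF s(1)] Ks(1)[OF s] by (intro exI conjI)
    qed (use t0 in simp)
    moreover have "- d t - - d 0 \<le> e * t ^ N / N - e * 0 ^ N / N"
    proof (rule deriv_compare_open[where f = "\<lambda>t. - d t", OF _ _ cE _ dE])
      show "continuous_on {0..t} (\<lambda>t. - d t)" by (intro continuous_on_minus cd)
      fix s assume s: "0 < s" "s < t"
      show "\<exists>f'. ((\<lambda>t. - d t) has_real_derivative f') (at s) \<and> f' \<le> s ^ (N - 1) * e"
        using DERIV_minus[OF dd[OF s(1)]] Ks(2)[OF s] by (intro exI conjI)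
    qed (use t0 in simp)
    moreover have "d 0 = 0" "(0::real) ^ N = 0" using assms(1) by (auto simp: d_def h0 power_0_left)
    ultimately have "\<bar>d t\<bar> \<le> e * t ^ N / N" by simp
    moreover have "t ^ N = t ^ (N - 1) * t" using assms(1) by (metis power_minus_mult zero_less_one less_le_trans)
    ultimately have "\<bar>t ^ (N - 1) * (t * G (t\<^sup>2) - h t)\<bar> \<le> t ^ (N - 1) * (e * t / N)"
      by (simp add: d_def algebra_simps)
    hence "t ^ (N - 1) * \<bar>t * G (t\<^sup>2) - h t\<bar> \<le> t ^ (N - 1) * (e * t / N)"
      using t0 by (simp only: abs_mult abs_of_pos zero_less_power)
    thus ?thesis using t0 by (simp only: mult_le_cancel_left_pos zero_less_power)
  qed
  thus ?thesis using K unfolding K_def G_def by blast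
qed

lemma LIMSEQ_inverse_bound:
  fixes a :: "nat \<Rightarrow> real"
  assumes "\<And>n. \<bar>a n - l\<bar> \<le> c * (1 / real (Suc n))" shows "a \<longlonglongrightarrow> l"
proof -
  have "(\<lambda>n. c * (1 / real (Suc n))) \<longlonglongrightarrow> c * 0"
    by (intro tendsto_intros lim_1_over_n[THEN LIMSEQ_Suc])
  hence l: "(\<lambda>n. c * (1 / real (Suc n))) \<longlonglongrightarrow> 0" by simp
  have "eventually (\<lambda>n. norm (a n - l) \<le> c * (1 / real (Suc n))) sequentially"
    unfolding real_norm_def by (intro always_eventually allI assms)
  from LIM_zero_cancel[OF Lim_null_comparison[OF this l]] show ?thesis .
qed

lemma measurable_lebesgue_continuous:
  "continuous_on UNIV f \<Longrightarrow> f \<in> borel_measurable (lebesgue :: (real ^ 'n) measure)"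
  by (simp add: measurable_completion borel_measurable_continuous_onI)

lemma radial_measurable:
  "continuous_on {0..} k \<Longrightarrow> (\<lambda>x :: real ^ 'n. k (norm x)) \<in> borel_measurable lebesgue"
  by (rule measurable_lebesgue_continuous, rule continuous_on_compose2[of "{0..}" k]) (auto intro: continuous_intros)

lemma cutoff_measurable:
  "(\<lambda>x :: real ^ 'n. cutoff R ((norm x)\<^sup>2)) \<in> borel_measurable lebesgue"
  "(\<lambda>x :: real ^ 'n. cutoff' R ((norm x)\<^sup>2)) \<in> borel_measurable lebesgue"
proof -
  have "continuous_on UNIV (\<lambda>x :: real ^ 'n. 1 - (norm x)\<^sup>2 * inverse (R\<^sup>2))" by (intro continuous_intros)
  hence c: "continuous_on UNIV (\<lambda>x :: real ^ 'n. flat P (1 - (norm x)\<^sup>2 * inverse (R\<^sup>2)))" for P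
    by (rule continuous_on_compose2[OF continuous_on_flat]) auto
  show "(\<lambda>x :: real ^ 'n. cutoff R ((norm x)\<^sup>2)) \<in> borel_measurable lebesgue"
    "(\<lambda>x :: real ^ 'n. cutoff' R ((norm x)\<^sup>2)) \<in> borel_measurable lebesgue"
    unfolding cutoff_def cutoff'_def divide_inverse by (intro measurable_lebesgue_continuous continuous_intros c)+
qed

text \<open>Passage from polynomials to continuous \<open>k\<close> and \<open>h\<close> for a fixed
  cutoff. What is known of \<open>G\<close> is that \<open>t * G\<close> tends to \<open>h\<close>,
  so one factor \<open>norm x\<close> is always grouped with it; everything is dominated on the ball
  of radius \<open>R\<close>.\<close>

lemma radial_cutoff_identity:
  fixes \<phi> :: "real ^ 'n \<Rightarrow> real"
  assumes wg: "is_weak_gradient \<phi> g" and R: "0 < R"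
    and ck: "continuous_on {0..} k" and ch: "continuous_on {0..} h" and h0: "h 0 = 0"
    and dh: "\<And>t. 0 < t \<Longrightarrow> ((\<lambda>t. t ^ (CARD('n) - 1) * h t) has_real_derivative t ^ (CARD('n) - 1) * k t) (at t)"
  shows "(\<integral>x. \<phi> x * (k (norm x) * cutoff R ((norm x)\<^sup>2) + 2 * norm x * h (norm x) * cutoff' R ((norm x)\<^sup>2)) \<partial>lebesgue)
     = - (\<integral>x. (g x \<bullet> x) * (h (norm x) / norm x * cutoff R ((norm x)\<^sup>2)) \<partial>lebesgue)"
proof -
  let ?N = "CARD('n)"
  have N: "1 \<le> ?N" by (simp add: Suc_leI)
  define Q where "Q n m a \<longleftrightarrow> (\<forall>t\<in>{0..R}. \<bar>(\<Sum>j\<le>m. a j * (t\<^sup>2) ^ j) - k t\<bar> \<le> 1 / real (Suc n) \<and>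
     \<bar>t * (\<Sum>j\<le>m. a j / (real ?N + 2 * j) * (t\<^sup>2) ^ j) - h t\<bar> \<le> 1 / real (Suc n) * t / ?N)" for n m and a :: "nat \<Rightarrow> real"
  have "\<forall>n. \<exists>m. \<exists>a. Q n m a"
    unfolding Q_def by (intro allI radial_polynomial_approx[OF N R _ ck ch h0 dh]) auto
  from choice[OF this] obtain m where "\<forall>n. \<exists>a. Q n (m n) a" by blast
  from choice[OF this] obtain a where "\<forall>n. Q n (m n) (a n)" by blast
  hence ma: "\<And>n t. t \<in> {0..R} \<Longrightarrow> \<bar>(\<Sum>j\<le>m n. a n j * (t\<^sup>2) ^ j) - k t\<bar> \<le> 1 / real (Suc n)"
     "\<And>n t. t \<in> {0..R} \<Longrightarrow> \<bar>t * (\<Sum>j\<le>m n. a n j / (real ?N + 2 * j) * (t\<^sup>2) ^ j) - h t\<bar> \<le> 1 / real (Suc n) * t / ?N"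
    unfolding Q_def by blast+
  define K where "K n t = (\<Sum>j\<le>m n. a n j * (t\<^sup>2) ^ j)" for n and t :: real
  define G where "G n t = (\<Sum>j\<le>m n. a n j / (real ?N + 2 * j) * (t\<^sup>2) ^ j)" for n and t :: real
  let ?c = "\<lambda>x :: real ^ 'n. cutoff R ((norm x)\<^sup>2)" and ?c' = "\<lambda>x :: real ^ 'n. cutoff' R ((norm x)\<^sup>2)"
  have Kk: "\<bar>K n t - k t\<bar> \<le> 1 * (1 / real (Suc n))" if "t \<in> {0..R}" for n t
    using ma(1)[OF that, of n] by (simp add: K_def)
  have Gh: "\<bar>t * G n t - h t\<bar> \<le> R * (1 / real (Suc n))" if t: "t \<in> {0..R}" for n t
  proof -
    have "\<bar>t * G n t - h t\<bar> \<le> 1 / real (Suc n) * t / ?N" using ma(2)[OF t, of n] by (simp add: G_def)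
    also have "\<dots> = t * (1 / real (Suc n)) / ?N" by simp
    also have "\<dots> \<le> R * (1 / real (Suc n)) / 1" using t R N by (intro frac_le mult_right_mono) auto
    finally show ?thesis by simp
  qed
  have eq: "(\<integral>x. \<phi> x * (K n (norm x) * ?c x + 2 * (norm x)\<^sup>2 * G n (norm x) * ?c' x) \<partial>lebesgue)
     = - (\<integral>x. (g x \<bullet> x) * (G n (norm x) * ?c x) \<partial>lebesgue)" for n
    using cutoff_polynomial_identity[OF wg R, where m = "m n" and a = "a n"] unfolding K_def G_def by simp
  have li: "locally_integrable \<phi>" "locally_integrable g" using wg by (auto simp: is_weak_gradient_def)
  note m\<phi> = locally_integrable_measurable[OF li(1)] and mg = locally_integrable_measurable[OF li(2)]
  have mK: "(\<lambda>x::real^'n. K n (norm x)) \<in> borel_measurable lebesgue" "(\<lambda>x::real^'n. G n (norm x)) \<in> borel_measurable lebesgue" for n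
    unfolding K_def G_def by (intro measurable_lebesgue_continuous continuous_intros)+
  have mn: "(\<lambda>x::real^'n. norm x) \<in> borel_measurable lebesgue"
    by (intro measurable_lebesgue_continuous continuous_intros)
  have mgx: "(\<lambda>x. g x \<bullet> x) \<in> borel_measurable lebesgue"
    by (rule borel_measurable_inner[OF mg measurable_lebesgue_continuous[OF continuous_on_id]])
  obtain Mk where Mk: "\<And>t. t \<in> {0..R} \<Longrightarrow> \<bar>k t\<bar> \<le> Mk"
  proof -
    have "bounded (k ` {0..R})" by (intro compact_imp_bounded compact_continuous_image continuous_on_subset[OF ck]) auto
    thus thesis using that unfolding bounded_iff image_iff real_norm_def by blast
  qed
  obtain Mh where Mh: "\<And>t. t \<in> {0..R} \<Longrightarrow> \<bar>h t\<bar> \<le> Mh"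
  proof -
    have "bounded (h ` {0..R})" by (intro compact_imp_bounded compact_continuous_image continuous_on_subset[OF ch]) auto
    thus thesis using that unfolding bounded_iff image_iff real_norm_def by blast
  qed
  obtain B where B: "0 < B" "\<And>R t. 0 < R \<Longrightarrow> 0 \<le> t \<Longrightarrow> \<bar>cutoff' R (t\<^sup>2)\<bar> \<le> B / R\<^sup>2" using cutoff'_bound by blast
  have one: "1 / real (Suc n) \<le> 1" for n by simp
  have Kb: "\<bar>K n t\<bar> \<le> Mk + 1" if "t \<in> {0..R}" for n t
    using Kk[OF that, of n] Mk[OF that] one[of n] by linarith
  have Gb: "\<bar>t * G n t\<bar> \<le> Mh + R" if "t \<in> {0..R}" for n t
  proof -
    have "R * (1 / real (Suc n)) \<le> R * 1" using R one[of n] by (intro mult_left_mono) auto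
    thus ?thesis using Gh[OF that, of n] Mh[OF that] by linarith
  qed
  have Mh0: "0 \<le> Mh" using Mh[of 0] R by simp
  define B1 where "B1 = (Mk + 1) + 2 * R * (Mh + R) * (B / R\<^sup>2)"
  have L1: "(\<lambda>n. \<integral>x. \<phi> x * (K n (norm x) * ?c x + 2 * (norm x)\<^sup>2 * G n (norm x) * ?c' x) \<partial>lebesgue)
     \<longlonglongrightarrow> (\<integral>x. \<phi> x * (k (norm x) * ?c x + 2 * norm x * h (norm x) * ?c' x) \<partial>lebesgue)"
  proof (rule integral_dominated_convergence[where w = "\<lambda>x. norm (indicator (cball 0 R) x *\<^sub>R \<phi> x) * B1"])
    show "integrable lebesgue (\<lambda>x. norm (indicator (cball 0 R) x *\<^sub>R \<phi> x) * B1)"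
      by (intro integrable_mult_left integrable_norm locally_integrable_set_integrable li)
    show "(\<lambda>x. \<phi> x * (k (norm x) * ?c x + 2 * norm x * h (norm x) * ?c' x)) \<in> borel_measurable lebesgue"
      by (intro borel_measurable_times borel_measurable_add borel_measurable_const m\<phi> radial_measurable ck ch mn cutoff_measurable)
    show "(\<lambda>x. \<phi> x * (K n (norm x) * ?c x + 2 * (norm x)\<^sup>2 * G n (norm x) * ?c' x)) \<in> borel_measurable lebesgue" for n
      by (intro borel_measurable_times borel_measurable_add borel_measurable_const borel_measurable_power m\<phi> mK mn cutoff_measurable)
    show "AE x in lebesgue. (\<lambda>n. \<phi> x * (K n (norm x) * ?c x + 2 * (norm x)\<^sup>2 * G n (norm x) * ?c' x))
      \<longlonglongrightarrow> \<phi> x * (k (norm x) * ?c x + 2 * norm x * h (norm x) * ?c' x)"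
    proof (rule AE_I2)
      fix x :: "real ^ 'n"
      show "(\<lambda>n. \<phi> x * (K n (norm x) * ?c x + 2 * (norm x)\<^sup>2 * G n (norm x) * ?c' x))
        \<longlonglongrightarrow> \<phi> x * (k (norm x) * ?c x + 2 * norm x * h (norm x) * ?c' x)"
      proof (cases "norm x \<le> R")
        case True
        hence t: "norm x \<in> {0..R}" by simp
        have "(\<lambda>n. \<phi> x * (K n (norm x) * ?c x + 2 * norm x * (norm x * G n (norm x)) * ?c' x))
          \<longlonglongrightarrow> \<phi> x * (k (norm x) * ?c x + 2 * norm x * h (norm x) * ?c' x)"
          by (intro tendsto_intros LIMSEQ_inverse_bound[OF Kk[OF t]] LIMSEQ_inverse_bound[OF Gh[OF t]])
        thus ?thesis by (simp add: power2_eq_square mult.assoc)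
      qed (use cutoff_outside[OF R, of "norm x"] in simp)
    qed
    show "AE x in lebesgue. norm (\<phi> x * (K n (norm x) * ?c x + 2 * (norm x)\<^sup>2 * G n (norm x) * ?c' x))
      \<le> norm (indicator (cball 0 R) x *\<^sub>R \<phi> x) * B1" for n
    proof (rule AE_I2)
      fix x :: "real ^ 'n"
      show "norm (\<phi> x * (K n (norm x) * ?c x + 2 * (norm x)\<^sup>2 * G n (norm x) * ?c' x))
        \<le> norm (indicator (cball 0 R) x *\<^sub>R \<phi> x) * B1"
      proof (cases "norm x \<le> R")
        case True
        hence t: "norm x \<in> {0..R}" by simp
        have 1: "\<bar>K n (norm x)\<bar> * \<bar>?c x\<bar> \<le> (Mk + 1) * 1"
          using Kb[OF t, of n] cutoff_bounds[of R "(norm x)\<^sup>2"] by (intro mult_mono) auto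
        have 2: "2 * norm x * \<bar>norm x * G n (norm x)\<bar> * \<bar>?c' x\<bar> \<le> 2 * R * (Mh + R) * (B / R\<^sup>2)"
          using Gb[OF t, of n] B(2)[OF R, of "norm x"] True R Mh0 by (intro mult_mono) auto
        have 3: "\<bar>K n (norm x) * ?c x + 2 * (norm x)\<^sup>2 * G n (norm x) * ?c' x\<bar>
          \<le> \<bar>K n (norm x)\<bar> * \<bar>?c x\<bar> + 2 * norm x * \<bar>norm x * G n (norm x)\<bar> * \<bar>?c' x\<bar>"
          by (rule order_trans[OF abs_triangle_ineq]) (simp add: abs_mult power2_eq_square mult.assoc)
        have "\<bar>K n (norm x) * ?c x + 2 * (norm x)\<^sup>2 * G n (norm x) * ?c' x\<bar> \<le> B1"
          using order_trans[OF 3 add_mono[OF 1 2]] by (simp only: B1_def mult_1_right)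
        from mult_left_mono[OF this, of "\<bar>\<phi> x\<bar>"] show ?thesis using True by (simp add: abs_mult)
      qed (use cutoff_outside[OF R, of "norm x"] in simp)
    qed
  qed
  have L2: "(\<lambda>n. \<integral>x. (g x \<bullet> x) * (G n (norm x) * ?c x) \<partial>lebesgue)
     \<longlonglongrightarrow> (\<integral>x. (g x \<bullet> x) * (h (norm x) / norm x * ?c x) \<partial>lebesgue)"
  proof (rule integral_dominated_convergence[where w = "\<lambda>x. norm (indicator (cball 0 R) x *\<^sub>R g x) * (Mh + R)"])
    show "integrable lebesgue (\<lambda>x. norm (indicator (cball 0 R) x *\<^sub>R g x) * (Mh + R))"
      by (intro integrable_mult_left integrable_norm locally_integrable_set_integrable li)
    show "(\<lambda>x. (g x \<bullet> x) * (h (norm x) / norm x * ?c x)) \<in> borel_measurable lebesgue"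
      by (intro borel_measurable_times borel_measurable_divide mgx radial_measurable ch mn cutoff_measurable)
    show "(\<lambda>x. (g x \<bullet> x) * (G n (norm x) * ?c x)) \<in> borel_measurable lebesgue" for n
      by (intro borel_measurable_times mgx mK cutoff_measurable)
    show "AE x in lebesgue. (\<lambda>n. (g x \<bullet> x) * (G n (norm x) * ?c x)) \<longlonglongrightarrow> (g x \<bullet> x) * (h (norm x) / norm x * ?c x)"
    proof (rule AE_I2)
      fix x :: "real ^ 'n"
      show "(\<lambda>n. (g x \<bullet> x) * (G n (norm x) * ?c x)) \<longlonglongrightarrow> (g x \<bullet> x) * (h (norm x) / norm x * ?c x)"
      proof (cases "x = 0 \<or> R < norm x")
        case True
        thus ?thesis using cutoff_outside[OF R, of "norm x"] by auto
      next
        case False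
        hence t: "norm x \<in> {0..R}" "x \<noteq> 0" by auto
        have "(\<lambda>n. (g x \<bullet> x) * (norm x * G n (norm x) / norm x * ?c x)) \<longlonglongrightarrow> (g x \<bullet> x) * (h (norm x) / norm x * ?c x)"
          using t by (intro tendsto_intros LIMSEQ_inverse_bound[OF Gh[OF t(1)]]) auto
        thus ?thesis using t by simp
      qed
    qed
    show "AE x in lebesgue. norm ((g x \<bullet> x) * (G n (norm x) * ?c x)) \<le> norm (indicator (cball 0 R) x *\<^sub>R g x) * (Mh + R)" for n
    proof (rule AE_I2)
      fix x :: "real ^ 'n"
      show "norm ((g x \<bullet> x) * (G n (norm x) * ?c x)) \<le> norm (indicator (cball 0 R) x *\<^sub>R g x) * (Mh + R)"
      proof (cases "norm x \<le> R")
        case True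
        hence t: "norm x \<in> {0..R}" by simp
        have "\<bar>g x \<bullet> x\<bar> * (\<bar>G n (norm x)\<bar> * \<bar>?c x\<bar>) \<le> (norm (g x) * norm x) * (\<bar>G n (norm x)\<bar> * 1)"
          using cutoff_bounds[of R "(norm x)\<^sup>2"] Cauchy_Schwarz_ineq2[of "g x" x] by (intro mult_mono) auto
        also have "\<dots> = norm (g x) * \<bar>norm x * G n (norm x)\<bar>" by (simp add: abs_mult)
        also have "\<dots> \<le> norm (g x) * (Mh + R)" using Gb[OF t, of n] by (intro mult_left_mono) auto
        finally show ?thesis using True by (simp add: abs_mult)
      qed (use cutoff_outside[OF R, of "norm x"] in simp)
    qed
  qed
  have "(\<lambda>n. - (\<integral>x. (g x \<bullet> x) * (G n (norm x) * ?c x) \<partial>lebesgue)) \<longlonglongrightarrow> - (\<integral>x. (g x \<bullet> x) * (h (norm x) / norm x * ?c x) \<partial>lebesgue)"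
    by (rule tendsto_minus[OF L2])
  with L1 show ?thesis unfolding eq by (rule LIMSEQ_unique)
qed

text \<open>The radius of the cutoff tends to infinity. Where \<open>cutoff'\<close> does not
  vanish, \<open>t < R\<close> turns its bound \<open>B / R\<^sup>2\<close>, multiplied by
  \<open>t\<close>, into one of order \<open>1 / (1 + t)\<close>; this explains hypothesis
  \<open>i2\<close>. The term itself tends to 0 pointwise.\<close>

lemma radial_weak_identity:
  fixes \<phi> :: "real ^ 'n \<Rightarrow> real"
  assumes wg: "is_weak_gradient \<phi> g"
    and ck: "continuous_on {0..} k" and ch: "continuous_on {0..} h" and h0: "h 0 = 0"
    and dh: "\<And>t. 0 < t \<Longrightarrow> ((\<lambda>t. t ^ (CARD('n) - 1) * h t) has_real_derivative t ^ (CARD('n) - 1) * k t) (at t)"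
    and i1: "integrable lebesgue (\<lambda>x. \<phi> x * k (norm x))"
    and i2: "integrable lebesgue (\<lambda>x. \<phi> x * (h (norm x) / (1 + norm x)))"
    and i3: "integrable lebesgue (\<lambda>x. norm (g x) * h (norm x))"
  shows "(\<integral>x. \<phi> x * k (norm x) \<partial>lebesgue) = - (\<integral>x. (g x \<bullet> x) * (h (norm x) / norm x) \<partial>lebesgue)"
proof -
  let ?c = "\<lambda>n. \<lambda>x :: real ^ 'n. cutoff (real (Suc n)) ((norm x)\<^sup>2)" and ?c' = "\<lambda>n. \<lambda>x :: real ^ 'n. cutoff' (real (Suc n)) ((norm x)\<^sup>2)"
  have li: "locally_integrable \<phi>" "locally_integrable g" using wg by (auto simp: is_weak_gradient_def)
  note m\<phi> = locally_integrable_measurable[OF li(1)] and mg = locally_integrable_measurable[OF li(2)]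
  have mn: "(\<lambda>x::real^'n. norm x) \<in> borel_measurable lebesgue"
    by (intro measurable_lebesgue_continuous continuous_intros)
  have mgx: "(\<lambda>x. g x \<bullet> x) \<in> borel_measurable lebesgue"
    by (rule borel_measurable_inner[OF mg measurable_lebesgue_continuous[OF continuous_on_id]])
  obtain B where B: "0 < B" "\<And>R t. 0 < R \<Longrightarrow> 0 \<le> t \<Longrightarrow> \<bar>cutoff' R (t\<^sup>2)\<bar> \<le> B / R\<^sup>2" using cutoff'_bound by blast
  have lim_c: "(\<lambda>n. ?c n x) \<longlonglongrightarrow> flat 1 1" for x
  proof -
    have "(\<lambda>n. 1 - (norm x)\<^sup>2 * (1 / real (Suc n))\<^sup>2) \<longlonglongrightarrow> 1 - (norm x)\<^sup>2 * 0\<^sup>2"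
      by (intro tendsto_intros lim_1_over_n[THEN LIMSEQ_Suc])
    hence "(\<lambda>n. flat 1 (1 - (norm x)\<^sup>2 * (1 / real (Suc n))\<^sup>2)) \<longlonglongrightarrow> flat 1 1"
      using continuous_on_flat[of 1] by (intro isCont_tendsto_compose[of _ "flat 1"]) (auto simp: continuous_on_eq_continuous_at)
    thus ?thesis by (simp add: cutoff_def power_divide)
  qed
  have c'_bound: "\<bar>2 * norm x * h (norm x) * ?c' n x\<bar> \<le> 4 * B * \<bar>h (norm x) / (1 + norm x)\<bar>" for n and x :: "real ^ 'n"
  proof (cases "real (Suc n) \<le> norm x")
    case True
    thus ?thesis using cutoff_outside(2)[OF _ True] B by simp
  next
    case False
    let ?R = "real (Suc n)" and ?t = "norm x"
    have R: "1 \<le> ?R" "?t \<le> ?R" using False by auto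
    have t1: "0 < 1 + ?t" using norm_ge_zero[of x] by linarith
    have "?t * \<bar>?c' n x\<bar> \<le> ?R * (B / ?R\<^sup>2)" using R B(2)[of ?R ?t] by (intro mult_mono) auto
    also have "\<dots> = B / ?R" using R by (simp add: power2_eq_square)
    also have "\<dots> = 2 * B / (2 * ?R)" by (rule mult_divide_mult_cancel_left[symmetric]) simp
    also have "\<dots> \<le> 2 * B / (1 + ?t)" using R B t1 by (intro divide_left_mono mult_pos_pos) auto
    finally have "2 * \<bar>h ?t\<bar> * (?t * \<bar>?c' n x\<bar>) \<le> 2 * \<bar>h ?t\<bar> * (2 * B / (1 + ?t))" by (intro mult_left_mono) auto
    thus ?thesis using t1 by (simp add: abs_mult abs_divide mult_ac)
  qed
  have lim_c': "(\<lambda>n. 2 * norm x * h (norm x) * ?c' n x) \<longlonglongrightarrow> 0" for x :: "real ^ 'n"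
  proof (rule LIMSEQ_inverse_bound)
    fix n
    let ?R = "real (Suc n)"
    have "\<bar>?c' n x\<bar> \<le> B / ?R\<^sup>2" using B(2)[of ?R "norm x"] by simp
    also have "\<dots> \<le> B / ?R" using B by (intro divide_left_mono) (auto simp: power2_eq_square)
    finally have "2 * norm x * \<bar>h (norm x)\<bar> * \<bar>?c' n x\<bar> \<le> 2 * norm x * \<bar>h (norm x)\<bar> * (B / ?R)" by (intro mult_left_mono) auto
    thus "\<bar>2 * norm x * h (norm x) * ?c' n x - 0\<bar> \<le> 2 * norm x * \<bar>h (norm x)\<bar> * B * (1 / ?R)"
      by (simp add: abs_mult)
  qed
  have eq: "(\<integral>x. \<phi> x * (k (norm x) * ?c n x + 2 * norm x * h (norm x) * ?c' n x) \<partial>lebesgue)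
     = - (\<integral>x. (g x \<bullet> x) * (h (norm x) / norm x * ?c n x) \<partial>lebesgue)" for n
    by (rule radial_cutoff_identity[OF wg _ ck ch h0 dh]) auto
  have L1: "(\<lambda>n. \<integral>x. \<phi> x * (k (norm x) * ?c n x + 2 * norm x * h (norm x) * ?c' n x) \<partial>lebesgue)
     \<longlonglongrightarrow> (\<integral>x. \<phi> x * (k (norm x) * flat 1 1 + 0) \<partial>lebesgue)"
  proof (rule integral_dominated_convergence[where w = "\<lambda>x. norm (\<phi> x * k (norm x)) + 4 * B * norm (\<phi> x * (h (norm x) / (1 + norm x)))"])
    show "integrable lebesgue (\<lambda>x. norm (\<phi> x * k (norm x)) + 4 * B * norm (\<phi> x * (h (norm x) / (1 + norm x))))"
      by (intro Bochner_Integration.integrable_add integrable_mult_right integrable_norm i1 i2)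
    show "(\<lambda>x. \<phi> x * (k (norm x) * flat 1 1 + 0)) \<in> borel_measurable lebesgue"
      by (intro borel_measurable_times borel_measurable_add borel_measurable_const m\<phi> radial_measurable ck)
    show "(\<lambda>x. \<phi> x * (k (norm x) * ?c n x + 2 * norm x * h (norm x) * ?c' n x)) \<in> borel_measurable lebesgue" for n
      by (intro borel_measurable_times borel_measurable_add borel_measurable_const m\<phi> radial_measurable ck ch mn cutoff_measurable)
    show "AE x in lebesgue. (\<lambda>n. \<phi> x * (k (norm x) * ?c n x + 2 * norm x * h (norm x) * ?c' n x)) \<longlonglongrightarrow> \<phi> x * (k (norm x) * flat 1 1 + 0)"
      by (intro AE_I2 tendsto_mult tendsto_add tendsto_const lim_c lim_c')
    show "AE x in lebesgue. norm (\<phi> x * (k (norm x) * ?c n x + 2 * norm x * h (norm x) * ?c' n x))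
      \<le> norm (\<phi> x * k (norm x)) + 4 * B * norm (\<phi> x * (h (norm x) / (1 + norm x)))" for n
    proof (rule AE_I2)
      fix x :: "real ^ 'n"
      have "\<bar>k (norm x) * ?c n x\<bar> \<le> \<bar>k (norm x)\<bar> * 1"
        unfolding abs_mult using cutoff_bounds[of "real (Suc n)" "(norm x)\<^sup>2"] by (intro mult_left_mono) auto
      from order_trans[OF abs_triangle_ineq add_mono[OF this c'_bound[of x n]]]
      have "\<bar>k (norm x) * ?c n x + 2 * norm x * h (norm x) * ?c' n x\<bar> \<le> \<bar>k (norm x)\<bar> + 4 * B * \<bar>h (norm x) / (1 + norm x)\<bar>"
        by (simp only: mult_1_right)
      from mult_left_mono[OF this, of "\<bar>\<phi> x\<bar>"]
      show "norm (\<phi> x * (k (norm x) * ?c n x + 2 * norm x * h (norm x) * ?c' n x))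
        \<le> norm (\<phi> x * k (norm x)) + 4 * B * norm (\<phi> x * (h (norm x) / (1 + norm x)))"
        unfolding real_norm_def abs_mult[of "\<phi> x"] by (simp only: distrib_left mult.left_commute)
    qed
  qed
  have L2: "(\<lambda>n. \<integral>x. (g x \<bullet> x) * (h (norm x) / norm x * ?c n x) \<partial>lebesgue)
     \<longlonglongrightarrow> (\<integral>x. (g x \<bullet> x) * (h (norm x) / norm x * flat 1 1) \<partial>lebesgue)"
  proof (rule integral_dominated_convergence[where w = "\<lambda>x. norm (norm (g x) * h (norm x))"])
    show "integrable lebesgue (\<lambda>x. norm (norm (g x) * h (norm x)))" by (intro integrable_norm i3)
    show "(\<lambda>x. (g x \<bullet> x) * (h (norm x) / norm x * flat 1 1)) \<in> borel_measurable lebesgue"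
      "(\<lambda>x. (g x \<bullet> x) * (h (norm x) / norm x * ?c n x)) \<in> borel_measurable lebesgue" for n
      by (intro borel_measurable_times borel_measurable_divide borel_measurable_const mgx radial_measurable ch mn cutoff_measurable)+
    show "AE x in lebesgue. (\<lambda>n. (g x \<bullet> x) * (h (norm x) / norm x * ?c n x)) \<longlonglongrightarrow> (g x \<bullet> x) * (h (norm x) / norm x * flat 1 1)"
      by (intro AE_I2 tendsto_mult tendsto_const lim_c)
    show "AE x in lebesgue. norm ((g x \<bullet> x) * (h (norm x) / norm x * ?c n x)) \<le> norm (norm (g x) * h (norm x))" for n
    proof (rule AE_I2)
      fix x :: "real ^ 'n"
      have "\<bar>g x \<bullet> x\<bar> * (\<bar>h (norm x) / norm x\<bar> * \<bar>?c n x\<bar>) \<le> (norm (g x) * norm x) * (\<bar>h (norm x) / norm x\<bar> * 1)"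
        using cutoff_bounds[of "real (Suc n)" "(norm x)\<^sup>2"] Cauchy_Schwarz_ineq2[of "g x" x] by (intro mult_mono) auto
      also have "\<dots> \<le> norm (g x) * \<bar>h (norm x)\<bar>" by (cases "x = 0") (auto simp: abs_divide)
      finally show "norm ((g x \<bullet> x) * (h (norm x) / norm x * ?c n x)) \<le> norm (norm (g x) * h (norm x))"
        by (simp add: abs_mult)
    qed
  qed
  have "(\<integral>x. \<phi> x * (k (norm x) * flat 1 1 + 0) \<partial>lebesgue) = - (\<integral>x. (g x \<bullet> x) * (h (norm x) / norm x * flat 1 1) \<partial>lebesgue)"
    using L1 tendsto_minus[OF L2] unfolding eq by (rule LIMSEQ_unique)
  hence "(\<integral>x. \<phi> x * k (norm x) \<partial>lebesgue) * flat 1 1 = - (\<integral>x. (g x \<bullet> x) * (h (norm x) / norm x) \<partial>lebesgue) * flat 1 1"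
    by (simp only: add_0_right mult.assoc[symmetric] integral_mult_left_zero mult_minus_left)
  moreover have "flat 1 1 \<noteq> 0" by (simp add: flat_def)
  ultimately show ?thesis by (simp only: mult_cancel_right) blast
qed

section \<open>The radial profile as a weak solution\<close>

lemma radial_decay_powr_integrable:
  assumes c: "continuous_on {0..} f" and f: "\<And>t. 0 \<le> t \<Longrightarrow> 0 \<le> f t" "\<And>t. 0 \<le> t \<Longrightarrow> f t \<le> C * (1 + t) powr - \<beta>"
    and e: "0 < e" "real CARD('n) < \<beta> * e"
  shows "integrable lebesgue (\<lambda>x :: real ^ 'n. f (norm x) powr e)"
proof (rule Bochner_Integration.integrable_bound)
  have "0 \<le> C" using f(1)[of 0] f(2)[of 0] by simp
  show "integrable lebesgue (\<lambda>x :: real ^ 'n. C powr e * (1 + norm x) powr - (\<beta> * e))"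
    by (intro integrable_mult_right integrable_radial_decay e)
  show "(\<lambda>x :: real ^ 'n. f (norm x) powr e) \<in> borel_measurable lebesgue"
    by (intro powr_real_measurable radial_measurable c borel_measurable_const)
  have "f (norm x) powr e \<le> C powr e * (1 + norm x) powr - (\<beta> * e)" for x :: "real ^ 'n"
  proof -
    have "f (norm x) powr e \<le> (C * (1 + norm x) powr - \<beta>) powr e" using f e by (intro powr_mono2) auto
    thus ?thesis by (simp add: powr_mult powr_powr)
  qed
  thus "AE x :: real ^ 'n in lebesgue. norm (f (norm x) powr e) \<le> norm (C powr e * (1 + norm x) powr - (\<beta> * e))" by simp
qed

text \<open>Young's inequality supplies the integrable majorant.\<close>

lemma integrable_mult_conjugate:
  fixes f g :: "real ^ 'n \<Rightarrow> real"
  assumes a: "1 < a" "1 < b" "1 / a + 1 / b = 1"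
    and f: "f \<in> borel_measurable lebesgue" "integrable lebesgue (\<lambda>x. \<bar>f x\<bar> powr a)"
    and g: "g \<in> borel_measurable lebesgue" "integrable lebesgue (\<lambda>x. \<bar>g x\<bar> powr b)"
  shows "integrable lebesgue (\<lambda>x. f x * g x)"
proof (rule Bochner_Integration.integrable_bound)
  show "integrable lebesgue (\<lambda>x. \<bar>f x\<bar> powr a / a + \<bar>g x\<bar> powr b / b)"
    by (intro Bochner_Integration.integrable_add integrable_divide f g)
  show "(\<lambda>x. f x * g x) \<in> borel_measurable lebesgue" by (intro borel_measurable_times f g)
  have "norm (f x * g x) \<le> norm (\<bar>f x\<bar> powr a / a + \<bar>g x\<bar> powr b / b)" for x
    using Youngs_inequality[OF a, of "\<bar>f x\<bar>" "\<bar>g x\<bar>"] by (simp add: abs_mult)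
  thus "AE x in lebesgue. norm (f x * g x) \<le> norm (\<bar>f x\<bar> powr a / a + \<bar>g x\<bar> powr b / b)" by simp
qed

text \<open>Away from the origin this is the chain rule. At the origin the vanishing one-sided
  derivative of \<open>u\<close> gives differentiability, and \<open>v 0 = 0\<close> gives
  continuity of the gradient.\<close>

lemma radial_C1:
  fixes u v :: "real \<Rightarrow> real"
  assumes u0: "(u has_real_derivative 0) (at_right 0)" and v0: "v 0 = 0" and cv: "continuous_on {0..} v"
    and du: "\<And>t. 0 < t \<Longrightarrow> (u has_real_derivative - v t) (at t)"
  defines "G \<equiv> \<lambda>x :: real ^ 'n. (- v (norm x) / norm x) *\<^sub>R x"
  shows "((\<lambda>x. u (norm x)) has_derivative (\<lambda>h. G x \<bullet> h)) (at x)" and "continuous_on UNIV G"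
    and "norm (G x) = \<bar>v (norm x)\<bar>"
proof -
  show nG: "norm (G x) = \<bar>v (norm x)\<bar>" for x
    by (cases "x = 0") (auto simp: G_def v0)
  show "((\<lambda>x. u (norm x)) has_derivative (\<lambda>h. G x \<bullet> h)) (at x)"
  proof (cases "x = 0")
    case False
    have "((\<lambda>x. u (norm x)) has_derivative (\<lambda>h. (h \<bullet> sgn x) * - v (norm x))) (at x)"
      by (rule DERIV_compose_FDERIV[OF du has_derivative_norm]) (use False in auto)
    moreover have "(\<lambda>h. (h \<bullet> sgn x) * - v (norm x)) = (\<lambda>h. G x \<bullet> h)"
      by (auto simp: G_def sgn_div_norm inner_commute divide_inverse)
    ultimately show ?thesis by simp
  next
    case True
    have "((\<lambda>t. (u t - u 0) / t) \<longlongrightarrow> 0) (at_right 0)"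
      using u0 by (simp add: has_field_derivative_iff)
    moreover have "filterlim norm (at_right 0) (at (0 :: real ^ 'n))"
      by (auto simp: filterlim_at eventually_at_filter intro!: tendsto_norm_zero tendsto_ident_at)
    ultimately have "((\<lambda>y :: real ^ 'n. (u (norm y) - u 0) / norm y) \<longlongrightarrow> 0) (at 0)"
      by (rule filterlim_compose)
    hence "((\<lambda>y :: real ^ 'n. norm ((u (norm y) - u 0) / norm y)) \<longlongrightarrow> 0) (at 0)" by (rule tendsto_norm_zero)
    thus ?thesis using True by (simp add: has_derivative_at G_def bounded_linear_zero)
  qed
  have cvn: "continuous_on UNIV (\<lambda>x :: real ^ 'n. v (norm x))"
    by (rule continuous_on_compose2[OF cv]) (auto intro: continuous_intros)
  have "isCont G x" for x
  proof (cases "x = 0")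
    case False
    thus ?thesis unfolding G_def using cvn
      by (intro continuous_intros) (auto simp: continuous_on_eq_continuous_at)
  next
    case True
    have "((\<lambda>x :: real ^ 'n. v (norm x)) \<longlongrightarrow> v (norm (0 :: real ^ 'n))) (at 0)"
      using cvn unfolding continuous_on_eq_continuous_at[OF open_UNIV] isCont_def by blast
    hence "((\<lambda>x. norm (G x)) \<longlongrightarrow> 0) (at 0)" unfolding nG by (auto simp: v0 intro: tendsto_rabs_zero)
    hence "(G \<longlongrightarrow> 0) (at 0)" by (rule tendsto_norm_zero_cancel)
    thus ?thesis using True by (simp add: isCont_def G_def)
  qed
  thus "continuous_on UNIV G" by (simp add: continuous_on_eq_continuous_at)
qed

lemma power_field_gradient:
  fixes x :: "real ^ 'n"
  assumes "1 < m" "0 \<le> v" "x = 0 \<Longrightarrow> v = 0"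
  shows "power_field m ((- v / norm x) *\<^sub>R x) = (- (v powr (m - 1)) / norm x) *\<^sub>R x"
proof (cases "v = 0")
  case True thus ?thesis by (simp add: power_field_def)
next
  case False
  hence v: "0 < v" and x: "x \<noteq> 0" using assms by auto
  have "norm ((- v / norm x) *\<^sub>R x) = v" using v x by simp
  moreover have "v powr (m - 2) * v = v powr (m - 1)" using v by (simp add: powr_mult_base mult.commute)
  ultimately show ?thesis by (simp add: power_field_def mult.commute)
qed

lemma power_field_real: "0 < u \<Longrightarrow> power_field m (u :: real) = u powr (m - 1)"
  by (simp add: power_field_def powr_mult_base mult.commute)

lemma is_weak_gradient_weak_grad: "is_weak_gradient u g \<Longrightarrow> is_weak_gradient u (weak_grad u)"
  unfolding weak_grad_def by (rule someI[of "is_weak_gradient u"])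

text \<open>The test function enters through its membership in \<open>D1 q\<close>:
  \<open>\<phi>\<close> is integrable to the power q^* and its gradient to the power
  \<open>q\<close>. The rates of the profile put \<open>k\<close>, \<open>h / (1 + t)\<close> and
  \<open>h\<close> into the dual spaces, so every product in the identity is integrable.\<close>

lemma profile_imp_weak_solution:
  assumes prob: "problem p q CARD('n) r s l" and a: "0 < a" "radial_ode.will_cross p q CARD('n) (exponents.nonlin r s l) a"
  shows "\<exists>u :: real ^ 'n \<Rightarrow> real. weak_solution p q r s l u \<and> (\<forall>x. u x > 0)"
proof -
  interpret problem p q "CARD('n)" r s l by (rule prob)
  let ?N = "real CARD('n)"
  define profile where "profile u v h C \<beta> \<mu> \<longleftrightarrow>
    continuous_on {0..} u \<and> continuous_on {0..} v \<and> v 0 = 0 \<and> (u has_real_derivative 0) (at_right 0) \<and>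
    (\<forall>t\<ge>0. 0 < u t \<and> 0 \<le> v t \<and> h t = v t powr (p - 1) + v t powr (q - 1) \<and>
       h t \<le> C * (1 + t) powr - \<beta> \<and> v t \<le> C * (1 + t) powr - \<mu> \<and> u t \<le> C * (1 + t) powr - (\<mu> - 1)) \<and>
    (\<forall>t>0. (u has_real_derivative - v t) (at t) \<and>
       ((\<lambda>t. t ^ (CARD('n) - 1) * h t) has_real_derivative t ^ (CARD('n) - 1) * nonlin l (u t)) (at t))"
    for u v h :: "real \<Rightarrow> real" and C \<beta> \<mu>
  have "\<exists>u v h. \<exists>C>0. \<exists>\<beta>>?N - ?N / q. \<exists>\<mu>>?N / q. profile u v h C \<beta> \<mu>"
    unfolding profile_def by (rule radial_profile[OF a])
  then obtain u v h C \<beta> \<mu> where C: "0 < C" and \<beta>: "?N - ?N / q < \<beta>" and \<mu>: "?N / q < \<mu>" and pr: "profile u v h C \<beta> \<mu>"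
    by blast
  have cu: "continuous_on {0..} u" and cv: "continuous_on {0..} v" and v0: "v 0 = 0" and u0: "(u has_real_derivative 0) (at_right 0)"
    using pr by (simp_all add: profile_def)
  have pos: "0 < u t" "0 \<le> v t" and h: "h t = v t powr (p - 1) + v t powr (q - 1)"
    and bd: "h t \<le> C * (1 + t) powr - \<beta>" "v t \<le> C * (1 + t) powr - \<mu>" "u t \<le> C * (1 + t) powr - (\<mu> - 1)" if "0 \<le> t" for t
    using pr that unfolding profile_def by blast+
  have du: "(u has_real_derivative - v t) (at t)"
    and dh: "((\<lambda>t. t ^ (CARD('n) - 1) * h t) has_real_derivative t ^ (CARD('n) - 1) * nonlin l (u t)) (at t)" if "0 < t" for t
    using pr that unfolding profile_def by blast+
  have pq: "1 < q" "1 < p" "q < p" "p < ?N" "q < ?N" using q_gt_1 q_less_p p_less_N by auto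
  define \<sigma> where "\<sigma> = ?N / q - 1"
  have \<sigma>: "0 < \<sigma>" "\<sigma> < ?N" "?N / r < \<sigma>" "\<sigma> < \<mu> - 1"
  proof -
    have "?N / q < ?N / 1" using pq by (intro divide_strict_left_mono) auto
    thus "\<sigma> < ?N" by (simp add: \<sigma>_def)
    show "0 < \<sigma>" using pq by (simp add: \<sigma>_def)
    show "?N / r < \<sigma>" "\<sigma> < \<mu> - 1" using r_super \<mu> by (auto simp: \<sigma>_def)
  qed
  define k where "k t = nonlin l (u t)" for t
  have ch: "continuous_on {0..} h"
    by (rule continuous_on_eq[of _ "\<lambda>t. v t powr (p - 1) + v t powr (q - 1)"])
       (use pos h pq in \<open>auto intro!: continuous_on_add continuous_on_powr_pos cv\<close>)
  have h0: "h 0 = 0" using h[of 0] v0 by simp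
  have hnn: "0 \<le> h t" if "0 \<le> t" for t using h[OF that] by simp
  have ck: "continuous_on {0..} k" unfolding k_def nonlin_def
    by (intro continuous_on_add continuous_on_mult continuous_on_const continuous_on_powr_pos cu) (use pos r_s in \<open>auto simp: less_imp_le\<close>)
  have knn: "0 \<le> k t" for t using l_pos by (simp add: k_def nonlin_def)
  define U where "U = (\<lambda>x :: real ^ 'n. u (norm x))"
  define G where "G x = (- v (norm x) / norm x) *\<^sub>R x" for x :: "real ^ 'n"
  have C1: "((\<lambda>x. u (norm x)) has_derivative (\<lambda>h. G x \<bullet> h)) (at x)" "continuous_on UNIV G" "norm (G x) = \<bar>v (norm x)\<bar>" for x
    unfolding G_def[abs_def] using radial_C1[OF u0 v0 cv du] by blast+
  have wgU: "is_weak_gradient U G" unfolding U_def by (rule weak_gradient_C1[OF C1(1,2)])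
  have wgW: "is_weak_gradient U (weak_grad U)" by (rule is_weak_gradient_weak_grad[OF wgU])
  have WG: "AE x in lebesgue. weak_grad U x = G x" by (rule weak_gradient_unique[OF wgW wgU])
  have nG: "norm (G x) = v (norm x)" for x using C1(3)[of x] pos(2)[of "norm x"] by simp
  have mw: "weak_grad w \<in> borel_measurable lebesgue" "(\<lambda>x. norm (weak_grad w x)) \<in> borel_measurable lebesgue"
    if "is_weak_gradient w (weak_grad w)" for w :: "real ^ 'n \<Rightarrow> real"
  proof -
    show m: "weak_grad w \<in> borel_measurable lebesgue"
      using that by (intro locally_integrable_measurable) (simp add: is_weak_gradient_def)
    show "(\<lambda>x. norm (weak_grad w x)) \<in> borel_measurable lebesgue" by (rule measurable_compose[OF m borel_measurable_norm])
  qed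
  have mU: "U \<in> borel_measurable lebesgue" unfolding U_def by (rule radial_measurable[OF cu])
  \<comment> \<open>Since (N / m - 1) times m^* equals N, the critical rate of decay for
    \<open>u\<close> falls as \<open>m\<close> grows. Beating it for \<open>m = q\<close> therefore
    covers \<open>p\<close> as well, and likewise for the gradient.\<close>
  have UD: "U \<in> D1 m" if m: "1 < m" "q \<le> m" "m < ?N" for m
  proof -
    have s: "0 < sobolev_exponent CARD('n) m" using m by (simp add: sobolev_exponent_def)
    have "?N / m - 1 \<le> \<sigma>" using m pq by (simp add: \<sigma>_def divide_left_mono)
    hence "?N / m - 1 < \<mu> - 1" using \<sigma> by simp
    hence "(?N / m - 1) * sobolev_exponent CARD('n) m < (\<mu> - 1) * sobolev_exponent CARD('n) m"
      using s by (intro mult_strict_right_mono)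
    moreover have "(?N / m - 1) * sobolev_exponent CARD('n) m = ?N"
      using m by (simp add: sobolev_exponent_def field_simps)
    ultimately have "integrable lebesgue (\<lambda>x :: real ^ 'n. u (norm x) powr sobolev_exponent CARD('n) m)"
      using s pos bd by (intro radial_decay_powr_integrable[OF cu, of C "\<mu> - 1"]) (auto simp: less_imp_le)
    hence "in_Lp (sobolev_exponent CARD('n) m) U"
      using mU pos by (simp add: in_Lp_def U_def abs_of_pos)
    moreover have "in_Lp m (\<lambda>x. norm (weak_grad U x))"
    proof -
      have "?N < \<mu> * q" using \<mu> pq by (simp add: field_simps)
      also have "\<mu> * q \<le> \<mu> * m" using \<mu> \<sigma> m by (intro mult_left_mono) auto
      finally have "integrable lebesgue (\<lambda>x :: real ^ 'n. v (norm x) powr m)"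
        using m pos bd by (intro radial_decay_powr_integrable[OF cv, of C \<mu>]) auto
      hence "integrable lebesgue (\<lambda>x. \<bar>norm (weak_grad U x)\<bar> powr m)"
      proof (rule integrable_cong_AE_imp)
        show "(\<lambda>x. \<bar>norm (weak_grad U x)\<bar> powr m) \<in> borel_measurable lebesgue"
          using mw(2)[OF wgW] by (simp add: powr_real_measurable)
        show "AE x in lebesgue. v (norm x) powr m = \<bar>norm (weak_grad U x)\<bar> powr m"
          using WG by (rule AE_mp) (auto intro!: AE_I2 simp: nG pos)
      qed
      thus ?thesis using mw(2)[OF wgW] by (simp add: in_Lp_def)
    qed
    ultimately show ?thesis using wgU by (auto simp: D1_def)
  qed
  \<comment> \<open>As before, boundedness of \<open>u\<close>, now by \<open>C\<close>, and
    \<open>r < s\<close> reduce the power of order \<open>s - 1\<close> to the one of order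
    \<open>r - 1\<close>.\<close>
  define K where "K = (1 + l * C powr (s - r)) * C powr (r - 1)"
  have kb: "k t \<le> K * (1 + t) powr - ((r - 1) * (\<mu> - 1))" if t: "0 \<le> t" for t
  proof -
    have ut: "0 < u t" "u t \<le> C * (1 + t) powr - (\<mu> - 1)" using pos bd t by auto
    have "(1 + t) powr - (\<mu> - 1) \<le> 1 powr - (\<mu> - 1)" using t \<sigma> by (intro powr_mono2') auto
    hence "C * (1 + t) powr - (\<mu> - 1) \<le> C * 1" using C by (intro mult_left_mono) auto
    hence uC: "u t \<le> C" using ut by simp
    have "u t powr (s - 1) = u t powr (s - r) * u t powr (r - 1)" by (simp add: powr_add[symmetric])
    also have "\<dots> \<le> C powr (s - r) * u t powr (r - 1)"
      using ut uC r_s by (intro mult_right_mono powr_mono2) auto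
    finally have "k t \<le> u t powr (r - 1) + l * (C powr (s - r) * u t powr (r - 1))"
      unfolding k_def nonlin_def using l_pos by (intro add_mono mult_left_mono) auto
    also have "\<dots> = (1 + l * C powr (s - r)) * u t powr (r - 1)" by (simp add: algebra_simps)
    also have "\<dots> \<le> (1 + l * C powr (s - r)) * (C * (1 + t) powr - (\<mu> - 1)) powr (r - 1)"
      using ut r_s l_pos by (intro mult_left_mono powr_mono2) auto
    also have "\<dots> = K * (1 + t) powr - ((r - 1) * (\<mu> - 1))"
    proof -
      have "- (\<mu> - 1) * (r - 1) = - ((r - 1) * (\<mu> - 1))" by (simp add: algebra_simps)
      thus ?thesis unfolding K_def powr_mult powr_powr by (simp only: mult.assoc)
    qed
    finally show ?thesis .
  qed
  have main: "integrable lebesgue (\<lambda>x. (power_field p (weak_grad U x) + power_field q (weak_grad U x)) \<bullet> weak_grad \<phi> x) \<and>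
      integrable lebesgue (\<lambda>x. (power_field r (U x) + l * power_field s (U x)) * \<phi> x) \<and>
      (\<integral>x. (power_field p (weak_grad U x) + power_field q (weak_grad U x)) \<bullet> weak_grad \<phi> x \<partial>lebesgue)
        = (\<integral>x. (power_field r (U x) + l * power_field s (U x)) * \<phi> x \<partial>lebesgue)"
    if \<phi>: "\<phi> \<in> D1 p \<inter> D1 q" for \<phi> :: "real ^ 'n \<Rightarrow> real"
  proof -
    let ?g = "weak_grad \<phi>"
    have wg: "is_weak_gradient \<phi> ?g" using \<phi> is_weak_gradient_weak_grad by (auto simp: D1_def)
    \<comment> \<open>This is q^*; written as \<open>N / \<sigma>\<close> it makes the conjugate
      exponent \<open>N / (N - \<sigma>)\<close>.\<close>
    define \<alpha> where "\<alpha> = ?N / \<sigma>"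
    have "sobolev_exponent CARD('n) q = \<alpha>"
      using pq by (simp add: sobolev_exponent_def \<alpha>_def \<sigma>_def field_simps)
    hence L\<phi>: "\<phi> \<in> borel_measurable lebesgue" "integrable lebesgue (\<lambda>x. \<bar>\<phi> x\<bar> powr \<alpha>)"
      and Lg: "integrable lebesgue (\<lambda>x. \<bar>norm (?g x)\<bar> powr q)"
      using \<phi> by (auto simp: D1_def in_Lp_def)
    define \<alpha>' where "\<alpha>' = ?N / (?N - \<sigma>)"
    have \<alpha>: "1 < \<alpha>" "1 < \<alpha>'" "1 / \<alpha> + 1 / \<alpha>' = 1" using \<sigma> by (auto simp: \<alpha>_def \<alpha>'_def field_simps)
    define q' where "q' = q / (q - 1)"
    have q': "1 < q'" "1 / q + 1 / q' = 1" using pq by (auto simp: q'_def field_simps)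
    have i1: "integrable lebesgue (\<lambda>x. \<phi> x * k (norm x))"
    proof (rule integrable_mult_conjugate[OF \<alpha> L\<phi> radial_measurable[OF ck]])
      \<comment> \<open>The condition q^* < r in the form \<open>N < r * \<sigma>\<close>: it places
        \<open>k\<close> in the dual of the space containing \<open>\<phi>\<close>.\<close>
      have "?N - \<sigma> < (r - 1) * \<sigma>" using \<sigma> r_s by (simp add: field_simps)
      also have "\<dots> < (r - 1) * (\<mu> - 1)" using \<sigma> r_s by (intro mult_strict_left_mono) auto
      finally have "(?N - \<sigma>) * \<alpha>' < (r - 1) * (\<mu> - 1) * \<alpha>'" using \<alpha> by (intro mult_strict_right_mono) auto
      hence "?N < (r - 1) * (\<mu> - 1) * \<alpha>'" using \<sigma> by (simp add: \<alpha>'_def)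
      hence "integrable lebesgue (\<lambda>x :: real ^ 'n. k (norm x) powr \<alpha>')"
        using \<alpha> knn kb by (intro radial_decay_powr_integrable[OF ck]) auto
      thus "integrable lebesgue (\<lambda>x :: real ^ 'n. \<bar>k (norm x)\<bar> powr \<alpha>')" using knn by simp
    qed
    have i2: "integrable lebesgue (\<lambda>x. \<phi> x * (h (norm x) / (1 + norm x)))"
    proof -
      have c: "continuous_on {0..} (\<lambda>t. h t / (1 + t))" by (intro continuous_intros ch) auto
      show ?thesis
      proof (rule integrable_mult_conjugate[OF \<alpha> L\<phi> radial_measurable[OF c]])
        have "?N - \<sigma> < \<beta> + 1" using \<beta> by (simp add: \<sigma>_def)
        hence "(?N - \<sigma>) * \<alpha>' < (\<beta> + 1) * \<alpha>'" using \<alpha> by (intro mult_strict_right_mono) auto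
        hence N: "?N < (\<beta> + 1) * \<alpha>'" using \<sigma> by (simp add: \<alpha>'_def)
        have "h t / (1 + t) \<le> C * (1 + t) powr - (\<beta> + 1)" if t: "0 \<le> t" for t
        proof -
          have "h t / (1 + t) \<le> C * (1 + t) powr - \<beta> / (1 + t)" using bd(1)[OF t] t by (intro divide_right_mono) auto
          also have "\<dots> = C * (1 + t) powr - (\<beta> + 1)"
          proof -
            have "- (\<beta> + 1) = - \<beta> - 1" by simp
            thus ?thesis using t by (simp only: powr_diff) simp
          qed
          finally show ?thesis .
        qed
        hence "integrable lebesgue (\<lambda>x :: real ^ 'n. (h (norm x) / (1 + norm x)) powr \<alpha>')"
          using \<alpha> hnn N by (intro radial_decay_powr_integrable[OF c]) auto
        thus "integrable lebesgue (\<lambda>x :: real ^ 'n. \<bar>h (norm x) / (1 + norm x)\<bar> powr \<alpha>')"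
          using hnn by (simp add: abs_of_nonneg)
      qed
    qed
    have i3: "integrable lebesgue (\<lambda>x. norm (?g x) * h (norm x))"
    proof (rule integrable_mult_conjugate[OF pq(1) q' mw(2)[OF wg] Lg radial_measurable[OF ch]])
      have "(?N - ?N / q) * q' < \<beta> * q'" using \<beta> q' by (intro mult_strict_right_mono) auto
      moreover have "(?N - ?N / q) * q' = ?N"
      proof -
        have "?N - ?N / q = ?N * ((q - 1) / q)" using pq by (simp add: field_simps)
        thus ?thesis using pq by (simp add: q'_def)
      qed
      ultimately have "integrable lebesgue (\<lambda>x :: real ^ 'n. h (norm x) powr q')"
        using q' hnn bd by (intro radial_decay_powr_integrable[OF ch]) auto
      thus "integrable lebesgue (\<lambda>x :: real ^ 'n. \<bar>h (norm x)\<bar> powr q')" using hnn by simp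
    qed
    have id: "(\<integral>x. \<phi> x * k (norm x) \<partial>lebesgue) = - (\<integral>x. (?g x \<bullet> x) * (h (norm x) / norm x) \<partial>lebesgue)"
      by (rule radial_weak_identity[OF wg ck ch h0 _ i1 i2 i3]) (use dh in \<open>simp add: k_def\<close>)
    have rhs: "(power_field r (U x) + l * power_field s (U x)) * \<phi> x = \<phi> x * k (norm x)" for x
      using pos(1)[of "norm x"] by (simp add: power_field_real U_def k_def nonlin_def mult.commute)
    let ?I = "\<lambda>x. - ((?g x \<bullet> x) * (h (norm x) / norm x))"
    \<comment> \<open>For the explicit gradient the two power fields add up to the radial field of
      length \<open>h\<close> pointing towards the origin; this is where the minus sign comes
      from.\<close>
    have lhs: "AE x in lebesgue. ?I x = (power_field p (weak_grad U x) + power_field q (weak_grad U x)) \<bullet> ?g x"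
    proof (rule AE_mp[OF WG], intro AE_I2 impI)
      fix x assume W: "weak_grad U x = G x"
      have P: "power_field m (G x) = (- (v (norm x) powr (m - 1)) / norm x) *\<^sub>R x" if "1 < m" for m
        unfolding G_def by (rule power_field_gradient) (use that pos v0 in auto)
      have "power_field p (G x) + power_field q (G x) = (- h (norm x) / norm x) *\<^sub>R x"
        unfolding P[OF pq(1)] P[OF pq(2)] scaleR_add_left[symmetric] h[OF norm_ge_zero]
        by (simp add: diff_divide_distrib add_divide_distrib)
      thus "?I x = (power_field p (weak_grad U x) + power_field q (weak_grad U x)) \<bullet> ?g x"
        unfolding W by (simp add: inner_commute)
    qed
    have mI: "?I \<in> borel_measurable lebesgue"
      by (intro borel_measurable_uminus borel_measurable_times borel_measurable_divide radial_measurable ch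
          borel_measurable_inner mw(1)[OF wg] measurable_lebesgue_continuous continuous_on_id continuous_on_norm_id)
    have iI: "integrable lebesgue ?I"
    proof (rule Bochner_Integration.integrable_bound[OF i3 mI], rule AE_I2)
      fix x :: "real ^ 'n"
      have "\<bar>?g x \<bullet> x\<bar> * \<bar>h (norm x) / norm x\<bar> \<le> (norm (?g x) * norm x) * \<bar>h (norm x) / norm x\<bar>"
        by (intro mult_right_mono Cauchy_Schwarz_ineq2) auto
      also have "\<dots> \<le> norm (?g x) * \<bar>h (norm x)\<bar>" by (cases "x = 0") (auto simp: abs_divide)
      finally show "norm (?I x) \<le> norm (norm (?g x) * h (norm x))" by (simp add: abs_mult)
    qed
    have mL: "(\<lambda>x. (power_field p (weak_grad U x) + power_field q (weak_grad U x)) \<bullet> ?g x) \<in> borel_measurable lebesgue"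
      unfolding power_field_def
      by (intro borel_measurable_inner borel_measurable_add borel_measurable_scaleR powr_real_measurable borel_measurable_const mw wg wgW)
    have "integrable lebesgue (\<lambda>x. (power_field p (weak_grad U x) + power_field q (weak_grad U x)) \<bullet> ?g x)"
      by (rule integrable_cong_AE_imp[OF iI mL lhs])
    moreover have "(\<integral>x. (power_field p (weak_grad U x) + power_field q (weak_grad U x)) \<bullet> ?g x \<partial>lebesgue) = (\<integral>x. ?I x \<partial>lebesgue)"
      by (rule integral_cong_AE[OF mL mI]) (use lhs in \<open>auto elim!: AE_mp\<close>)
    ultimately show ?thesis using i1 id by (simp add: rhs)
  qed
  have "weak_solution p q r s l U"
    unfolding weak_solution_def using UD[of p] UD[of q] pq main by auto
  moreover have "\<forall>x. 0 < U x" using pos by (simp add: U_def)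
  ultimately show ?thesis by blast
qed

theorem theorem1p2:
  fixes p q r s :: real
  assumes "CARD('n::finite) \<ge> 2"
    and "1 < q" and "q < p" and "p < real CARD('n)"
    and "sobolev_exponent CARD('n) q < r"
    and "r < sobolev_exponent CARD('n) p"
    and "sobolev_exponent CARD('n) p < s"
    and "p < r"
  shows "\<exists>l0>0. \<forall>l. 0 < l \<and> l < l0 \<longrightarrow>
           (\<exists>u :: real ^ 'n \<Rightarrow> real. weak_solution p q r s l u \<and> (\<forall>x. u x > 0))"
proof -
  let ?N = "real CARD('n)"
  have star: "0 < sobolev_exponent CARD('n) m" "?N / sobolev_exponent CARD('n) m = ?N / m - 1" if "1 < m" "m < ?N" for m
    using that by (auto simp: sobolev_exponent_def field_simps)
  have N: "0 < ?N" by simp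
  note sq = star[of q] and sp = star[of p]
  have ex: "exponents p q CARD('n) r s"
  proof unfold_locales
    show "?N / r < ?N / q - 1"
      unfolding sq(2)[symmetric, OF assms(2) order_less_trans[OF assms(3,4)]]
      using assms sq N by (intro divide_strict_left_mono) auto
    show "?N / p - 1 < ?N / r" "?N / s < ?N / p - 1"
      unfolding sp(2)[symmetric, OF order_less_trans[OF assms(2,3)] assms(4)]
      using assms sp N by (intro divide_strict_left_mono; auto intro!: mult_pos_pos)+
    show "0 < s" using assms sp(1) by linarith
  qed (use assms in auto)
  \<comment> \<open>One initial value \<open>a\<close> crosses for all \<open>l\<close> below
    \<open>l0\<close>; the threshold value found by shooting still varies with
    \<open>l\<close>.\<close>
  obtain a l0 where a: "0 < a" "0 < l0"
    "\<And>l. 0 < l \<and> l < l0 \<Longrightarrow> radial_ode.will_cross p q CARD('n) (exponents.nonlin r s l) a"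
    using exponents.exists_crossing[OF ex] by blast
  have "problem p q CARD('n) r s l" if "0 < l" for l
    using ex that by (simp add: problem_def problem_axioms_def)
  thus ?thesis using a profile_imp_weak_solution by blast
qed

end
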